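(* Let $N\in\mathbb{N}$ and $s>-1$. Define \[ \tilde\pi_N^{(s)}(x)=\frac{(p^{-1-s};p^{-1})_N^2(p^{-1};p^{-1})_N^2}{(p^{-1-s};p^{-1})_{2N}(p^{-1};p^{-1})_x(p^{-1-s};p^{-1})_x(p^{-1};p^{-1})_{N-x}^2}\,p^{-(N-x)^2},\quad 0\le x\le N. \] Then $\tilde\pi_N^{(s)}$ is a probability measure on $\{0,1,\dots,N\}$. Moreover, for every $\mathbf{k}\in\Delta_N$, setting $x_i=\sum_{j=i}^\infty l_j(\mathbf{k})$ for $i\ge0$ and $y_i=N-\sum_{j=-i}^\infty l_j(\mathbf{k})$ for $i\ge0$ (so $y_0=N-x_0$), \[ \mathsf{m}_N^{(s)}(\mathbf{k})=\tilde\pi_N^{(s)}(x_0)\prod_{i=0}^\infty\mathsf{P}^{(s)}(x_i,x_{i+1})\prod_{i=0}^\infty\mathsf{P}^{(0)}(y_i,y_{i+1}). \] Equivalently, a $\mathbf{k}$ with law $\mathsf{m}_N^{(s)}$ can be sampled by drawing $\sum_{i\ge0}l_i(\mathbf{k})$ from $\tilde\pi_N^{(s)}$, then running from it a Markov chain with kernel $\mathsf{P}^{(s)}$ to produce $\sum_{i\ge1}l_i(\mathbf{k}),\sum_{i\ge2}l_i(\mathbf{k}),\dots$, and (independently given the starting point) running from $N-\sum_{i\ge0}l_i(\mathbf{k})$ a Markov chain with kernel $\mathsf{P}^{(0)}$ to produce $N-\sum_{i\ge-1}l_i(\mathbf{k}),N-\sum_{i\ge-2}l_i(\mathbf{k}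),\dots$.
   Context: $(\alpha;q)_N=\prod_{j=0}^{N-1}(1-\alpha q^j)$. $\mathsf{vol}$ is the Haar measure on $\mathrm{Mat}(N,\mathbb{Q}_p)$ with $\mathsf{vol}(\mathrm{Mat}(N,\mathbb{Z}_p))=1$. Every $\mathbf{Z}\in\mathrm{Mat}(N,\mathbb{Q}_p)$ is $\mathbf{B}\,\mathrm{diag}(p^{-k_1},\dots,p^{-k_N})\,\mathbf{C}$ with $\mathbf{B},\mathbf{C}\in\mathrm{GL}(N,\mathbb{Z}_p)$ and unique $k_1\ge\dots\ge k_N\ge-\infty$ ($p^{-(-\infty)}=0$); $\mathsf{Sing}_N(\mathbf{Z})=(k_1,\dots,k_N)\in\Delta_N=\{(k_1,\dots,k_N)\in(\mathbb{Z}\cup\{-\infty\})^N:k_1\ge\dots\ge k_N\}$. $l_i(\mathbf{k})=\#\{j:k_j=i\}$ for $i\in\mathbb{Z}\cup\{-\infty\}$; sums $\sum_{j=m}^\infty$ run over integers $j\ge m$. $\gamma(\mathbf{Z})=\prod_{j:k_j>0}p^{k_j}$ ($=1$ if none); $d\mathsf{M}_N^{(s)}(\mathbf{Z})=\frac{(p^{-1-s};p^{-1})_N^2}{(p^{-1-s};p^{-1})_{2N}}\gamma(\mathbf{Z})^{-s-2N}d\mathsf{vol}(\mathbf{Z})$ is a probability measure and $\mathsf{m}_N^{(s)}=(\mathsf{Sing}_N)_*\mathsf{M}_N^{(s)}$. For $s>-1$, $\mathsf{P}^{(s)}(x_1,x_2)=\frac{p^{-x_2^2-sx_2}(p^{-1};p^{-1})_{x_1}(p^{-1-s};p^{-1})_{x_1}}{(p^{-1};p^{-1})_{x_2}(p^{-1};p^{-1})_{x_1-x_2}(p^{-1-s};p^{-1})_{x_2}}\mathbf{1}(0\le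 x_2\le x_1)$ for $x_1,x_2\in\mathbb{Z}_+$; it is a Markov kernel on $\mathbb{Z}_+$. *)

theory Defs
  imports "HOL-Probability.Probability" "HOL-Number_Theory.Number_Theory"
begin

definition qpoch :: "real \<Rightarrow> real \<Rightarrow> nat \<Rightarrow> real" where
  "qpoch a q n = (\<Prod>j<n. 1 - a * q ^ j)"

definition Pker :: "nat \<Rightarrow> real \<Rightarrow> nat \<Rightarrow> nat \<Rightarrow> real" where
  "Pker p s x1 x2 =
     (if x2 \<le> x1 then
        real p powr (- real (x2^2) - s * real x2) * qpoch (1/p) (1/p) x1
          * qpoch (real p powr (-1-s)) (1/p) x1
        / (qpoch (1/p) (1/p) x2 * qpoch (1/p) (1/p) (x1 - x2)
           * qpoch (real p powr (-1-s)) (1/p) x2)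
      else 0)"

definition pitilde :: "nat \<Rightarrow> nat \<Rightarrow> real \<Rightarrow> nat \<Rightarrow> real" where
  "pitilde p N s x =
     qpoch (real p powr (-1-s)) (1/p) N ^ 2 * qpoch (1/p) (1/p) N ^ 2
     / (qpoch (real p powr (-1-s)) (1/p) (2*N) * qpoch (1/p) (1/p) x
        * qpoch (real p powr (-1-s)) (1/p) x * qpoch (1/p) (1/p) (N - x) ^ 2)
     * real p powr (- real ((N - x)^2))"

definition Delta :: "nat \<Rightarrow> ereal list set" where
  "Delta N = {k. length k = N \<and> sorted_wrt (\<ge>) k
                 \<and> (\<forall>v\<in>set k. v = -\<infinity> \<or> (\<exists>i::int. v = ereal (of_int i)))}"

definition lcount :: "ereal list \<Rightarrow> ereal \<Rightarrow> nat" where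
  "lcount k i = length (filter (\<lambda>v. v = i) k)"

text \<open>sum_{j=i}^\<infinity> l_j(k) for integer i: the number of entries that are integers >= i
  (only finitely many j contribute).\<close>
definition ltail :: "ereal list \<Rightarrow> int \<Rightarrow> nat" where
  "ltail k i = (\<Sum>j\<in>{j::int. i \<le> j \<and> ereal (of_int j) \<in> set k}. lcount k (ereal (of_int j)))"

text \<open>An element of Q_p is represented by its p-adic digit expansion (int \<Rightarrow> nat, digits < p,
  digits vanishing for sufficiently negative index); an element of Z_p by a digit sequence
  nat \<Rightarrow> nat. An N x N matrix over Q_p is a function (row, column, digit index) \<Rightarrow> digit,
  zero outside the N x N block.\<close>

type_synonym qmat = "nat \<Rightarrow> nat \<Rightarrow> int \<Rightarrow> nat"
type_synonym zmat = "nat \<Rightarrow> nat \<Rightarrow> nat \<Rightarrow> nat"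

definition qmat_space :: "nat \<Rightarrow> nat \<Rightarrow> qmat set" where
  "qmat_space p N = {Z. (\<forall>a b j. Z a b j < p) \<and> (\<forall>a b j. (N \<le> a \<or> N \<le> b) \<longrightarrow> Z a b j = 0)
                       \<and> (\<exists>m::nat. \<forall>a b j. j < - int m \<longrightarrow> Z a b j = 0)}"

definition zmat_space :: "nat \<Rightarrow> nat \<Rightarrow> zmat set" where
  "zmat_space p N = {B. (\<forall>a b j. B a b j < p) \<and> (\<forall>a b j. (N \<le> a \<or> N \<le> b) \<longrightarrow> B a b j = 0)}"

definition trunc :: "nat \<Rightarrow> nat \<Rightarrow> (nat \<Rightarrow> nat) \<Rightarrow> int" where
  "trunc p n d = (\<Sum>i<n. int (d i) * int p ^ i)"

text \<open>GL(N, Z_p): matrices over Z_p with a two-sided inverse over Z_p (identities in Z_p are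
  identities modulo every p^n).\<close>
definition GLZp :: "nat \<Rightarrow> nat \<Rightarrow> zmat set" where
  "GLZp p N = {B \<in> zmat_space p N. \<exists>B' \<in> zmat_space p N. \<forall>n a b. a < N \<longrightarrow> b < N \<longrightarrow>
      [(\<Sum>c<N. trunc p n (B a c) * trunc p n (B' c b)) = (if a = b then 1 else 0)] (mod int p ^ n)
    \<and> [(\<Sum>c<N. trunc p n (B' a c) * trunc p n (B c b)) = (if a = b then 1 else 0)] (mod int p ^ n)}"

text \<open>Z = B diag(p^{-k_1},...,p^{-k_N}) C with B, C in GL(N,Z_p). Equivalently (after multiplying
  by p^m for m large), p^m Z = B diag(p^{m-k_i}) C as matrices over Z_p, where p^{-(-\<infinity>)} = 0.\<close>
definition sing_rel :: "nat \<Rightarrow> nat \<Rightarrow> qmat \<Rightarrow> ereal list \<Rightarrow> bool" where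
  "sing_rel p N Z k \<longleftrightarrow> k \<in> Delta N \<and>
     (\<exists>B\<in>GLZp p N. \<exists>C\<in>GLZp p N. \<exists>m::nat.
        (\<forall>a b j. j < - int m \<longrightarrow> Z a b j = 0) \<and> (\<forall>v\<in>set k. v \<le> ereal (real m)) \<and>
        (\<forall>n a b. a < N \<longrightarrow> b < N \<longrightarrow>
           [trunc p n (\<lambda>i. Z a b (int i - int m)) =
              (\<Sum>c<N. trunc p n (B a c)
                   * (if k ! c = -\<infinity> then 0 else int p ^ nat (int m - \<lfloor>real_of_ereal (k ! c)\<rfloor>))
                   * trunc p n (C c b))] (mod int p ^ n)))"

definition Sing :: "nat \<Rightarrow> nat \<Rightarrow> qmat \<Rightarrow> ereal list" where
  "Sing p N Z = (THE k. sing_rel p N Z k)"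

definition gammaZ :: "nat \<Rightarrow> nat \<Rightarrow> qmat \<Rightarrow> real" where
  "gammaZ p N Z = (let k = Sing p N Z in
      (\<Prod>q\<in>{q. q < N \<and> k ! q > 0}. real p powr real_of_ereal (k ! q)))"

definition qmat_gen :: "nat \<Rightarrow> nat \<Rightarrow> qmat set set" where
  "qmat_gen p N = {{Z \<in> qmat_space p N. Z a b j = d} | a b j d. True}"

definition digit_idx :: "nat \<Rightarrow> nat \<Rightarrow> (nat \<times> nat \<times> int) set" where
  "digit_idx N m = {(a, b, j). a < N \<and> b < N \<and> - int m \<le> j}"

definition digit_emb :: "nat \<Rightarrow> nat \<Rightarrow> (nat \<times> nat \<times> int \<Rightarrow> nat) \<Rightarrow> qmat" where
  "digit_emb N m f = (\<lambda>a b j. if (a, b, j) \<in> digit_idx N m then f (a, b, j) else 0)"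

text \<open>Haar measure restricted to p^{-m} Mat(N,Z_p), divided by p^{m N^2}: image of the product of
  uniform digit distributions.\<close>
definition vol_m :: "nat \<Rightarrow> nat \<Rightarrow> nat \<Rightarrow> qmat measure" where
  "vol_m p N m = distr (PiM (digit_idx N m) (\<lambda>_. measure_pmf (pmf_of_set {0..<p})))
                       (sigma (qmat_space p N) (qmat_gen p N)) (digit_emb N m)"

text \<open>Haar measure vol on Mat(N,Q_p), normalized by vol(Mat(N,Z_p)) = 1.\<close>
definition vol :: "nat \<Rightarrow> nat \<Rightarrow> qmat measure" where
  "vol p N = measure_of (qmat_space p N) (qmat_gen p N)
               (\<lambda>A. SUP m. ennreal (real p ^ (m * N * N)) * emeasure (vol_m p N m) A)"

definition Mconst :: "nat \<Rightarrow> nat \<Rightarrow> real \<Rightarrow> real" where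
  "Mconst p N s = qpoch (real p powr (-1-s)) (1/p) N ^ 2 / qpoch (real p powr (-1-s)) (1/p) (2*N)"

definition Mmeas :: "nat \<Rightarrow> nat \<Rightarrow> real \<Rightarrow> qmat measure" where
  "Mmeas p N s = density (vol p N)
      (\<lambda>Z. ennreal (Mconst p N s * gammaZ p N Z powr (- s - 2 * real N)))"

definition mmeas :: "nat \<Rightarrow> nat \<Rightarrow> real \<Rightarrow> ereal list \<Rightarrow> ennreal" where
  "mmeas p N s k = emeasure (Mmeas p N s) (Sing p N -` {k} \<inter> space (Mmeas p N s))"

end

theory Submission
  imports Defs
begin

text \<open>
  After scaling by \<open>p\<^sup>m\<close> the event that \<open>Z\<close> has singular numbers \<open>k\<close> says that, for every \<open>i\<close>, exactly
  \<open>c\<^sub>i\<close> elementary divisors of an integral matrix are divisible by \<open>p\<^sup>i\<close>; equivalently, the kernel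
  modulo \<open>p\<^sup>i\<close> has \<open>p\<close> to the power \<open>c\<^sub>1 + \<dots> + c\<^sub>i\<close> elements for all \<open>i\<close>. A uniform matrix of size \<open>c\<^sub>0\<close> has
  corank \<open>c\<^sub>1\<close> modulo \<open>p\<close> with probability \<open>Pker p 0 c\<^sub>0 c\<^sub>1\<close>, and then it is equivalent to the direct
  sum of an identity matrix and \<open>p\<close> times a uniform matrix of size \<open>c\<^sub>1\<close>. So \<open>c\<^sub>0, c\<^sub>1, \<dots>\<close> is a Markov
  chain with kernel \<open>Pker p 0\<close>. The indices beyond \<open>m\<close> give the chain \<open>y\<close>, and the density \<open>gammaZ\<close>
  turns the time reversal of the first \<open>m + 1\<close> steps into the chain \<open>x\<close> with kernel \<open>Pker p s\<close>.
  Elements of \<open>\<int>\<^sub>p\<close> are handled as sequences of integers that are coherent modulo the powers of \<open>p\<close>.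
\<close>

section \<open>The q-Vandermonde identity\<close>

text \<open>Kernel sizes serve as the invariant because invertible factors on either side preserve
  them, because each of them sees only finitely many digits, and because they can be counted by
  exposing columns. One family of numbers thus yields the uniqueness of \<open>k\<close>, the
  measurability of \<open>Sing\<close> and its law. No finite modulus separates an entry
  \<open>-\<infinity>\<close> from a very negative one. The event that \<open>Sing\<close> takes the
  value \<open>k\<close> is therefore a decreasing limit of digit events, and the infinite product
  over the chain \<open>y\<close> converges because a probability measure is continuous along such
  limits. The scale \<open>m\<close> is arbitrary as long as it bounds the entries of
  \<open>k\<close>. That the scaled volumes do not depend on it makes the supremum in
  \<open>vol\<close> computable; the independence comes from completing a square in the exponents,
  which is also what fixes the exponent \<open>- s - 2 * N\<close> of the density. The total mass of
  \<open>pitilde\<close> is obtained separately from a q-Vandermonde sum, in which one upper index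
  is the real number \<open>N + s\<close>.\<close>

lemma qpoch_0 [simp]: "qpoch a q 0 = 1"
  by (simp add: qpoch_def)

lemma qpoch_Suc: "qpoch a q (Suc n) = qpoch a q n * (1 - a * q ^ n)"
  by (simp add: qpoch_def)

lemma qpoch_pos:
  assumes "0 \<le> a" "a < 1" "0 \<le> q" "q \<le> 1"
  shows "qpoch a q n > 0"
  unfolding qpoch_def
proof (intro prod_pos ballI)
  fix j
  have "a * q ^ j \<le> a * 1"
    using assms by (intro mult_left_mono power_le_one) auto
  with assms show "0 < 1 - a * q ^ j" by simp
qed

definition qbinom :: "real \<Rightarrow> nat \<Rightarrow> nat \<Rightarrow> real" where
  "qbinom t n j = (if j \<le> n then qpoch t t n / (qpoch t t j * qpoch t t (n - j)) else 0)"

text \<open>The Gaussian binomial coefficient of \<open>\<beta>\<close> over \<open>r\<close> as a function of \<open>B = t\<^sup>\<beta>\<close>, so that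
  \<open>\<beta>\<close> need not be a natural number.\<close>
definition gqbinom :: "real \<Rightarrow> real \<Rightarrow> nat \<Rightarrow> real" where
  "gqbinom t B r = (\<Prod>i<r. 1 - B / t ^ i) / qpoch t t r"

lemma qpoch_base_pos: "0 < t \<Longrightarrow> t < 1 \<Longrightarrow> qpoch t t n > 0"
  by (rule qpoch_pos) auto

text \<open>The Pascal rule: the last factor of the numerator splits as
  \<open>v + t ^ Suc d * u\<close>, where \<open>u\<close> and \<open>v\<close> are the last factors
  of the two symbols in the denominator.\<close>

lemma qbinom_Suc_Suc:
  assumes t: "0 < t" "t < 1" and "j \<le> n"
  shows "qbinom t (Suc n) (Suc j) = qbinom t n (Suc j) + t ^ (n - j) * qbinom t n j"
proof -
  have P: "qpoch t t m \<noteq> 0" for m using qpoch_base_pos[OF t, of m] by simp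
  have P': "1 - t * t ^ m \<noteq> 0" for m using power_Suc_less_one[OF t(1) t(2), of m] t by simp
  show ?thesis
  proof (cases "j = n")
    case True
    then show ?thesis using P by (simp add: qbinom_def)
  next
    case False
    then obtain d where d: "n = Suc (j + d)"
      using \<open>j \<le> n\<close> less_imp_Suc_add le_neq_implies_less by metis
    define u where "u = 1 - t * t ^ j"
    define v where "v = 1 - t * t ^ d"
    have nz: "u \<noteq> 0" "v \<noteq> 0" using P' by (auto simp: u_def v_def)
    have "1 - t * t ^ n = v + t ^ Suc d * u"
      unfolding d u_def v_def by (simp add: power_add algebra_simps)
    then have e1: "qbinom t (Suc n) (Suc j) = qpoch t t n * (v + t ^ Suc d * u)
        / ((qpoch t t j * u) * (qpoch t t d * v))"
      unfolding qbinom_def qpoch_Suc[of _ _ n] by (simp add: d qpoch_Suc u_def v_def)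
    have e2: "qbinom t n (Suc j) = qpoch t t n / ((qpoch t t j * u) * qpoch t t d)"
      unfolding qbinom_def by (simp add: d qpoch_Suc u_def)
    have e3: "qbinom t n j = qpoch t t n / (qpoch t t j * (qpoch t t d * v))"
      unfolding qbinom_def by (simp add: d qpoch_Suc v_def Suc_diff_le)
    have e4: "n - j = Suc d" by (simp add: d)
    show ?thesis unfolding e1 e2 e3 e4 using P[of j] P[of d] nz by (simp add: field_simps)
  qed
qed

text \<open>Passing from \<open>B\<close> to \<open>B * t\<close> raises \<beta> by one, so this is
  the other Pascal rule, for real \<beta>, with the power of \<open>t\<close> on the term of
  unchanged lower index.\<close>

lemma gqbinom_Suc:
  assumes t: "0 < t" "t < 1"
  shows "gqbinom t (B * t) (Suc r) = gqbinom t B r + t ^ Suc r * gqbinom t B (Suc r)"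
proof -
  have P: "qpoch t t m \<noteq> 0" for m using qpoch_base_pos[OF t, of m] by simp
  have P': "1 - t * t ^ m \<noteq> 0" for m using power_Suc_less_one[OF t(1) t(2), of m] t by simp
  define X where "X = (\<Prod>i<r. 1 - B / t ^ i)"
  have "(\<Prod>i<Suc r. 1 - B * t / t ^ i) = (1 - B * t) * X"
    unfolding X_def using t by (subst prod.lessThan_Suc_shift) (simp add: field_simps)
  then have 1: "gqbinom t (B * t) (Suc r) = (1 - B * t) * X / (qpoch t t r * (1 - t * t ^ r))"
    by (simp add: gqbinom_def qpoch_Suc)
  have 2: "gqbinom t B r = X / qpoch t t r" by (simp add: gqbinom_def X_def)
  have 3: "gqbinom t B (Suc r) = X * (1 - B / t ^ r) / (qpoch t t r * (1 - t * t ^ r))"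
    by (simp add: gqbinom_def qpoch_Suc X_def)
  show ?thesis
    unfolding 1 2 3 using P[of r] P'[of r] t by (simp add: field_simps)
qed

text \<open>The Pascal rule for \<open>qbinom\<close> produces one sum with the same
  \<open>d\<close> and one whose index is shifted, which is an instance for \<open>Suc d\<close>;
  hence the induction keeps \<open>d\<close> arbitrary. The two values recombine by
  \<open>gqbinom_Suc\<close>.\<close>

lemma q_Vandermonde:
  assumes t: "0 < t" "t < 1"
  shows "(\<Sum>j\<le>n. qbinom t n j * gqbinom t B (j + d) * t ^ (j * (j + d))) = gqbinom t (B * t ^ n) (n + d)"
proof (induction n arbitrary: d)
  case 0
  then show ?case by (simp add: qbinom_def)
next
  case (Suc n)
  have P: "qpoch t t m \<noteq> 0" for m using qpoch_base_pos[OF t, of m] by simp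
  define f where "f j = gqbinom t B (j + d) * t ^ (j * (j + d))" for j
  have "(\<Sum>j\<le>Suc n. qbinom t (Suc n) j * f j)
      = qbinom t (Suc n) 0 * f 0 + (\<Sum>j\<le>n. qbinom t (Suc n) (Suc j) * f (Suc j))"
    by (rule sum.atMost_Suc_shift)
  also have "\<dots> = (qbinom t n 0 * f 0 + (\<Sum>j\<le>n. qbinom t n (Suc j) * f (Suc j)))
      + (\<Sum>j\<le>n. t ^ (n - j) * qbinom t n j * f (Suc j))"
    using P by (simp add: qbinom_Suc_Suc[OF t] distrib_right sum.distrib) (simp add: qbinom_def)
  also have "qbinom t n 0 * f 0 + (\<Sum>j\<le>n. qbinom t n (Suc j) * f (Suc j)) = (\<Sum>j\<le>Suc n. qbinom t n j * f j)"
    by (rule sum.atMost_Suc_shift[symmetric])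
  also have "\<dots> = (\<Sum>j\<le>n. qbinom t n j * f j)" by (simp add: qbinom_def)
  also have "\<dots> = gqbinom t (B * t ^ n) (n + d)"
    using Suc.IH[of d] by (simp add: f_def mult.assoc)
  also have "(\<Sum>j\<le>n. t ^ (n - j) * qbinom t n j * f (Suc j)) =
     t ^ Suc (n + d) * (\<Sum>j\<le>n. qbinom t n j * gqbinom t B (j + Suc d) * t ^ (j * (j + Suc d)))"
    unfolding sum_distrib_left
  proof (rule sum.cong[OF refl])
    fix j assume "j \<in> {..n}"
    then have "n - j + Suc j * (Suc j + d) = Suc (n + d) + j * (j + Suc d)" by (simp add: algebra_simps)
    then have "t ^ (n - j) * t ^ (Suc j * (Suc j + d)) = t ^ Suc (n + d) * t ^ (j * (j + Suc d))"
      by (simp only: power_add[symmetric])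
    then show "t ^ (n - j) * qbinom t n j * f (Suc j) =
       t ^ Suc (n + d) * (qbinom t n j * gqbinom t B (j + Suc d) * t ^ (j * (j + Suc d)))"
      unfolding f_def add_Suc_shift by (metis mult.assoc mult.left_commute)
  qed
  also have "\<dots> = t ^ Suc (n + d) * gqbinom t (B * t ^ n) (Suc (n + d))"
    unfolding Suc.IH by simp
  also have "gqbinom t (B * t ^ n) (n + d) + \<dots> = gqbinom t (B * t ^ n * t) (Suc (n + d))"
    by (rule gqbinom_Suc[OF t, symmetric])
  finally show ?case by (simp add: f_def mult_ac)
qed

text \<open>For \<open>B = a * t ^ n / t\<close> the numerator of \<open>gqbinom t B j\<close>
  consists of the last \<open>j\<close> factors of \<open>qpoch a t n\<close> in reverse
  order.\<close>

lemma prod_rev_eq_qpoch: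
  assumes "t \<noteq> 0" "j \<le> n"
  shows "(\<Prod>i<j. 1 - (a * t ^ n / t) / t ^ i) * qpoch a t (n - j) = qpoch a t n"
  using assms(2)
proof (induction j)
  case 0
  then show ?case by simp
next
  case (Suc j)
  then have e: "n - j = Suc (n - Suc j)" by simp
  have n: "n = (n - Suc j) + j + 1" using Suc.prems by simp
  have "t ^ n = t ^ (n - Suc j) * t ^ j * t"
    by (subst n) (simp only: power_add power_one_right)
  then have "a * t ^ n / t / t ^ j = a * t ^ (n - Suc j)"
    using assms(1) by (simp add: field_simps)
  then show ?case using Suc.IH Suc.prems unfolding e qpoch_Suc by (simp add: mult_ac)
qed

section \<open>Total mass of the starting law\<close>

lemma pitilde_nonneg:
  assumes "prime p" "s > -1"
  shows "pitilde p N s x \<ge> 0"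
proof -
  have p: "real p > 1" using prime_gt_1_nat[OF assms(1)] by simp
  then have "real p powr (-1-s) < 1" using assms(2)
    by (simp add: powr_less_one)
  then have "qpoch (real p powr (-1-s)) (1/p) n > 0" for n using p by (intro qpoch_pos) auto
  moreover have "qpoch (1/p) (1/p) n > 0" for n using p by (intro qpoch_pos) auto
  ultimately show ?thesis unfolding pitilde_def
    by (intro mult_nonneg_nonneg divide_nonneg_nonneg) (simp_all add: less_imp_le)
qed

text \<open>With \<open>x = N - j\<close> the weights become the terms of the q-Vandermonde sum for
  \<open>d = 0\<close> and \<open>B\<close> equal to \<open>t\<close> to the power
  \<open>N + s\<close>, since \<open>a\<close> is \<open>t\<close> to the power
  \<open>1 + s\<close>. The prefactor is the reciprocal of the resulting Gaussian binomial.\<close>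

lemma sum_pitilde:
  assumes "prime p" "s > -1"
  shows "(\<Sum>x\<le>N. pitilde p N s x) = 1"
proof -
  define t where "t = 1 / real p"
  define a where "a = real p powr (-1-s)"
  have p: "real p > 1" using prime_gt_1_nat[OF assms(1)] by simp
  then have t: "0 < t" "t < 1" by (auto simp: t_def)
  have a: "0 \<le> a" "a < 1" using p assms(2) by (auto simp: a_def powr_less_one)
  have Q: "qpoch t t n \<noteq> 0" for n using qpoch_base_pos[OF t, of n] by simp
  have R: "qpoch a t n \<noteq> 0" for n using qpoch_pos[OF a, of t n] t by simp
  define B where "B = a * t ^ N / t"
  have "(\<Sum>x\<le>N. pitilde p N s x) = (\<Sum>j\<le>N. pitilde p N s (N - j))"
    by (rule sum.reindex_bij_witness[of _ "\<lambda>j. N - j" "\<lambda>j. N - j"]) auto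
  also have "\<dots> = (\<Sum>j\<le>N. qpoch a t N * qpoch t t N / qpoch a t (2 * N)
      * (qbinom t N j * gqbinom t B (j + 0) * t ^ (j * (j + 0))))"
  proof (rule sum.cong[OF refl])
    fix j assume "j \<in> {..N}" then have j: "j \<le> N" by simp
    have g: "gqbinom t B j = qpoch a t N / qpoch a t (N - j) / qpoch t t j"
      unfolding gqbinom_def B_def using t j
      by (intro arg_cong[where f = "\<lambda>x. x / qpoch t t j"] eq_divide_imp[OF R prod_rev_eq_qpoch]) auto
    have "real p powr (- real ((N - (N - j))^2)) = t ^ (j * j)"
      using p j by (simp add: t_def powr_minus powr_realpow power_one_over power2_eq_square divide_simps
          flip: of_nat_mult)
    then show "pitilde p N s (N - j) = qpoch a t N * qpoch t t N / qpoch a t (2 * N)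
      * (qbinom t N j * gqbinom t B (j + 0) * t ^ (j * (j + 0)))"
      using j Q R unfolding pitilde_def a_def[symmetric] t_def[symmetric]
      by (simp add: g qbinom_def divide_simps power2_eq_square)
  qed
  also have "\<dots> = qpoch a t N * qpoch t t N / qpoch a t (2 * N) * gqbinom t (B * t ^ N) N"
    unfolding sum_distrib_left[symmetric] q_Vandermonde[OF t] by simp
  also have "gqbinom t (B * t ^ N) N = qpoch a t (2 * N) / qpoch a t N / qpoch t t N"
  proof -
    have "B * t ^ N = a * t ^ (2 * N) / t" by (simp add: B_def mult_2 power_add)
    then show ?thesis
      unfolding gqbinom_def using prod_rev_eq_qpoch[of t N "2 * N" a] t R[of N]
      by (intro arg_cong[where f = "\<lambda>x. x / qpoch t t N"] eq_divide_imp) (auto simp: mult_2)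
  qed
  finally show ?thesis using Q R by simp
qed

section \<open>Kernels modulo q\<close>

text \<open>Rows and columns are indexed by arbitrary sets, so that a pivot can delete one of each
  without renumbering.\<close>

definition ker_card :: "int \<Rightarrow> 'r set \<Rightarrow> 'c set \<Rightarrow> ('r \<Rightarrow> 'c \<Rightarrow> int) \<Rightarrow> nat" where
  "ker_card q I J A = card {v \<in> J \<rightarrow>\<^sub>E {0..<q}. \<forall>a\<in>I. q dvd (\<Sum>b\<in>J. A a b * v b)}"

lemma ker_card_cong:
  assumes "\<And>a b. a \<in> I \<Longrightarrow> b \<in> J \<Longrightarrow> [A a b = A' a b] (mod q)"
  shows "ker_card q I J A = ker_card q I J A'"
proof -
  have "[(\<Sum>b\<in>J. A a b * v b) = (\<Sum>b\<in>J. A' a b * v b)] (mod q)" if "a \<in> I" for a v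
    using assms that by (intro cong_sum cong_mult) auto
  then have "q dvd (\<Sum>b\<in>J. A a b * v b) \<longleftrightarrow> q dvd (\<Sum>b\<in>J. A' a b * v b)" if "a \<in> I" for a v
    using that cong_dvd_iff by blast
  then show ?thesis unfolding ker_card_def by (intro arg_cong[where f=card]) auto
qed

lemma ker_card_one [simp]: "ker_card 1 I J A = 1"
proof -
  have "{v \<in> J \<rightarrow>\<^sub>E {0..<1::int}. \<forall>a\<in>I. 1 dvd (\<Sum>b\<in>J. A a b * v b)} = {\<lambda>x\<in>J. 0}"
    by (force simp: PiE_iff extensional_def fun_eq_iff)
  then show ?thesis by (simp add: ker_card_def)
qed

text \<open>The equation of row \<open>a\<close> determines the coordinate \<open>j\<close> of a kernel vector; substituting it
  into the other rows gives the Schur complement.\<close>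
lemma ker_card_pivot:
  fixes A :: "'r \<Rightarrow> 'c \<Rightarrow> int"
  assumes "finite J" "j \<in> J" "a \<in> I" "q > 0" and u: "[A a j * u = 1] (mod q)"
  shows "ker_card q I J A = ker_card q (I - {a}) (J - {j}) (\<lambda>i c. A i c - A i j * u * A a c)"
    (is "_ = ker_card q ?I ?J ?S")
proof -
  define R where "R i v = (\<Sum>b\<in>?J. A i b * v b)" for i v
  define x where "x w = (- u * R a w) mod q" for w
  have split: "(\<Sum>b\<in>J. A i b * v b) = A i j * v j + R i v" for i v
    unfolding R_def using assms(1,2) by (rule sum.remove)
  have S: "(\<Sum>c\<in>?J. ?S i c * v c) = R i v - A i j * u * R a v" for i v
    by (simp add: R_def left_diff_distrib sum_subtractf sum_distrib_left mult.assoc)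
  have R_cong: "R i v = R i w" if "\<And>b. b \<in> ?J \<Longrightarrow> v b = w b" for i v w
    unfolding R_def using that by (intro sum.cong) auto
  have row: "q dvd A a j * z + R a v \<longleftrightarrow> [z = - u * R a v] (mod q)" for z v
  proof
    assume "q dvd A a j * z + R a v"
    then have "[u * (A a j * z + R a v) = 0] (mod q)" by (simp add: cong_0_iff)
    moreover have "[u * (A a j * z + R a v) = 1 * z + u * R a v] (mod q)"
      using cong_add[OF cong_mult[OF u cong_refl[of z]] cong_refl[of "u * R a v"]] by (simp add: algebra_simps)
    ultimately have "[z + u * R a v = 0] (mod q)" by (metis cong_sym cong_trans mult_1)
    then show "[z = - u * R a v] (mod q)" by (simp add: cong_iff_dvd_diff)
  next
    assume "[z = - u * R a v] (mod q)"
    then have "[A a j * z = A a j * (- u * R a v)] (mod q)" by (rule cong_mult[OF cong_refl])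
    moreover have "[A a j * (- u * R a v) = - R a v] (mod q)"
      using cong_mult[OF u cong_refl[of "- R a v"]] by (simp add: algebra_simps)
    ultimately have "[A a j * z = - R a v] (mod q)" by (rule cong_trans)
    then show "q dvd A a j * z + R a v" by (simp add: cong_iff_dvd_diff)
  qed
  have elim: "q dvd A i j * z + R i v \<longleftrightarrow> q dvd R i v - A i j * u * R a v"
    if "[z = - u * R a v] (mod q)" for i z v
  proof -
    have "[A i j * z + R i v = A i j * (- u * R a v) + R i v] (mod q)"
      by (intro cong_add cong_mult cong_refl that)
    from cong_dvd_iff[OF this] show ?thesis by (simp add: algebra_simps)
  qed
  let ?K = "{v \<in> J \<rightarrow>\<^sub>E {0..<q}. \<forall>i\<in>I. q dvd (\<Sum>b\<in>J. A i b * v b)}"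
  let ?L = "{v \<in> ?J \<rightarrow>\<^sub>E {0..<q}. \<forall>i\<in>?I. q dvd (\<Sum>c\<in>?J. ?S i c * v c)}"
  have "bij_betw (\<lambda>v. restrict v ?J) ?K ?L"
  proof (rule bij_betw_byWitness[where f' = "\<lambda>w. w(j := x w)"])
    show "\<forall>v\<in>?K. (restrict v ?J)(j := x (restrict v ?J)) = v"
    proof
      fix v assume v: "v \<in> ?K"
      then have "[v j = - u * R a v] (mod q)" using \<open>a \<in> I\<close> unfolding row[symmetric] split[symmetric] by auto
      moreover have "0 \<le> v j" "v j < q" using v \<open>j \<in> J\<close> by (auto simp: PiE_iff)
      ultimately have "v j = x v" unfolding x_def cong_def by (metis mod_pos_pos_trivial)
      moreover have "x (restrict v ?J) = x v" unfolding x_def by (subst R_cong[of "restrict v ?J" v]) auto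
      ultimately show "(restrict v ?J)(j := x (restrict v ?J)) = v"
        using v by (auto simp: fun_eq_iff PiE_iff extensional_def)
    qed
    show "\<forall>w\<in>?L. restrict (w(j := x w)) ?J = w"
      by (auto simp: fun_eq_iff PiE_iff extensional_def)
    show "(\<lambda>v. restrict v ?J) ` ?K \<subseteq> ?L"
    proof (rule image_subsetI, rule CollectI, rule conjI)
      fix v assume v: "v \<in> ?K"
      show "restrict v ?J \<in> ?J \<rightarrow>\<^sub>E {0..<q}" using v by auto
      have "[v j = - u * R a v] (mod q)" using v \<open>a \<in> I\<close> unfolding row[symmetric] split[symmetric] by auto
      from elim[OF this] have "q dvd R i v - A i j * u * R a v" if "i \<in> I" for i
        using v that unfolding split[symmetric] by blast
      then show "\<forall>i\<in>?I. q dvd (\<Sum>c\<in>?J. ?S i c * restrict v ?J c)"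
        unfolding S by (subst (1 2) R_cong[of "restrict v ?J" v]) auto
    qed
    show "(\<lambda>w. w(j := x w)) ` ?L \<subseteq> ?K"
    proof (rule image_subsetI, rule CollectI, rule conjI)
      fix w assume w: "w \<in> ?L"
      show "w(j := x w) \<in> J \<rightarrow>\<^sub>E {0..<q}"
        using w \<open>j \<in> J\<close> \<open>q > 0\<close> by (auto simp: PiE_iff extensional_def x_def)
      have c: "[x w = - u * R a w] (mod q)" by (simp add: x_def cong_def)
      have "q dvd A i j * x w + R i w" if "i \<in> I" for i
      proof (cases "i = a")
        case True then show ?thesis using row c by blast
      next
        case False then show ?thesis using w that unfolding elim[OF c] S[symmetric] by blast
      qed
      moreover have "R i (w(j := x w)) = R i w" for i by (rule R_cong) auto
      ultimately show "\<forall>i\<in>I. q dvd (\<Sum>b\<in>J. A i b * (w(j := x w)) b)" unfolding split by (simp del: fun_upd_apply add: fun_upd_same)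
    qed
  qed
  then show ?thesis unfolding ker_card_def by (rule bij_betw_same_card)
qed

lemma card_PiE_mod:
  fixes q m :: int
  assumes "finite J" "0 < q" "0 < m"
  shows "card {v \<in> J \<rightarrow>\<^sub>E {0..<q * m}. Q (\<lambda>b\<in>J. v b mod q)} = nat m ^ card J * card {v \<in> J \<rightarrow>\<^sub>E {0..<q}. Q v}"
proof -
  let ?V = "{v \<in> J \<rightarrow>\<^sub>E {0..<q * m}. Q (\<lambda>b\<in>J. v b mod q)}"
  let ?W = "{v \<in> J \<rightarrow>\<^sub>E {0..<q}. Q v} \<times> (J \<rightarrow>\<^sub>E {0..<m})"
  have lt: "x + q * y < q * m" if "x < q" "y < m" for x y
  proof -
    have "x + q * y < q * (y + 1)" using that by (simp add: algebra_simps)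
    also have "\<dots> \<le> q * m" using that assms(2) by (intro mult_left_mono) auto
    finally show ?thesis .
  qed
  have dv: "x div q < m" if "x < q * m" for x
    proof (rule ccontr)
    assume "\<not> x div q < m"
    then have "q * m \<le> q * (x div q)" using assms(2) by (intro mult_left_mono) auto
    also have "\<dots> \<le> x" using mult_div_mod_eq[of q x] pos_mod_sign[OF assms(2), of x] by linarith
    finally show False using that by simp
  qed
  have "bij_betw (\<lambda>v. (\<lambda>b\<in>J. v b mod q, \<lambda>b\<in>J. v b div q)) ?V ?W"
    by (rule bij_betw_byWitness[where f' = "\<lambda>(x, y). \<lambda>b\<in>J. x b + q * y b"])
      (use assms lt dv in \<open>auto simp: PiE_iff extensional_def fun_eq_iff restrict_def pos_imp_zdiv_nonneg_iff
        intro!: add_nonneg_nonneg mult_nonneg_nonneg cong: if_cong elim!: back_subst[of Q]\<close>)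
  then have "card ?V = card ?W" by (rule bij_betw_same_card)
  also have "\<dots> = nat m ^ card J * card {v \<in> J \<rightarrow>\<^sub>E {0..<q}. Q v}"
    using assms(1) by (simp add: card_cartesian_product card_PiE)
  finally show ?thesis .
qed

text \<open>Cancelling \<open>m\<close> leaves a condition modulo \<open>q\<close> on vectors modulo
  \<open>q * m\<close>, so each kernel vector modulo \<open>q\<close> is counted once for every
  lift.\<close>

lemma ker_card_scale:
  assumes "finite J" "0 < q" "0 < m"
  shows "ker_card (q * m) I J (\<lambda>a b. m * A a b) = nat m ^ card J * ker_card q I J A"
proof -
  have *: "q * m dvd (\<Sum>b\<in>J. m * A a b * v b) \<longleftrightarrow> q dvd (\<Sum>b\<in>J. A a b * (\<lambda>b\<in>J. v b mod q) b)" for a v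
  proof -
    have "(\<Sum>b\<in>J. m * A a b * v b) = (\<Sum>b\<in>J. A a b * v b) * m"
      by (simp add: sum_distrib_left mult_ac)
    then have "q * m dvd (\<Sum>b\<in>J. m * A a b * v b) \<longleftrightarrow> q dvd (\<Sum>b\<in>J. A a b * v b)"
      using assms(3) by simp
    also have "[(\<Sum>b\<in>J. A a b * v b) = (\<Sum>b\<in>J. A a b * (\<lambda>b\<in>J. v b mod q) b)] (mod q)"
      by (intro cong_sum cong_mult) (auto simp: cong_def)
    then have "q dvd (\<Sum>b\<in>J. A a b * v b) \<longleftrightarrow> q dvd (\<Sum>b\<in>J. A a b * (\<lambda>b\<in>J. v b mod q) b)"
      by (rule cong_dvd_iff)
    finally show ?thesis .
  qed
  show ?thesis unfolding ker_card_def *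
    by (rule card_PiE_mod[OF assms, where Q = "\<lambda>v. \<forall>a\<in>I. q dvd (\<Sum>b\<in>J. A a b * v b)"])
qed

lemma sum_delta_mult_cong:
  fixes f :: "'a \<Rightarrow> int"
  assumes "finite T" "c \<in> T" "\<And>d. d \<in> T \<Longrightarrow> [M d = (if c = d then 1 else 0)] (mod q)"
  shows "[(\<Sum>d\<in>T. M d * f d) = f c] (mod q)"
proof -
  have "[(\<Sum>d\<in>T. M d * f d) = (\<Sum>d\<in>T. (if c = d then 1 else 0) * f d)] (mod q)"
    by (intro cong_sum cong_mult cong_refl assms(3))
  also have "(\<Sum>d\<in>T. (if c = d then 1 else 0) * f d) = (\<Sum>d\<in>T. if c = d then f d else 0)"
    by (intro sum.cong) auto
  also have "\<dots> = f c" using assms by (simp add: sum.delta)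
  finally show ?thesis .
qed

text \<open>The substitution \<open>w = C v\<close> is bijective modulo \<open>q\<close> by the two
  identities for \<open>C\<close> and \<open>C'\<close>, and multiplying the equations by
  \<open>B'\<close> removes \<open>B\<close>. What remains is one independent condition per diagonal
  entry.\<close>

lemma ker_card_BDC:
  fixes A :: "'r \<Rightarrow> 'c \<Rightarrow> int" and D :: "'t \<Rightarrow> int"
  assumes fin: "finite I" "finite J" "finite T" and "q > 0"
    and A: "\<And>a b. a \<in> I \<Longrightarrow> b \<in> J \<Longrightarrow> [A a b = (\<Sum>c\<in>T. B a c * D c * C c b)] (mod q)"
    and B: "\<And>c d. c \<in> T \<Longrightarrow> d \<in> T \<Longrightarrow> [(\<Sum>a\<in>I. B' c a * B a d) = (if c = d then 1 else 0)] (mod q)"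
    and C: "\<And>b d. b \<in> J \<Longrightarrow> d \<in> J \<Longrightarrow> [(\<Sum>c\<in>T. C' b c * C c d) = (if b = d then 1 else 0)] (mod q)"
    and C': "\<And>c d. c \<in> T \<Longrightarrow> d \<in> T \<Longrightarrow> [(\<Sum>b\<in>J. C c b * C' b d) = (if c = d then 1 else 0)] (mod q)"
  shows "ker_card q I J A = (\<Prod>c\<in>T. card {x \<in> {0..<q}. q dvd D c * x})"
proof -
  let ?K = "{v \<in> J \<rightarrow>\<^sub>E {0..<q}. \<forall>i\<in>I. q dvd (\<Sum>b\<in>J. A i b * v b)}"
  let ?L = "{w \<in> T \<rightarrow>\<^sub>E {0..<q}. \<forall>c\<in>T. q dvd D c * w c}"
  define f where "f v = (\<lambda>c\<in>T. (\<Sum>b\<in>J. C c b * v b) mod q)" for v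
  define g where "g w = (\<lambda>b\<in>J. (\<Sum>c\<in>T. C' b c * w c) mod q)" for w
  have fc: "[f v c = (\<Sum>b\<in>J. C c b * v b)] (mod q)" if "c \<in> T" for v c
    using that by (simp add: f_def cong_def)
  have gc: "[g w b = (\<Sum>c\<in>T. C' b c * w c)] (mod q)" if "b \<in> J" for w b
    using that by (simp add: g_def cong_def)
  have gf: "[(\<Sum>c\<in>T. C' b c * f v c) = v b] (mod q)" if "b \<in> J" for v b
  proof -
    have "[(\<Sum>c\<in>T. C' b c * f v c) = (\<Sum>c\<in>T. C' b c * (\<Sum>d\<in>J. C c d * v d))] (mod q)"
      by (intro cong_sum cong_mult cong_refl fc)
    also have "(\<Sum>c\<in>T. C' b c * (\<Sum>d\<in>J. C c d * v d)) = (\<Sum>d\<in>J. (\<Sum>c\<in>T. C' b c * C c d) * v d)"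
      by (simp add: sum_distrib_left sum_distrib_right mult.assoc) (rule sum.swap)
    also have "[\<dots> = v b] (mod q)" by (rule sum_delta_mult_cong) (use fin that C in auto)
    finally show ?thesis .
  qed
  have fg: "[(\<Sum>b\<in>J. C c b * g w b) = w c] (mod q)" if "c \<in> T" for w c
  proof -
    have "[(\<Sum>b\<in>J. C c b * g w b) = (\<Sum>b\<in>J. C c b * (\<Sum>d\<in>T. C' b d * w d))] (mod q)"
      by (intro cong_sum cong_mult cong_refl gc)
    also have "(\<Sum>b\<in>J. C c b * (\<Sum>d\<in>T. C' b d * w d)) = (\<Sum>d\<in>T. (\<Sum>b\<in>J. C c b * C' b d) * w d)"
      by (simp add: sum_distrib_left sum_distrib_right mult.assoc) (rule sum.swap)
    also have "[\<dots> = w c] (mod q)" by (rule sum_delta_mult_cong) (use fin that C' in auto)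
    finally show ?thesis .
  qed
  have row: "[(\<Sum>b\<in>J. A i b * v b) = (\<Sum>c\<in>T. B i c * (D c * f v c))] (mod q)" if "i \<in> I" for i v
  proof -
    have "[(\<Sum>b\<in>J. A i b * v b) = (\<Sum>b\<in>J. (\<Sum>c\<in>T. B i c * D c * C c b) * v b)] (mod q)"
      by (intro cong_sum cong_mult cong_refl A that)
    also have "(\<Sum>b\<in>J. (\<Sum>c\<in>T. B i c * D c * C c b) * v b) = (\<Sum>c\<in>T. B i c * (D c * (\<Sum>b\<in>J. C c b * v b)))"
      by (simp add: sum_distrib_left sum_distrib_right mult.assoc) (rule sum.swap)
    also have "[\<dots> = (\<Sum>c\<in>T. B i c * (D c * f v c))] (mod q)"
      by (intro cong_sum cong_mult cong_refl cong_sym[OF fc])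
    finally show ?thesis .
  qed
  have iff: "(\<forall>i\<in>I. q dvd (\<Sum>b\<in>J. A i b * v b)) \<longleftrightarrow> (\<forall>c\<in>T. q dvd D c * f v c)" for v
  proof -
    have "(\<forall>i\<in>I. q dvd (\<Sum>b\<in>J. A i b * v b)) \<longleftrightarrow> (\<forall>i\<in>I. q dvd (\<Sum>c\<in>T. B i c * (D c * f v c)))"
      using cong_dvd_iff[OF row] by blast
    also have "\<dots> \<longleftrightarrow> (\<forall>c\<in>T. q dvd D c * f v c)"
    proof
      assume h: "\<forall>i\<in>I. q dvd (\<Sum>c\<in>T. B i c * (D c * f v c))"
      show "\<forall>c\<in>T. q dvd D c * f v c"
      proof
        fix c assume c: "c \<in> T"
        have "q dvd (\<Sum>i\<in>I. B' c i * (\<Sum>d\<in>T. B i d * (D d * f v d)))"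

          by (rule dvd_sum, rule dvd_mult) (use h in auto)
        also have "(\<Sum>i\<in>I. B' c i * (\<Sum>d\<in>T. B i d * (D d * f v d)))
            = (\<Sum>d\<in>T. (\<Sum>i\<in>I. B' c i * B i d) * (D d * f v d))"
          by (simp add: sum_distrib_left sum_distrib_right mult.assoc) (rule sum.swap)
        also have "q dvd \<dots> \<longleftrightarrow> q dvd D c * f v c"
          by (intro cong_dvd_iff sum_delta_mult_cong) (use fin c B in auto)
        finally show "q dvd D c * f v c" .
      qed
    qed (simp add: dvd_sum)
    finally show ?thesis .
  qed
  have eqI: "x = y" if "[x = y] (mod q)" "0 \<le> x" "x < q" "0 \<le> y" "y < q" for x y
    using that by (metis cong_def mod_pos_pos_trivial)
  have "bij_betw f ?K ?L"
  proof (rule bij_betw_byWitness[where f' = g])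
    show "\<forall>v\<in>?K. g (f v) = v"
    proof (rule ballI, rule ext)
      fix v b assume v: "v \<in> ?K"
      show "g (f v) b = v b"
      proof (cases "b \<in> J")
        case True
        have "[g (f v) b = v b] (mod q)" using gc[OF True] gf[OF True] by (rule cong_trans)
        then show ?thesis using v True \<open>q > 0\<close> by (intro eqI) (auto simp: PiE_iff g_def)
      next
        case False
        then show ?thesis using v by (auto simp: g_def PiE_iff extensional_def)
      qed
    qed
    show fgw: "\<forall>w\<in>?L. f (g w) = w"
    proof (rule ballI, rule ext)
      fix w c assume w: "w \<in> ?L"
      show "f (g w) c = w c"
      proof (cases "c \<in> T")
        case True
        have "[f (g w) c = w c] (mod q)" using fc[OF True] fg[OF True] by (rule cong_trans)
        then show ?thesis using w True \<open>q > 0\<close> by (intro eqI) (auto simp: PiE_iff f_def)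
      next
        case False
        then show ?thesis using w by (auto simp: f_def PiE_iff extensional_def)
      qed
    qed
    show "f ` ?K \<subseteq> ?L" using iff \<open>q > 0\<close> by (auto simp: f_def PiE_iff)
    show "g ` ?L \<subseteq> ?K"
    proof (rule image_subsetI, rule CollectI, rule conjI)
      fix w assume w: "w \<in> ?L"
      show "g w \<in> J \<rightarrow>\<^sub>E {0..<q}" using \<open>q > 0\<close> by (auto simp: g_def PiE_iff)
      show "\<forall>i\<in>I. q dvd (\<Sum>b\<in>J. A i b * g w b)" unfolding iff using w fgw by auto
    qed
  qed
  then have "ker_card q I J A = card ?L" unfolding ker_card_def by (rule bij_betw_same_card)
  also have "?L = (\<Pi>\<^sub>E c\<in>T. {x \<in> {0..<q}. q dvd D c * x})" by (auto simp: PiE_iff extensional_def)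
  also have "card \<dots> = (\<Prod>c\<in>T. card {x \<in> {0..<q}. q dvd D c * x})" using fin(3) by (rule card_PiE)
  finally show ?thesis .
qed

section \<open>Counting matrices by their elementary divisors\<close>

text \<open>Counting in two stages: the entries on \<open>Y\<close> are exposed first, and
  \<open>T\<close> marks the outcomes that can still be completed. All of them have the same number
  \<open>w\<close> of completions, so the count factorises.\<close>

lemma card_PiE_Un_fibres:
  fixes R :: "'z \<Rightarrow> 'a set"
  assumes "finite X" "finite Y" "X \<inter> Y = {}" "\<And>z. z \<in> X \<union> Y \<Longrightarrow> finite (R z)"
    and w: "\<And>B. B \<in> PiE Y R \<Longrightarrow> T B \<Longrightarrow> card {C \<in> PiE X R. Q (\<lambda>z. if z \<in> Y then B z else C z)} = w"
    and T: "\<And>A. A \<in> PiE (X \<union> Y) R \<Longrightarrow> Q A \<Longrightarrow> T (restrict A Y)"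
  shows "card {A \<in> PiE (X \<union> Y) R. Q A} = card {B \<in> PiE Y R. T B} * w"
proof -
  let ?m = "\<lambda>B C z. if z \<in> Y then B z else C z"
  let ?S = "SIGMA B : {B \<in> PiE Y R. T B}. {C \<in> PiE X R. Q (?m B C)}"
  have m_eq: "?m (restrict A Y) (restrict A X) = A" if "A \<in> PiE (X \<union> Y) R" for A
    using that by (auto simp: fun_eq_iff PiE_iff extensional_def)
  have "bij_betw (\<lambda>A. (restrict A Y, restrict A X)) {A \<in> PiE (X \<union> Y) R. Q A} ?S"
  proof (rule bij_betw_byWitness[where f' = "\<lambda>(B, C). ?m B C"])
    show "\<forall>A\<in>{A \<in> PiE (X \<union> Y) R. Q A}. (case (restrict A Y, restrict A X) of (B, C) \<Rightarrow> ?m B C) = A"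
      using m_eq by auto
    show "\<forall>S\<in>?S. (restrict (case S of (B, C) \<Rightarrow> ?m B C) Y, restrict (case S of (B, C) \<Rightarrow> ?m B C) X) = S"
      using assms(3) by (auto simp: fun_eq_iff PiE_iff extensional_def)
    show "(\<lambda>A. (restrict A Y, restrict A X)) ` {A \<in> PiE (X \<union> Y) R. Q A} \<subseteq> ?S"
      using m_eq T by (auto simp: PiE_iff)
    show "(\<lambda>(B, C). ?m B C) ` ?S \<subseteq> {A \<in> PiE (X \<union> Y) R. Q A}"
      by (auto simp: PiE_iff extensional_def)
  qed
  then have "card {A \<in> PiE (X \<union> Y) R. Q A} = card ?S" by (rule bij_betw_same_card)
  also have "\<dots> = (\<Sum>B\<in>{B \<in> PiE Y R. T B}. card {C \<in> PiE X R. Q (?m B C)})"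
    using assms(1,2,4) by (intro card_SigmaI ballI finite_subset[OF Collect_restrict] finite_PiE) auto
  also have "\<dots> = card {B \<in> PiE Y R. T B} * w" by (simp add: w)
  finally show ?thesis .
qed

text \<open>The residues divisible by \<open>d z\<close> form a subgroup modulo \<open>q\<close>,
  and translation by one of its elements permutes it.\<close>

lemma card_PiE_translate:
  fixes q :: int
  assumes "finite X" "q > 0" "\<And>z. z \<in> X \<Longrightarrow> d z dvd q \<and> d z dvd \<tau> z"
  shows "card {C \<in> (\<Pi>\<^sub>E z\<in>X. {x \<in> {0..<q}. d z dvd x}). Q (\<lambda>z\<in>X. (C z + \<tau> z) mod q)}
       = card {C \<in> (\<Pi>\<^sub>E z\<in>X. {x \<in> {0..<q}. d z dvd x}). Q C}"
proof -
  define P where "P = (\<Pi>\<^sub>E z\<in>X. {x \<in> {0..<q}. d z dvd x})"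
  define f where "f \<tau> C = (\<lambda>z\<in>X. (C z + \<tau> z) mod q)" for \<tau> C :: "'a \<Rightarrow> int"
  have mem: "f \<sigma> C \<in> P" if "C \<in> P" "\<And>z. z \<in> X \<Longrightarrow> d z dvd \<sigma> z" for \<sigma> C
    using that assms by (auto simp: P_def f_def PiE_iff dvd_mod_iff)
  have inv: "f (\<lambda>z. - \<tau> z) (f \<tau> C) = C" "f \<tau> (f (\<lambda>z. - \<tau> z) C) = C" if "C \<in> P" for C
    using that by (auto simp: P_def f_def PiE_iff extensional_def fun_eq_iff mod_simps)
  have "bij_betw (f \<tau>) {C \<in> P. Q (f \<tau> C)} {C \<in> P. Q C}"
    by (rule bij_betw_byWitness[where f' = "f (\<lambda>z. - \<tau> z)"]) (use inv mem assms(3) in \<open>auto simp: dvd_minus_iff\<close>)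
  then show ?thesis unfolding f_def P_def by (rule bij_betw_same_card)
qed

text \<open>\<open>profile p n I J A c\<close> says that for \<open>1 \<le> i \<le> n\<close> exactly \<open>c i\<close> elementary divisors of \<open>A\<close>
  are divisible by \<open>p ^ i\<close>, since the elementary divisor \<open>p ^ k\<close> contributes the factor \<open>p ^ min k i\<close>
  to the number of kernel vectors modulo \<open>p ^ i\<close>.\<close>
definition profile :: "nat \<Rightarrow> nat \<Rightarrow> 'r set \<Rightarrow> 'c set \<Rightarrow> ('r \<Rightarrow> 'c \<Rightarrow> int) \<Rightarrow> (nat \<Rightarrow> nat) \<Rightarrow> bool" where
  "profile p n I J A c \<longleftrightarrow> (\<forall>i\<le>n. ker_card (int p ^ i) I J A = p ^ (\<Sum>l\<in>{1..i}. c l))"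

lemma profile_cong:
  assumes "\<And>a b. a \<in> I \<Longrightarrow> b \<in> J \<Longrightarrow> [A a b = A' a b] (mod int p ^ n)"
  shows "profile p n I J A c \<longleftrightarrow> profile p n I J A' c"
proof -
  have "ker_card (int p ^ i) I J A = ker_card (int p ^ i) I J A'" if "i \<le> n" for i
    using assms that by (intro ker_card_cong) (meson cong_dvd_modulus le_imp_power_dvd)
  then show ?thesis unfolding profile_def by auto
qed

lemma profile_pivot:
  assumes "finite J" "j \<in> J" "a \<in> I" "p > 0" "[A a j * u = 1] (mod int p ^ n)"
  shows "profile p n I J A c \<longleftrightarrow> profile p n (I - {a}) (J - {j}) (\<lambda>i b. A i b - A i j * u * A a b) c"
proof -
  have "ker_card (int p ^ i) I J A = ker_card (int p ^ i) (I - {a}) (J - {j}) (\<lambda>i b. A i b - A i j * u * A a b)"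
    if "i \<le> n" for i
    using assms that by (intro ker_card_pivot) (auto intro: cong_dvd_modulus le_imp_power_dvd)
  then show ?thesis unfolding profile_def by auto
qed

text \<open>Every elementary divisor of \<open>p\<close> times a matrix is divisible by
  \<open>p\<close>, which forces the first count; dividing by \<open>p\<close> shifts the other
  counts by one place.\<close>

lemma profile_scale:
  assumes "finite J" "prime p"
  shows "profile p (Suc n) I J (\<lambda>a b. int p * A a b) c \<longleftrightarrow> card J = c 1 \<and> profile p n I J A (\<lambda>l. c (Suc l))"
proof -
  have p: "p > 1" using assms(2) by (rule prime_gt_1_nat)
  have K: "ker_card (int p ^ Suc i) I J (\<lambda>a b. int p * A a b) = p ^ card J * ker_card (int p ^ i) I J A" for i
    using ker_card_scale[of J "int p ^ i" "int p" I A] p assms(1) by (simp add: mult.commute)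
  have S: "(\<Sum>l\<in>{1..Suc i}. c l) = c 1 + (\<Sum>l\<in>{1..i}. c (Suc l))" for i
    by (subst sum.atLeast_Suc_atMost) (auto simp: sum.shift_bounds_cl_Suc_ivl simp del: sum.cl_ivl_Suc)
  have "profile p (Suc n) I J (\<lambda>a b. int p * A a b) c \<longleftrightarrow>
    (\<forall>i\<le>n. p ^ card J * ker_card (int p ^ i) I J A = p ^ c 1 * p ^ (\<Sum>l\<in>{1..i}. c (Suc l)))"
  proof -
    have "(\<forall>i\<le>Suc n. P i) \<longleftrightarrow> P 0 \<and> (\<forall>i\<le>n. P (Suc i))" for P
      by (metis Suc_le_mono le0 not0_implies_Suc)
    then show ?thesis unfolding profile_def using K S by (simp add: power_add)
  qed
  also have "\<dots> \<longleftrightarrow> card J = c 1 \<and> profile p n I J A (\<lambda>l. c (Suc l))"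
  proof
    assume h: "\<forall>i\<le>n. p ^ card J * ker_card (int p ^ i) I J A = p ^ c 1 * p ^ (\<Sum>l\<in>{1..i}. c (Suc l))"
    \<comment> \<open>Index \<open>0\<close> isolates the first count, since every kernel modulo
      \<open>1\<close> has one element.\<close>
    from h[rule_format, of 0] have "p ^ card J = p ^ c 1" by simp
    then have "card J = c 1" using p by (simp add: power_inject_exp)
    with h p show "card J = c 1 \<and> profile p n I J A (\<lambda>l. c (Suc l))" by (auto simp: profile_def)
  qed (auto simp: profile_def)
  finally show ?thesis .
qed

text \<open>A state of the exposure of columns: those in \<open>J0\<close> are known to vanish
  modulo \<open>p\<close>, the others are still unrestricted.\<close>

definition divcol_mats :: "nat \<Rightarrow> nat \<Rightarrow> 'r set \<Rightarrow> 'c set \<Rightarrow> 'c set \<Rightarrow> ('r \<times> 'c \<Rightarrow> int) set" where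
  "divcol_mats p n I J J0 =
     (\<Pi>\<^sub>E (a, b) \<in> I \<times> J. {x \<in> {0..<int p ^ n}. (if b \<in> J0 then int p else 1) dvd x})"

lemma card_multiples:
  assumes "p > 0"
  shows "card {x \<in> {0..<int p ^ Suc n}. (if Z then int p else 1) dvd x} = (if Z then p ^ n else p ^ Suc n)"
proof (cases Z)
  case True
  have "bij_betw (\<lambda>x. int p * x) {0..<int p ^ n} {x \<in> {0..<int p ^ Suc n}. int p dvd x}"
    by (rule bij_betw_byWitness[where f' = "\<lambda>x. x div int p"])
       (use assms in \<open>auto simp: zero_le_mult_iff pos_imp_zdiv_nonneg_iff\<close>)
  from bij_betw_same_card[OF this] show ?thesis using True by (simp flip: of_nat_power)
next
  case False
  have "card {0..<int p ^ Suc n} = p ^ Suc n" by (simp add: nat_power_eq nat_mult_distrib)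
  moreover have "{x \<in> {0..<int p ^ Suc n}. 1 dvd x} = {0..<int p ^ Suc n}" by auto
  ultimately show ?thesis using False by simp
qed

text \<open>The three factors count column \<open>j\<close>, the rest of a row \<open>a\<close> in
  which that column has a unit, and the remaining block. The pivot replaces this block by its Schur
  complement, a translate by quantities fixed at the earlier stages, so the block still contributes
  \<open>w\<close>.\<close>

lemma card_unit_pivot:
  fixes I :: "'r set" and J :: "'c set"
  assumes p: "prime p" and fin: "finite I" "finite J" and j: "j \<in> J" "j \<notin> J0" and "J0 \<subseteq> J"
    and w: "\<And>a. a \<in> I \<Longrightarrow> card {A \<in> divcol_mats p (Suc n) (I - {a}) (J - {j}) J0.
                profile p m (I - {a}) (J - {j}) (curry A) c} = w"
    and "m \<le> Suc n"
  shows "card {A \<in> divcol_mats p (Suc n) I J J0. profile p m I J (curry A) c \<and> (\<exists>a\<in>I. \<not> int p dvd A (a, j))}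
    = (p ^ (Suc n * card I) - p ^ (n * card I)) * (p ^ (n * card J0 + Suc n * (card J - card J0 - 1)) * w)"
proof -
  define q where "q = int p ^ Suc n"
  define d where "d z = (if snd z \<in> J0 then int p else 1)" for z :: "'r \<times> 'c"
  define R where "R z = {x \<in> {0..<q}. d z dvd x}" for z :: "'r \<times> 'c"
  have p0: "p > 0" using p by (rule prime_gt_0_nat)
  have q0: "q > 0" using p0 by (simp add: q_def)
  have mats: "divcol_mats p (Suc n) I' J' J0 = PiE (I' \<times> J') R" for I' J'
    unfolding divcol_mats_def by (rule PiE_cong) (auto simp: R_def d_def q_def)
  have finR: "finite (R z)" for z by (rule finite_subset[of _ "{0..<q}"]) (auto simp: R_def)
  have cardR: "card (R z) = (if snd z \<in> J0 then p ^ n else p ^ Suc n)" for z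
    using card_multiples[OF p0, of n "snd z \<in> J0"] by (simp add: R_def d_def q_def)
  define X where "X = I \<times> (J - {j})"
  define Y where "Y = I \<times> {j}"
  define T where "T B \<longleftrightarrow> (\<exists>a\<in>I. \<not> int p dvd B (a, j))" for B :: "'r \<times> 'c \<Rightarrow> int"
  define Q where "Q A \<longleftrightarrow> profile p m I J (curry A) c \<and> T A" for A :: "'r \<times> 'c \<Rightarrow> int"
  have IJ: "I \<times> J = X \<union> Y" using j by (auto simp: X_def Y_def)
  have cardT: "card {B \<in> PiE Y R. T B} = p ^ (Suc n * card I) - p ^ (n * card I)"
  proof -
    have cY: "card Y = card I" by (simp add: Y_def card_cartesian_product)
    have "{B \<in> PiE Y R. \<not> T B} = (\<Pi>\<^sub>E z\<in>Y. {x \<in> {0..<q}. int p dvd x})"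
      using j by (auto simp: T_def Y_def PiE_iff R_def d_def extensional_def)
    then have "card {B \<in> PiE Y R. \<not> T B} = p ^ (n * card I)"
      using card_multiples[OF p0, of n True] fin by (simp add: card_PiE Y_def q_def power_mult card_cartesian_product)
    moreover have "card (PiE Y R) = p ^ (Suc n * card I)"
    proof -
      have "card (PiE Y R) = (\<Prod>z\<in>Y. card (R z))" using fin by (intro card_PiE) (simp add: Y_def)
      also have "\<dots> = (\<Prod>z\<in>Y. p ^ Suc n)" using j by (intro prod.cong) (auto simp: Y_def cardR)
      finally show ?thesis by (simp only: prod_constant cY power_mult)
    qed
    moreover have "{B \<in> PiE Y R. T B} = PiE Y R - {B \<in> PiE Y R. \<not> T B}" by auto
    moreover have "finite (PiE Y R)" using fin finR by (intro finite_PiE) (auto simp: Y_def)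
    ultimately show ?thesis by (simp add: card_Diff_subset)
  qed
  have "card {A \<in> PiE (X \<union> Y) R. Q A} = card {B \<in> PiE Y R. T B}
     * (p ^ (n * card J0 + Suc n * (card J - card J0 - 1)) * w)"
  proof (rule card_PiE_Un_fibres)
    show "finite X" "finite Y" using fin by (auto simp: X_def Y_def)
    show "X \<inter> Y = {}" by (auto simp: X_def Y_def)
    show "finite (R z)" for z by (rule finR)
    show "T (restrict A Y)" if "Q A" for A using that by (auto simp: Q_def T_def Y_def)
    fix B assume B: "B \<in> PiE Y R" "T B"
    obtain a where a: "a \<in> I" "\<not> int p dvd B (a, j)" using B by (auto simp: T_def)
    have "coprime (int p) (B (a, j))"
      using a p by (simp add: prime_imp_coprime)
    then have "coprime (B (a, j)) q" by (simp add: q_def coprime_commute)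
    then obtain u where u: "[B (a, j) * u = 1] (mod q)" using cong_solve_coprime_int by blast
    let ?m = "\<lambda>C z. if z \<in> Y then B z else C z"
    let ?X1 = "(I - {a}) \<times> (J - {j})"
    let ?X2 = "{a} \<times> (J - {j})"
    have XX: "X = ?X1 \<union> ?X2" using a by (auto simp: X_def)
    have Q: "Q (?m C) \<longleftrightarrow> profile p m (I - {a}) (J - {j})
        (\<lambda>i b. C (i, b) - B (i, j) * u * C (a, b)) c" for C
    proof -
      have "T (?m C)" using a by (auto simp: T_def Y_def)
      then have "Q (?m C) \<longleftrightarrow> profile p m I J (curry (?m C)) c" by (simp add: Q_def)
      also have "\<dots> \<longleftrightarrow> profile p m (I - {a}) (J - {j})
          (\<lambda>i b. curry (?m C) i b - curry (?m C) i j * u * curry (?m C) a b) c"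
      proof (rule profile_pivot)
        have "[B (a, j) * u = 1] (mod int p ^ m)"
          using u \<open>m \<le> Suc n\<close> unfolding q_def by (meson cong_dvd_modulus le_imp_power_dvd)
        then show "[curry (?m C) a j * u = 1] (mod int p ^ m)" using a by (simp add: Y_def)
      qed (use fin j a p0 in auto)
      also have "\<dots> \<longleftrightarrow> profile p m (I - {a}) (J - {j}) (\<lambda>i b. C (i, b) - B (i, j) * u * C (a, b)) c"
        by (rule profile_cong) (use a in \<open>auto simp: Y_def\<close>)
      finally show ?thesis .
    qed
    have "card {C \<in> PiE (?X1 \<union> ?X2) R. Q (?m C)} = card {r \<in> PiE ?X2 R. True} * w"
    proof (rule card_PiE_Un_fibres)
      show "finite ?X1" "finite ?X2" using fin by auto
      show "finite (R z)" for z by (rule finR)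
      fix r assume r: "r \<in> PiE ?X2 R"
      \<comment> \<open>The shift in the Schur complement is a multiple of the exposed row
        \<open>a\<close>, entry by entry in the same column, and so inherits the divisibility
        imposed on the columns of \<open>J0\<close>.\<close>
      define \<tau> where "\<tau> z = - B (fst z, j) * u * r (a, snd z)" for z
      define Q' where "Q' C \<longleftrightarrow> profile p m (I - {a}) (J - {j}) (curry C) c" for C :: "'r \<times> 'c \<Rightarrow> int"
      have "Q (?m (\<lambda>z. if z \<in> ?X2 then r z else C z)) \<longleftrightarrow> Q' (\<lambda>z\<in>?X1. (C z + \<tau> z) mod q)" for C
        unfolding Q Q'_def
      proof (rule profile_cong)
        fix i b assume ib: "i \<in> I - {a}" "b \<in> J - {j}"
        then have "[C (i, b) - B (i, j) * u * r (a, b) = (C (i, b) + \<tau> (i, b)) mod q] (mod q)"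
          by (simp add: \<tau>_def cong_def)
        then have "[C (i, b) - B (i, j) * u * r (a, b) = (C (i, b) + \<tau> (i, b)) mod q] (mod int p ^ m)"
          using \<open>m \<le> Suc n\<close> unfolding q_def by (meson cong_dvd_modulus le_imp_power_dvd)
        with ib show "[(if (i, b) \<in> ?X2 then r (i, b) else C (i, b)) -
             B (i, j) * u * (if (a, b) \<in> ?X2 then r (a, b) else C (a, b)) =
             curry (\<lambda>z\<in>?X1. (C z + \<tau> z) mod q) i b] (mod int p ^ m)" by simp
      qed
      then have "card {C \<in> PiE ?X1 R. Q (?m (\<lambda>z. if z \<in> ?X2 then r z else C z))}
         = card {C \<in> PiE ?X1 R. Q' (\<lambda>z\<in>?X1. (C z + \<tau> z) mod q)}" by simp
      also have "\<dots> = card {C \<in> PiE ?X1 R. Q' C}"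
        unfolding R_def
      proof (rule card_PiE_translate)
        fix z assume "z \<in> ?X1"
        then have "(a, snd z) \<in> ?X2" by auto
        from PiE_mem[OF r this] have "d z dvd r (a, snd z)" by (simp add: R_def d_def)
        then show "d z dvd q \<and> d z dvd \<tau> z" by (auto simp: \<tau>_def d_def q_def)
      qed (use fin q0 in auto)
      also have "\<dots> = w" using w[OF a(1)] unfolding mats Q'_def .
      finally show "card {C \<in> PiE ?X1 R. Q (?m (\<lambda>z. if z \<in> ?X2 then r z else C z))} = w" .
    qed auto
    also have "card {r \<in> PiE ?X2 R. True} = p ^ (n * card J0 + Suc n * (card J - card J0 - 1))"
    proof -
      have "card (PiE ?X2 R) = (\<Prod>z\<in>?X2. card (R z))" using fin by (intro card_PiE) auto
      also have "\<dots> = (\<Prod>b\<in>J - {j}. card (R (a, b)))"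
        by (rule prod.reindex_bij_witness[of _ "\<lambda>b. (a, b)" snd]) auto
      also have "(\<Prod>b\<in>J - {j}. card (R (a, b))) = (\<Prod>b\<in>J0 \<union> (J - {j} - J0). card (R (a, b)))"
        using j \<open>J0 \<subseteq> J\<close> by (intro prod.cong) auto
      also have "\<dots> = (\<Prod>b\<in>J0. card (R (a, b))) * (\<Prod>b\<in>J - {j} - J0. card (R (a, b)))"
        using fin \<open>J0 \<subseteq> J\<close> by (intro prod.union_disjoint) (auto intro: finite_subset)
      also have "\<dots> = (\<Prod>b\<in>J0. p ^ n) * (\<Prod>b\<in>J - {j} - J0. p ^ Suc n)"
        by (intro arg_cong2[where f = times] prod.cong) (auto simp: cardR)
      also have "\<dots> = p ^ (n * card J0) * p ^ (Suc n * card (J - {j} - J0))"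
        by (simp only: prod_constant power_mult[symmetric])
      also have "card (J - {j} - J0) = card J - card J0 - 1"
        using fin j \<open>J0 \<subseteq> J\<close> finite_subset[OF \<open>J0 \<subseteq> J\<close>]
        by (subst card_Diff_subset) auto
      finally show ?thesis by (simp add: power_add)
    qed
    finally show "card {C \<in> PiE X R. Q (?m C)} = p ^ (n * card J0 + Suc n * (card J - card J0 - 1)) * w"
      unfolding XX .
  qed
  then show ?thesis unfolding mats IJ cardT unfolding Q_def T_def by simp
qed

text \<open>For \<open>t = 1 / p\<close>: the probability that a square matrix of size
  \<open>r + b\<close> over the field with \<open>p\<close> elements has corank \<open>K\<close>,
  when \<open>r\<close> columns are zero and \<open>b\<close> columns are uniform.\<close>

definition corank_weight :: "real \<Rightarrow> nat \<Rightarrow> nat \<Rightarrow> nat \<Rightarrow> real" where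
  "corank_weight t r b K =
     (if r \<le> K \<and> K \<le> r + b
      then t ^ (K * (K - r)) * qpoch t t (r + b) * qpoch t t b
             / (qpoch t t K * qpoch t t (K - r) * qpoch t t (r + b - K))
      else 0)"

lemma corank_weight_0:
  assumes "0 < t" "t < 1"
  shows "corank_weight t r 0 K = (if K = r then 1 else 0)"
  using qpoch_base_pos[OF assms, of r] by (auto simp: corank_weight_def)

text \<open>One of the uniform columns, with \<open>r + Suc b\<close> entries, vanishes with
  probability \<open>t ^ (r + Suc b)\<close> and then joins the zero columns; otherwise a pivot
  removes it together with one row and leaves the corank unchanged.\<close>

lemma corank_weight_Suc:
  assumes t: "0 < t" "t < 1"
  shows "corank_weight t r (Suc b) K =
    t ^ (r + Suc b) * corank_weight t (Suc r) b K + (1 - t ^ (r + Suc b)) * corank_weight t r b K"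
proof -
  have P: "qpoch t t m \<noteq> 0" for m using qpoch_base_pos[OF t, of m] by simp
  have P': "1 - t * t ^ m \<noteq> 0" for m using power_Suc_less_one[OF t(1) t(2), of m] t by simp
  \<comment> \<open>At \<open>K = r\<close> the first term on the right vanishes, at
    \<open>K = Suc (r + b)\<close> the second. Strictly between them both contribute and the
    numerator splits as in the Pascal rule.\<close>
  consider "K < r \<or> K > Suc (r + b)" | "K = r" | i where "K = Suc (r + i)" "b = i"
    | i l where "K = Suc (r + i)" "b = Suc (i + l)"
  proof (cases "K < r \<or> K > Suc (r + b) \<or> K = r")
    case False
    then have "K = Suc (r + (K - r - 1))" by simp
    moreover from False have "b = K - r - 1 \<or> b = Suc ((K - r - 1) + (r + b - K))" by auto
    ultimately show ?thesis using that(3,4) by blast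
  qed (use that in auto)
  then show ?thesis
  proof cases
    case 1
    then show ?thesis by (auto simp: corank_weight_def)
  next
    case 2
    then show ?thesis using P P' by (simp add: corank_weight_def qpoch_Suc)
  next
    case 3
    then show ?thesis using P P' by (simp add: corank_weight_def qpoch_Suc power_add)
  next
    case (4 i l)
    define u where "u = 1 - t * t ^ i"
    define v where "v = 1 - t * t ^ l"
    define z where "z = 1 - t * t ^ (K + l)"
    have nz: "u \<noteq> 0" "v \<noteq> 0" "z \<noteq> 0" using P' by (auto simp: u_def v_def z_def)
    have rb: "r + b = K + l" "r + Suc b = Suc (K + l)" "Suc r + b = Suc (K + l)" "K - r = Suc i" "K - Suc r = i"
      using 4 by auto
    have b: "1 - t * t ^ b = t ^ Suc l * u + v"
      unfolding 4 u_def v_def by (simp add: power_add algebra_simps)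
    have Q: "qpoch t t (Suc b) = qpoch t t b * (t ^ Suc l * u + v)" "qpoch t t (Suc (K + l)) = qpoch t t (K + l) * z"
      "qpoch t t (Suc i) = qpoch t t i * u" "qpoch t t (Suc l) = qpoch t t l * v"
      by (simp_all only: qpoch_Suc b u_def v_def z_def)
    have le: "r \<le> K" "Suc r \<le> K" "K \<le> K + l" "K \<le> Suc (K + l)" "Suc (K + l) - K = Suc l" "K + l - K = l"
      "t ^ (K * Suc i) = t ^ (K * i) * t ^ K"
      using 4 by (auto simp: power_add)
    note simps = corank_weight_def rb Q le if_True simp_thms
    have e1: "corank_weight t r (Suc b) K = t ^ (K * i) * t ^ K * (qpoch t t (K + l) * z) * (qpoch t t b * (t ^ Suc l * u + v))
        / (qpoch t t K * (qpoch t t i * u) * (qpoch t t l * v))"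
      by (simp only: simps)
    have e2: "corank_weight t (Suc r) b K = t ^ (K * i) * (qpoch t t (K + l) * z) * qpoch t t b
        / (qpoch t t K * qpoch t t i * (qpoch t t l * v))"
      by (simp only: simps)
    have e3: "corank_weight t r b K = t ^ (K * i) * t ^ K * qpoch t t (K + l) * qpoch t t b
        / (qpoch t t K * (qpoch t t i * u) * qpoch t t l)"
      by (simp only: simps)
    have e4: "t ^ (r + Suc b) = t ^ K * t ^ Suc l" by (simp only: rb) (simp add: power_add)
    have e5: "1 - t ^ (r + Suc b) = z" by (simp only: rb) (simp add: z_def)
    have gen: "T * k * (m * z) * (qb * (s * u + v)) / (qK * (qi * u) * (ql * v))
        = k * s * (T * (m * z) * qb / (qK * qi * (ql * v))) + z * (T * k * m * qb / (qK * (qi * u) * ql))"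
      if "qK \<noteq> 0" "qi \<noteq> 0" "ql \<noteq> 0" for T k m qb s qK qi ql :: real
      using that nz by (simp add: field_simps)
    show ?thesis
      unfolding e1 e2 e3 e5 unfolding e4 by (rule gen) (rule P)+
  qed
qed

lemma Pker_0_eq_corank_weight:
  assumes "p > 0"
  shows "Pker p 0 N K = corank_weight (1 / real p) 0 N K"
proof -
  have "real p powr - real (K ^ 2) = (1 / real p) ^ (K * K)"
    using assms by (simp add: powr_minus powr_realpow power_one_over power2_eq_square divide_simps flip: of_nat_mult)
  moreover have "real p powr - 1 = 1 / real p" using assms by (simp add: powr_minus_divide)
  ultimately show ?thesis by (simp add: Pker_def corank_weight_def power2_eq_square)
qed

text \<open>Reveal the columns outside \<open>J0\<close> one at a time: a column without units joins \<open>J0\<close>, the others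
  are removed by a pivot step together with one row.\<close>
lemma card_divcol_mats_profile:
  fixes I :: "'r set" and J :: "'c set"
  assumes p: "prime p"
    and base: "\<And>(I :: 'r set) (J :: 'c set). finite I \<Longrightarrow> finite J \<Longrightarrow> card I = card J \<Longrightarrow>
      real (card {A \<in> divcol_mats p (Suc n) I J J. profile p (Suc n) I J (curry A) c}) = (if card J = c 1 then X else 0)"
    and "finite I" "finite J" "card I = card J" "J0 \<subseteq> J"
  shows "real (card {A \<in> divcol_mats p (Suc n) I J J0. profile p (Suc n) I J (curry A) c})
    = real p ^ (card J * (n * card J0 + Suc n * (card J - card J0)))
      * corank_weight (1 / real p) (card J0) (card J - card J0) (c 1) * (X / real p ^ (n * c 1 * c 1))"
  using assms(3-6)
proof (induction "card J - card J0" arbitrary: I J J0)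
  case 0
  have p1: "real p > 1" using prime_gt_1_nat[OF p] by simp
  have "card J0 = card J"
    using 0 card_mono[of J J0] by simp
  then have J0: "J0 = J" using 0 by (simp add: card_subset_eq)
  show ?case
    unfolding J0 base[OF 0(2,3,4)] using p1 corank_weight_0[of "1 / real p"] by (simp add: mult_ac)
next
  case (Suc b)
  have p0: "p > 0" using p by (rule prime_gt_0_nat)
  have p1: "real p > 1" using prime_gt_1_nat[OF p] by simp
  define t where "t = 1 / real p"
  have t: "0 < t" "t < 1" using p1 by (auto simp: t_def)
  have tp: "real p ^ M * t ^ M = 1" for M using p0 by (simp add: t_def flip: power_mult_distrib)
  \<comment> \<open>\<open>Y\<close> is the conditional probability of the later counts given the
    first: among the \<open>p ^ (n * c 1 * c 1)\<close> matrices of size \<open>c 1\<close> with all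
    entries divisible by \<open>p\<close>, exactly \<open>X\<close> have the profile.\<close>
  define Y where "Y = X / real p ^ (n * c 1 * c 1)"
  define r where "r = card J0"
  define E where "E = n * r + Suc n * b"
  have finJ0: "finite J0" using Suc.prems finite_subset by blast
  obtain j where j: "j \<in> J" "j \<notin> J0"
    using Suc by (metis card_mono diff_is_0_eq finJ0 nat.distinct(1) subsetI)
  have cJ: "card J = r + Suc b" using Suc.hyps(2) unfolding r_def by simp
  have cI: "card I = r + Suc b" using cJ Suc.prems by simp
  define S where "S I J J0 = {A \<in> divcol_mats p (Suc n) I J J0. profile p (Suc n) I J (curry A) c}"
    for I :: "'r set" and J J0 :: "'c set"
  have IH: "real (card (S (I - {a}) (J - {j}) J0)) = real p ^ ((r + b) * E) * corank_weight t r b (c 1) * Y"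
    if "a \<in> I" for a
  proof -
    have c: "card (J - {j}) = r + b" "card (I - {a}) = r + b"
      using cJ cI j that Suc.prems by auto
    have "b = card (J - {j}) - card J0" unfolding c r_def by simp
    from Suc.hyps(1)[OF this, of "I - {a}"] show ?thesis
      using Suc.prems j c unfolding S_def t_def Y_def E_def by (auto simp flip: r_def)
  qed
  have IH2: "real (card (S I J (insert j J0))) = real p ^ ((r + Suc b) * (E + n)) * corank_weight t (Suc r) b (c 1) * Y"
  proof -
    have c: "card (insert j J0) = Suc r" using finJ0 j by (simp add: r_def)
    have "b = card J - card (insert j J0)" unfolding c cJ by simp
    from Suc.hyps(1)[OF this Suc.prems(1-3)] show ?thesis
      using Suc.prems j unfolding S_def t_def Y_def E_def c cJ by (auto simp: algebra_simps)
  qed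
  obtain a0 where a0: "a0 \<in> I" using cI by fastforce
  define w where "w = card (S (I - {a0}) (J - {j}) J0)"
  \<comment> \<open>The induction hypothesis involves only the sizes, so the count is the same for
    every pivot row.\<close>
  have "card (S (I - {a}) (J - {j}) J0) = w" if "a \<in> I" for a
    using IH[OF that] IH[OF a0] unfolding w_def by simp
  then have "card {A \<in> divcol_mats p (Suc n) I J J0. profile p (Suc n) I J (curry A) c \<and> (\<exists>a\<in>I. \<not> int p dvd A (a, j))}
    = (p ^ (Suc n * card I) - p ^ (n * card I)) * (p ^ (n * card J0 + Suc n * (card J - card J0 - 1)) * w)"
    by (intro card_unit_pivot) (use p Suc.prems j in \<open>auto simp: S_def\<close>)
  moreover have "n * card J0 + Suc n * (card J - card J0 - 1) = E"
    by (simp add: E_def cJ flip: r_def)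
  ultimately have U: "card {A \<in> S I J J0. \<exists>a\<in>I. \<not> int p dvd A (a, j)}
    = (p ^ (Suc n * card I) - p ^ (n * card I)) * (p ^ E * w)"
    by (simp add: S_def)
  have D: "{A \<in> S I J J0. \<not> (\<exists>a\<in>I. \<not> int p dvd A (a, j))} = S I J (insert j J0)"
    using j by (auto simp: S_def divcol_mats_def PiE_iff split: if_splits)
  have "finite (divcol_mats p (Suc n) I J J0)"
    unfolding divcol_mats_def using Suc.prems
    by (intro finite_PiE) (auto intro: finite_subset[of _ "{0..<int p ^ Suc n}"])
  then have "finite (S I J J0)" by (simp add: S_def)
  then have "card (S I J J0) = card ({A \<in> S I J J0. \<exists>a\<in>I. \<not> int p dvd A (a, j)} \<union> {A \<in> S I J J0. \<not> (\<exists>a\<in>I. \<not> int p dvd A (a, j))})"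
    by (intro arg_cong[where f = card]) auto
  also have "\<dots> = card {A \<in> S I J J0. \<exists>a\<in>I. \<not> int p dvd A (a, j)} + card {A \<in> S I J J0. \<not> (\<exists>a\<in>I. \<not> int p dvd A (a, j))}"
    using \<open>finite (S I J J0)\<close> by (intro card_Un_disjoint) auto
  also have "\<dots> = (p ^ (Suc n * card I) - p ^ (n * card I)) * (p ^ E * w) + card (S I J (insert j J0))"
    unfolding U D ..
  finally have "real (card (S I J J0)) = (real p ^ (Suc n * card I) - real p ^ (n * card I)) * (real p ^ E * real w)
      + real (card (S I J (insert j J0)))"
    using p0 by (simp add: of_nat_diff power_increasing)
  also have "real w = real p ^ ((r + b) * E) * corank_weight t r b (c 1) * Y"
    unfolding w_def by (rule IH[OF a0])
  also have "(real p ^ (Suc n * card I) - real p ^ (n * card I)) = real p ^ (Suc n * (r + Suc b)) * (1 - t ^ (r + Suc b))"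
  proof -
    have "real p ^ (Suc n * (r + Suc b)) = real p ^ (n * (r + Suc b)) * real p ^ (r + Suc b)"
      by (simp only: power_add[symmetric] mult_Suc add.commute)
    then show ?thesis unfolding cI using tp[of "r + Suc b"] by (simp only: right_diff_distrib mult.assoc mult_1_right)
  qed
  also note IH2
  also have "real p ^ ((r + Suc b) * (E + n)) = real p ^ ((r + Suc b) * (E + Suc n)) * t ^ (r + Suc b)"
  proof -
    have "real p ^ ((r + Suc b) * (E + Suc n)) = real p ^ ((r + Suc b) * (E + n)) * real p ^ (r + Suc b)"
      by (simp only: power_add[symmetric] mult_Suc_right add_Suc_right add.commute)
    then show ?thesis using tp[of "r + Suc b"] by (simp only: mult.assoc mult_1_right)
  qed
  also have "real p ^ (Suc n * (r + Suc b)) * (1 - t ^ (r + Suc b)) *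
      (real p ^ E * (real p ^ ((r + b) * E) * corank_weight t r b (c 1) * Y))
     = real p ^ ((r + Suc b) * (E + Suc n)) * (1 - t ^ (r + Suc b)) * corank_weight t r b (c 1) * Y"
  proof -
    have "(r + Suc b) * (E + Suc n) = Suc n * (r + Suc b) + (E + (r + b) * E)" by (simp add: algebra_simps)
    then have "real p ^ ((r + Suc b) * (E + Suc n)) = real p ^ (Suc n * (r + Suc b)) * (real p ^ E * real p ^ ((r + b) * E))"
      by (simp only: power_add)
    then show ?thesis by (simp only: mult_ac)
  qed
  also have "\<dots> + real p ^ ((r + Suc b) * (E + Suc n)) * t ^ (r + Suc b) * corank_weight t (Suc r) b (c 1) * Y
     = real p ^ ((r + Suc b) * (E + Suc n)) * corank_weight t r (Suc b) (c 1) * Y"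
  proof -
    have "P * (1 - k) * x * Y + P * k * x' * Y = P * (k * x' + (1 - k) * x) * Y" for P k x x' :: real
      by (simp add: algebra_simps)
    then show ?thesis using corank_weight_Suc[OF t, of r b "c 1"] by simp
  qed
  also have "(r + Suc b) * (E + Suc n) = card J * (n * card J0 + Suc n * (card J - card J0))"
    unfolding cJ E_def by (simp flip: r_def add: algebra_simps)
  finally show ?case unfolding S_def cJ t_def Y_def by (simp flip: r_def)
qed

lemma card_mats_profile:
  fixes I :: "'r set" and J :: "'c set"
  assumes p: "prime p" and "finite I" "finite J" "card I = card J" "card J = c 0"
  shows "real (card {A \<in> I \<times> J \<rightarrow>\<^sub>E {0..<int p ^ n}. profile p n I J (curry A) c})
    = real p ^ (n * c 0 * c 0) * (\<Prod>i<n. Pker p 0 (c i) (c (Suc i)))"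
  using assms(2-)
proof (induction n arbitrary: I J c)
  case 0
  have e: "{A \<in> I \<times> J \<rightarrow>\<^sub>E {0..<int p ^ 0}. profile p 0 I J (curry A) c} = {\<lambda>x\<in>I \<times> J. 0}"
    by (force simp: profile_def PiE_iff extensional_def fun_eq_iff)
  show ?case by (subst e) simp
next
  case (Suc n)
  have p0: "p > 0" using p by (rule prime_gt_0_nat)
  define X where "X = real p ^ (n * c 1 * c 1) * (\<Prod>i<n. Pker p 0 (c (Suc i)) (c (Suc (Suc i))))"
  \<comment> \<open>Once all entries are divisible by \<open>p\<close>, the matrix is
    \<open>p\<close> times one modulo \<open>p ^ n\<close>, and the induction hypothesis applies to
    the shifted counts. It has to cover all index sets, because the pivots leave unspecified rows
    and columns.\<close>
  have base: "real (card {A \<in> divcol_mats p (Suc n) I J J. profile p (Suc n) I J (curry A) c}) = (if card J = c 1 then X else 0)"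
    if "finite I" "finite J" "card I = card J" for I :: "'r set" and J :: "'c set"
  proof -
    let ?L = "{A \<in> I \<times> J \<rightarrow>\<^sub>E {0..<int p ^ n}. card J = c 1 \<and> profile p n I J (curry A) (\<lambda>l. c (Suc l))}"
    let ?K = "{A \<in> divcol_mats p (Suc n) I J J. profile p (Suc n) I J (curry A) c}"
    define f where "f A = (\<lambda>z\<in>I \<times> J. int p * A z)" for A :: "'r \<times> 'c \<Rightarrow> int"
    have f: "profile p (Suc n) I J (curry (f A)) c \<longleftrightarrow> card J = c 1 \<and> profile p n I J (curry A) (\<lambda>l. c (Suc l))" for A
    proof -
      have "profile p (Suc n) I J (curry (f A)) c \<longleftrightarrow> profile p (Suc n) I J (\<lambda>a b. int p * curry A a b) c"
        by (rule profile_cong) (simp add: f_def)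
      then show ?thesis using profile_scale[OF that(2) p, of n I "curry A" c] by simp
    qed
    have D: "A \<in> divcol_mats p (Suc n) I J J \<longleftrightarrow> A \<in> extensional (I \<times> J) \<and> (\<forall>z\<in>I \<times> J. 0 \<le> A z \<and> A z < int p * int p ^ n \<and> int p dvd A z)" for A
      by (auto simp: divcol_mats_def PiE_iff)
    have "bij_betw f ?L ?K"
    proof (rule bij_betw_byWitness[where f' = "\<lambda>A. \<lambda>z\<in>I \<times> J. A z div int p"])
      show "\<forall>A\<in>?L. (\<lambda>z\<in>I \<times> J. f A z div int p) = A"
        using p0 by (auto simp: f_def fun_eq_iff PiE_iff extensional_def)
      show inv: "\<forall>A\<in>?K. f (\<lambda>z\<in>I \<times> J. A z div int p) = A"
        by (auto simp: f_def fun_eq_iff D extensional_def)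
      show "f ` ?L \<subseteq> ?K"
      proof (rule image_subsetI)
        fix A assume A: "A \<in> ?L"
        have "0 \<le> f A z \<and> f A z < int p * int p ^ n \<and> int p dvd f A z" if "z \<in> I \<times> J" for z
        proof -
          have "A z \<in> {0..<int p ^ n}" using A that by blast
          then show ?thesis using that p0 by (auto simp: f_def)
        qed
        moreover have "f A \<in> extensional (I \<times> J)" by (simp add: f_def)
        ultimately have "f A \<in> divcol_mats p (Suc n) I J J" unfolding D by blast
        then show "f A \<in> ?K" using A f by blast
      qed
      show "(\<lambda>A. \<lambda>z\<in>I \<times> J. A z div int p) ` ?K \<subseteq> ?L"
      proof (rule image_subsetI)
        fix A assume A: "A \<in> ?K"
        let ?A = "\<lambda>z\<in>I \<times> J. A z div int p"
        have "?A \<in> I \<times> J \<rightarrow>\<^sub>E {0..<int p ^ n}"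
        proof (rule restrict_PiE_iff[THEN iffD2], rule ballI)
          fix z assume "z \<in> I \<times> J"
          then obtain y where y: "A z = int p * y" "0 \<le> A z" "A z < int p * int p ^ n"
            using A unfolding D mem_Collect_eq by (meson dvdE)
          then show "A z div int p \<in> {0..<int p ^ n}" using p0 by (auto simp: zero_le_mult_iff)
        qed
        moreover have "profile p (Suc n) I J (curry (f ?A)) c" using A inv by auto
        ultimately show "?A \<in> ?L" using f by blast
      qed
    qed
    then have "card ?K = card ?L" by (rule bij_betw_same_card[symmetric])
    moreover have "real (card ?L) = (if card J = c 1 then X else 0)"
    proof (cases "card J = c 1")
      case True
      then show ?thesis using Suc.IH[OF that, of "\<lambda>l. c (Suc l)"] by (simp add: X_def curry_def)
    qed simp
    ultimately show ?thesis by simp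
  qed
  have "{A \<in> I \<times> J \<rightarrow>\<^sub>E {0..<int p ^ Suc n}. profile p (Suc n) I J (curry A) c}
      = {A \<in> divcol_mats p (Suc n) I J {}. profile p (Suc n) I J (curry A) c}"
    by (auto simp: divcol_mats_def PiE_iff)
  also have "real (card \<dots>) = real p ^ (card J * (n * card ({} :: 'c set) + Suc n * (card J - card ({} :: 'c set))))
      * corank_weight (1 / real p) (card ({} :: 'c set)) (card J - card ({} :: 'c set)) (c 1) * (X / real p ^ (n * c 1 * c 1))"
    by (rule card_divcol_mats_profile[OF p base]) (use Suc.prems in auto)
  also have "\<dots> = real p ^ (Suc n * c 0 * c 0) * (Pker p 0 (c 0) (c 1) * (\<Prod>i<n. Pker p 0 (c (Suc i)) (c (Suc (Suc i)))))"
    using p0 Suc.prems(4) by (simp add: Pker_0_eq_corank_weight X_def mult_ac)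
  also have "Pker p 0 (c 0) (c 1) * (\<Prod>i<n. Pker p 0 (c (Suc i)) (c (Suc (Suc i)))) = (\<Prod>i<Suc n. Pker p 0 (c i) (c (Suc i)))"
    by (subst prod.lessThan_Suc_shift) simp
  finally show ?case .
qed

section \<open>Smith normal form over the p-adic integers\<close>

text \<open>A p-adic integer of which the term at \<open>n\<close> records only the residue modulo
  \<open>p ^ n\<close>. The terms are not normalised to digits, so ring operations act
  termwise.\<close>

definition coh :: "nat \<Rightarrow> (nat \<Rightarrow> int) \<Rightarrow> bool" where
  "coh p x \<longleftrightarrow> (\<forall>n. [x (Suc n) = x n] (mod int p ^ n))"

lemma coh_diff: "coh p x \<Longrightarrow> coh p y \<Longrightarrow> coh p (\<lambda>n. x n - y n)"
  and coh_mult: "coh p x \<Longrightarrow> coh p y \<Longrightarrow> coh p (\<lambda>n. x n * y n)"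
  and coh_minus: "coh p x \<Longrightarrow> coh p (\<lambda>n. - x n)"
  and coh_const: "coh p (\<lambda>n. z)"
  by (auto simp: coh_def intro: cong_diff cong_mult cong_minus_minus_iff[THEN iffD2])

lemma coh_sum: "(\<And>c. c \<in> T \<Longrightarrow> coh p (x c)) \<Longrightarrow> coh p (\<lambda>n. \<Sum>c\<in>T. x c n)"
  by (auto simp: coh_def intro: cong_sum)

lemma coh_mono:
  assumes "coh p x" "n \<le> m"
  shows "[x m = x n] (mod int p ^ n)"
  using assms(2)
proof (induction m rule: dec_induct)
  case (step m)
  have "[x (Suc m) = x m] (mod int p ^ n)"
    using assms(1) step.hyps unfolding coh_def by (meson cong_dvd_modulus le_imp_power_dvd)
  then show ?case using step.IH by (rule cong_trans)
qed simp

text \<open>The inverses modulo the separate powers can be chosen independently: an inverse is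
  unique modulo \<open>p ^ n\<close>, and this forces coherence.\<close>

lemma coh_inverse:
  assumes p: "prime p" and x: "coh p x" and u: "\<not> int p dvd x 1"
  obtains y where "coh p y" "\<And>n. [x n * y n = 1] (mod int p ^ n)"
proof -
  have "\<exists>y. [x n * y = 1] (mod int p ^ n)" for n
  proof (cases n)
    case 0
    then show ?thesis by (auto intro: exI[of _ 0])
  next
    case (Suc m)
    have "[x n = x 1] (mod int p ^ 1)" using x by (rule coh_mono) (simp add: Suc)
    then have "\<not> int p dvd x n" using u cong_dvd_iff by simp blast
    then have "coprime (x n) (int p ^ n)" using p by (simp add: prime_imp_coprime coprime_commute)
    then show ?thesis using cong_solve_coprime_int by blast
  qed
  then obtain y where y: "[x n * y n = 1] (mod int p ^ n)" for n by metis
  have "coh p y" unfolding coh_def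
  proof
    fix n
    have 1: "[x n * y n = 1] (mod int p ^ n)" by (rule y)
    have "[x (Suc n) * y (Suc n) = 1] (mod int p ^ n)"
      using y[of "Suc n"] by (meson cong_dvd_modulus le_imp_power_dvd le_SucI le_refl)
    moreover have "[x (Suc n) * y (Suc n) = x n * y (Suc n)] (mod int p ^ n)"
      using x unfolding coh_def by (intro cong_mult) auto
    ultimately have 2: "[x n * y (Suc n) = 1] (mod int p ^ n)" using cong_sym cong_trans by blast
    have "[y (Suc n) = y (Suc n) * (x n * y n)] (mod int p ^ n)"
      using cong_mult[OF cong_refl[of "y (Suc n)"] 1] by (simp add: cong_sym)
    also have "y (Suc n) * (x n * y n) = (x n * y (Suc n)) * y n" by simp
    also have "[\<dots> = 1 * y n] (mod int p ^ n)" by (intro cong_mult 2 cong_refl)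
    finally show "[y (Suc n) = y n] (mod int p ^ n)" by simp
  qed
  then show ?thesis using y that by blast
qed

text \<open>Division by \<open>p ^ e\<close> costs \<open>e\<close> digits of precision, hence the
  index \<open>n + e\<close>. Divisibility of the single term at \<open>e\<close> passes to all
  later terms by coherence.\<close>

lemma coh_divide:
  assumes "p > 0" and x: "coh p x" and e: "[x e = 0] (mod int p ^ e)"
  shows "coh p (\<lambda>n. x (n + e) div int p ^ e)"
    and "[x n = int p ^ e * (x (n + e) div int p ^ e)] (mod int p ^ n)"
    and "int p ^ e * (x (n + e) div int p ^ e) = x (n + e)"
proof -
  have E: "int p ^ e * (x (n + e) div int p ^ e) = x (n + e)" for n
  proof -
    have "[x (n + e) = x e] (mod int p ^ e)" using x by (rule coh_mono) simp
    then have "int p ^ e dvd x (n + e)" using e by (metis cong_0_iff cong_trans)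
    then show ?thesis by simp
  qed
  then show "int p ^ e * (x (n + e) div int p ^ e) = x (n + e)" .
  show "[x n = int p ^ e * (x (n + e) div int p ^ e)] (mod int p ^ n)"
    unfolding E using coh_mono[OF x, of n "n + e"] by (simp add: cong_sym)
  show "coh p (\<lambda>n. x (n + e) div int p ^ e)" unfolding coh_def
  proof
    fix n
    have "[x (Suc n + e) = x (n + e)] (mod int p ^ (n + e))" using x unfolding coh_def by simp
    then have "int p ^ e * int p ^ n dvd int p ^ e * (x (Suc n + e) div int p ^ e) - int p ^ e * (x (n + e) div int p ^ e)"
      unfolding E by (simp add: cong_iff_dvd_diff power_add mult.commute)
    then have "int p ^ n dvd x (Suc n + e) div int p ^ e - x (n + e) div int p ^ e"
      using \<open>p > 0\<close> unfolding right_diff_distrib[symmetric] by simp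
    then show "[x (Suc n + e) div int p ^ e = x (n + e) div int p ^ e] (mod int p ^ n)"
      by (simp add: cong_iff_dvd_diff)
  qed
qed

section \<open>Invertible matrices and elimination over coherent sequences\<close>

definition inv_pair :: "nat \<Rightarrow> 'r set \<Rightarrow> 't set \<Rightarrow> (nat \<Rightarrow> 'r \<Rightarrow> 't \<Rightarrow> int) \<Rightarrow> (nat \<Rightarrow> 't \<Rightarrow> 'r \<Rightarrow> int) \<Rightarrow> bool" where
  "inv_pair p I T B B' \<longleftrightarrow>
     (\<forall>a\<in>I. \<forall>c\<in>T. coh p (\<lambda>n. B n a c) \<and> coh p (\<lambda>n. B' n c a)) \<and>
     (\<forall>n. \<forall>a\<in>I. \<forall>d\<in>I. [(\<Sum>c\<in>T. B n a c * B' n c d) = (if a = d then 1 else 0)] (mod int p ^ n)) \<and>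
     (\<forall>n. \<forall>c\<in>T. \<forall>d\<in>T. [(\<Sum>a\<in>I. B' n c a * B n a d) = (if c = d then 1 else 0)] (mod int p ^ n))"

text \<open>In block form \<open>B\<close> is triangular with diagonal blocks \<open>u n a0\<close>
  and \<open>B1\<close>. The inverse has diagonal blocks \<open>y\<close> and \<open>B1'\<close> and
  the off-diagonal column \<open>- y * B1' * u\<close>.\<close>

lemma inv_pair_extend:
  fixes B1 :: "nat \<Rightarrow> 'r \<Rightarrow> 't \<Rightarrow> int"
  assumes fin: "finite I" "finite T" and inv: "inv_pair p I T B1 B1'" and new: "a0 \<notin> I" "t \<notin> T"
    and u: "\<And>a. a \<in> insert a0 I \<Longrightarrow> coh p (\<lambda>n. u n a)"
    and y: "coh p y" "\<And>n. [u n a0 * y n = 1] (mod int p ^ n)"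
  defines "B \<equiv> \<lambda>n a c. if c = t then u n a else if a = a0 then 0 else B1 n a c"
  shows "\<exists>B'. inv_pair p (insert a0 I) (insert t T) B B'"
proof -
  define B' where "B' n c a = (if c = t then (if a = a0 then y n else 0)
      else if a = a0 then - y n * (\<Sum>b\<in>I. B1' n c b * u n b) else B1' n c a)" for n c a
  have coh1: "coh p (\<lambda>n. B1 n a c)" "coh p (\<lambda>n. B1' n c a)" if "a \<in> I" "c \<in> T" for a c
    using inv that unfolding inv_pair_def by auto
  have BB': "[(\<Sum>c\<in>T. B1 n a c * B1' n c d) = (if a = d then 1 else 0)] (mod int p ^ n)" if "a \<in> I" "d \<in> I" for n a d
    using inv that unfolding inv_pair_def by blast
  have B'B: "[(\<Sum>a\<in>I. B1' n c a * B1 n a d) = (if c = d then 1 else 0)] (mod int p ^ n)" if "c \<in> T" "d \<in> T" for n c d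
    using inv that unfolding inv_pair_def by blast
  have neI: "a \<noteq> a0" if "a \<in> I" for a using that new by auto
  have neT: "c \<noteq> t" if "c \<in> T" for c using that new by auto
  have "inv_pair p (insert a0 I) (insert t T) B B'"
    unfolding inv_pair_def
  proof (intro conjI ballI allI)
    fix a c assume ac: "a \<in> insert a0 I" "c \<in> insert t T"
    show "coh p (\<lambda>n. B n a c)"
      using ac u coh1 coh_const[of p 0] by (auto simp: B_def neT neI)
    show "coh p (\<lambda>n. B' n c a)"
      using ac u coh1 y(1) coh_const[of p 0] unfolding B'_def
      by (auto simp: neT neI intro!: coh_minus coh_mult coh_sum)
  next
    fix n a d assume ad: "a \<in> insert a0 I" "d \<in> insert a0 I"
    have "(\<Sum>c\<in>insert t T. B n a c * B' n c d) = u n a * B' n t d + (\<Sum>c\<in>T. B n a c * B' n c d)"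
      using fin new by (simp add: B_def)
    moreover have "[u n a * B' n t d + (\<Sum>c\<in>T. B n a c * B' n c d) = (if a = d then 1 else 0)] (mod int p ^ n)"
    proof (cases "a = a0")
      case True
      then have "(\<Sum>c\<in>T. B n a c * B' n c d) = 0" using neT by (intro sum.neutral) (auto simp: B_def)
      then show ?thesis using True y(2) by (auto simp: B'_def)
    next
      case False
      then have aI: "a \<in> I" using ad by simp
      show ?thesis
      proof (cases "d = a0")
        case True
        have "(\<Sum>c\<in>T. B n a c * B' n c d) = (\<Sum>c\<in>T. - y n * (B1 n a c * (\<Sum>b\<in>I. B1' n c b * u n b)))"
          using True False neT by (intro sum.cong) (auto simp: B_def B'_def)
        also have "\<dots> = - y n * (\<Sum>c\<in>T. B1 n a c * (\<Sum>b\<in>I. B1' n c b * u n b))"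
          by (rule sum_distrib_left[symmetric])
        also have "(\<Sum>c\<in>T. B1 n a c * (\<Sum>b\<in>I. B1' n c b * u n b)) = (\<Sum>b\<in>I. (\<Sum>c\<in>T. B1 n a c * B1' n c b) * u n b)"
          by (simp add: sum_distrib_left sum_distrib_right mult.assoc) (rule sum.swap)
        finally have "u n a * B' n t d + (\<Sum>c\<in>T. B n a c * B' n c d)
            = u n a * y n + - y n * (\<Sum>b\<in>I. (\<Sum>c\<in>T. B1 n a c * B1' n c b) * u n b)"
          using True by (simp add: B'_def)
        also have "[\<dots> = u n a * y n + - y n * u n a] (mod int p ^ n)"
          by (intro cong_add cong_mult cong_refl sum_delta_mult_cong) (use fin aI BB' in auto)
        finally show ?thesis using True False by simp
      next
        case F: False
        then have "d \<in> I" using ad by simp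
        have "(\<Sum>c\<in>T. B n a c * B' n c d) = (\<Sum>c\<in>T. B1 n a c * B1' n c d)"
          using F False neT by (intro sum.cong) (auto simp: B_def B'_def)
        then show ?thesis using BB'[OF aI \<open>d \<in> I\<close>] F by (simp add: B'_def)
      qed
    qed
    ultimately show "[(\<Sum>c\<in>insert t T. B n a c * B' n c d) = (if a = d then 1 else 0)] (mod int p ^ n)" by simp
  next
    fix n c d assume cd: "c \<in> insert t T" "d \<in> insert t T"
    have "(\<Sum>a\<in>insert a0 I. B' n c a * B n a d) = B' n c a0 * B n a0 d + (\<Sum>a\<in>I. B' n c a * B n a d)"
      using fin new by simp
    moreover have "[B' n c a0 * B n a0 d + (\<Sum>a\<in>I. B' n c a * B n a d) = (if c = d then 1 else 0)] (mod int p ^ n)"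
    proof (cases "c = t")
      case True
      then have "(\<Sum>a\<in>I. B' n c a * B n a d) = 0" using neI by (intro sum.neutral) (auto simp: B'_def)
      then show ?thesis using True y(2)[of n] by (auto simp: B_def B'_def mult.commute)
    next
      case False
      then have cT: "c \<in> T" using cd by simp
      show ?thesis
      proof (cases "d = t")
        case True
        have "(\<Sum>a\<in>I. B' n c a * B n a d) = (\<Sum>b\<in>I. B1' n c b * u n b)"
          using True False neI by (intro sum.cong) (auto simp: B_def B'_def)
        then have "B' n c a0 * B n a0 d + (\<Sum>a\<in>I. B' n c a * B n a d)
           = - (\<Sum>b\<in>I. B1' n c b * u n b) * (u n a0 * y n) + (\<Sum>b\<in>I. B1' n c b * u n b)"
          using True False by (simp add: B_def B'_def)
        also have "[\<dots> = - (\<Sum>b\<in>I. B1' n c b * u n b) * 1 + (\<Sum>b\<in>I. B1' n c b * u n b)] (mod int p ^ n)"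
          by (intro cong_add cong_mult cong_refl y(2))
        finally show ?thesis using True False by simp
      next
        case F: False
        then have "d \<in> T" using cd by simp
        have "(\<Sum>a\<in>I. B' n c a * B n a d) = (\<Sum>a\<in>I. B1' n c a * B1 n a d)"
          using F False neI by (intro sum.cong) (auto simp: B_def B'_def)
        then show ?thesis using B'B[OF cT \<open>d \<in> T\<close>] F by (simp add: B_def)
      qed
    qed
    ultimately show "[(\<Sum>a\<in>insert a0 I. B' n c a * B n a d) = (if c = d then 1 else 0)] (mod int p ^ n)" by simp
  qed
  then show ?thesis by blast
qed

definition ppow :: "nat \<Rightarrow> nat option \<Rightarrow> int" where
  "ppow p d = (case d of None \<Rightarrow> 0 | Some e \<Rightarrow> int p ^ e)"

text \<open>The diagonal factor is indexed by the rows; \<open>W\<close> is the transpose of the right factor.\<close>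
definition has_snf :: "nat \<Rightarrow> 'r set \<Rightarrow> 'c set \<Rightarrow> (nat \<Rightarrow> 'r \<Rightarrow> 'c \<Rightarrow> int) \<Rightarrow> bool" where
  "has_snf p I J A \<longleftrightarrow> (\<exists>B B' W W' \<delta>. inv_pair p I I B B' \<and> inv_pair p J I W W' \<and>
     (\<forall>n. \<forall>a\<in>I. \<forall>b\<in>J. [A n a b = (\<Sum>c\<in>I. B n a c * ppow p (\<delta> c) * W n b c)] (mod int p ^ n)))"

text \<open>The rank one matrix built from \<open>u\<close>, \<open>d\<close> and \<open>w\<close>
  agrees with \<open>A\<close> in row \<open>a0\<close> and column \<open>b0\<close>. Subtracting it
  leaves a smaller block, and appending \<open>u\<close> and \<open>w\<close> to the factors of that
  block adds it back.\<close>

lemma has_snf_step: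
  fixes I :: "'r set" and J :: "'c set"
  assumes fin: "finite I" "finite J" and a0: "a0 \<in> I" and b0: "b0 \<in> J"
    and u: "\<And>a. a \<in> I \<Longrightarrow> coh p (\<lambda>n. u n a)" and y: "coh p y" "\<And>n. [u n a0 * y n = 1] (mod int p ^ n)"
    and w: "\<And>b. b \<in> J \<Longrightarrow> coh p (\<lambda>n. w n b)" and z: "coh p z" "\<And>n. [w n b0 * z n = 1] (mod int p ^ n)"
    and row: "\<And>n b. b \<in> J \<Longrightarrow> [A n a0 b = u n a0 * ppow p d * w n b] (mod int p ^ n)"
    and col: "\<And>n a. a \<in> I \<Longrightarrow> [A n a b0 = u n a * ppow p d * w n b0] (mod int p ^ n)"
    and snf: "has_snf p (I - {a0}) (J - {b0}) (\<lambda>n a b. A n a b - u n a * ppow p d * w n b)"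
  shows "has_snf p I J A"
proof -
  obtain B B' W W' \<delta> where B: "inv_pair p (I - {a0}) (I - {a0}) B B'"
    and W: "inv_pair p (J - {b0}) (I - {a0}) W W'"
    and A: "\<And>n a b. a \<in> I - {a0} \<Longrightarrow> b \<in> J - {b0} \<Longrightarrow>
       [A n a b - u n a * ppow p d * w n b = (\<Sum>c\<in>I - {a0}. B n a c * ppow p (\<delta> c) * W n b c)] (mod int p ^ n)"
    using snf unfolding has_snf_def by blast
  have I: "insert a0 (I - {a0}) = I" and J: "insert b0 (J - {b0}) = J" using a0 b0 by auto
  define B2 where "B2 n a c = (if c = a0 then u n a else if a = a0 then 0 else B n a c)" for n a c
  define W2 where "W2 n b c = (if c = a0 then w n b else if b = b0 then 0 else W n b c)" for n b c
  have "\<exists>B'. inv_pair p (insert a0 (I - {a0})) (insert a0 (I - {a0})) B2 B'"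
    unfolding B2_def by (rule inv_pair_extend[OF _ _ B]) (use fin a0 u y in auto)
  then obtain B2' where B2: "inv_pair p I I B2 B2'" unfolding I by blast
  have "\<exists>W'. inv_pair p (insert b0 (J - {b0})) (insert a0 (I - {a0})) W2 W'"
    unfolding W2_def by (rule inv_pair_extend[OF _ _ W]) (use fin b0 w z in auto)
  then obtain W2' where W2: "inv_pair p J I W2 W2'" unfolding I J by blast
  define \<delta>2 where "\<delta>2 = \<delta>(a0 := d)"
  have "[A n a b = (\<Sum>c\<in>I. B2 n a c * ppow p (\<delta>2 c) * W2 n b c)] (mod int p ^ n)" if "a \<in> I" "b \<in> J" for n a b
  proof -
    have s: "(\<Sum>c\<in>I. B2 n a c * ppow p (\<delta>2 c) * W2 n b c)
       = u n a * ppow p d * w n b + (\<Sum>c\<in>I - {a0}. B2 n a c * ppow p (\<delta>2 c) * W2 n b c)"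
      by (subst sum.remove[OF fin(1) a0]) (simp add: B2_def W2_def \<delta>2_def)
    show ?thesis
    proof (cases "a = a0 \<or> b = b0")
      case True
      then have "(\<Sum>c\<in>I - {a0}. B2 n a c * ppow p (\<delta>2 c) * W2 n b c) = 0"
        by (intro sum.neutral) (auto simp: B2_def W2_def)
      then show ?thesis using True row col that unfolding s by auto
    next
      case False
      have "(\<Sum>c\<in>I - {a0}. B2 n a c * ppow p (\<delta>2 c) * W2 n b c) = (\<Sum>c\<in>I - {a0}. B n a c * ppow p (\<delta> c) * W n b c)"
        using False by (intro sum.cong) (auto simp: B2_def W2_def \<delta>2_def)
      then show ?thesis
        using cong_add[OF cong_refl[of "u n a * ppow p d * w n b"] A[of a b n]] False that unfolding s by simp
    qed
  qed
  then show ?thesis using B2 W2 unfolding has_snf_def by blast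
qed

text \<open>Elimination at an entry of least valuation: the pivot divides every entry, so its row
  and column are cleared without denominators.\<close>

lemma has_snf:
  fixes I :: "'r set" and J :: "'c set"
  assumes p: "prime p" and "finite I" "finite J" "card I = card J"
    and "\<And>a b. a \<in> I \<Longrightarrow> b \<in> J \<Longrightarrow> coh p (\<lambda>n. A n a b)"
  shows "has_snf p I J A"
  using assms(2-)
proof (induction "card I" arbitrary: I J A)
  case 0
  then show ?case by (simp add: has_snf_def inv_pair_def)
next
  case (Suc k)
  note fin = Suc.prems(1,2)
  note coh = Suc.prems(4)
  have p0: "p > 0" using p by (rule prime_gt_0_nat)
  have IH: "has_snf p (I - {a}) (J - {b}) A'"
    if "a \<in> I" "b \<in> J" "\<And>a b. a \<in> I \<Longrightarrow> b \<in> J \<Longrightarrow> coh p (\<lambda>n. A' n a b)" for a b A'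
    using that Suc.prems Suc.hyps(2) by (intro Suc.hyps(1)) auto
  show ?case
  proof (cases "\<forall>n. \<forall>a\<in>I. \<forall>b\<in>J. [A n a b = 0] (mod int p ^ n)")
    case True
    obtain a0 b0 where a0: "a0 \<in> I" and b0: "b0 \<in> J"
      using Suc.hyps(2) Suc.prems(3) by (metis card.empty ex_in_conv nat.distinct(1))
    \<comment> \<open>For the zero matrix the rank one term is zero, and any vectors with units at
      the pivot position serve.\<close>
    show ?thesis
    proof (rule has_snf_step[OF fin a0 b0, where u = "\<lambda>_ _. 1" and w = "\<lambda>_ _. 1" and y = "\<lambda>_. 1" and z = "\<lambda>_. 1" and d = None])
      show "has_snf p (I - {a0}) (J - {b0}) (\<lambda>n a b. A n a b - 1 * ppow p None * 1)"
        using coh by (intro IH a0 b0 coh_diff coh_const) auto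
    qed (use True a0 b0 in \<open>auto simp: ppow_def coh_const\<close>)
  next
    case False
    \<comment> \<open>\<open>N\<close> is the first exponent at which some entry is nonzero, so
      \<open>N - 1\<close> is the least valuation, attained at \<open>(a0, b0)\<close>.\<close>
    define N where "N = (LEAST n. \<exists>a\<in>I. \<exists>b\<in>J. \<not> [A n a b = 0] (mod int p ^ n))"
    have ex: "\<exists>n. \<exists>a\<in>I. \<exists>b\<in>J. \<not> [A n a b = 0] (mod int p ^ n)" using False by blast
    obtain a0 b0 where a0: "a0 \<in> I" and b0: "b0 \<in> J" and N: "\<not> [A N a0 b0 = 0] (mod int p ^ N)"
      using LeastI_ex[OF ex] unfolding N_def by blast
    have "N \<noteq> 0" by (rule notI) (use N in simp)
    then obtain e where e: "N = Suc e" using not0_implies_Suc by blast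
    have z: "[A e a b = 0] (mod int p ^ e)" if "a \<in> I" "b \<in> J" for a b
      using not_less_Least[of e "\<lambda>n. \<exists>a\<in>I. \<exists>b\<in>J. \<not> [A n a b = 0] (mod int p ^ n)"] that e
      unfolding N_def[symmetric] by auto
    define A' where "A' n a b = A (n + e) a b div int p ^ e" for n a b
    have coh': "coh p (\<lambda>n. A' n a b)" if "a \<in> I" "b \<in> J" for a b
      unfolding A'_def by (rule coh_divide[OF p0 coh z]) (rule that)+
    have A: "[A n a b = int p ^ e * A' n a b] (mod int p ^ n)" if "a \<in> I" "b \<in> J" for n a b
      unfolding A'_def by (rule coh_divide[OF p0 coh z]) (rule that)+
    have A1: "int p ^ e * A' 1 a0 b0 = A N a0 b0"
      unfolding A'_def e using coh_divide(3)[OF p0 coh z, of a0 b0 1] a0 b0 by simp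
    have "\<not> int p dvd A' 1 a0 b0"
    proof
      assume "int p dvd A' 1 a0 b0"
      then have "int p ^ e * int p dvd int p ^ e * A' 1 a0 b0" by (rule mult_dvd_mono[OF dvd_refl])
      then show False using N unfolding A1 e by (simp add: cong_0_iff mult.commute)
    qed
    then obtain y where y: "coh p y" "\<And>n. [A' n a0 b0 * y n = 1] (mod int p ^ n)"
      using coh_inverse[OF p coh'[OF a0 b0]] by blast
    \<comment> \<open>The column of \<open>A'\<close> through the pivot, times the row divided by
      the pivot, reproduces both. The inverse \<open>y\<close> is put into \<open>w\<close>, whose
      pivot entry is then congruent to one.\<close>
    show ?thesis
    proof (rule has_snf_step[OF fin a0 b0, where u = "\<lambda>n a. A' n a b0" and w = "\<lambda>n b. A' n a0 b * y n"
          and y = y and z = "\<lambda>_. 1" and d = "Some e"])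
      show "coh p (\<lambda>n. A' n a b0)" if "a \<in> I" for a using coh' that b0 by blast
      show "coh p (\<lambda>n. A' n a0 b * y n)" if "b \<in> J" for b using coh' that a0 y by (intro coh_mult) auto
      show "[A n a0 b = A' n a0 b0 * ppow p (Some e) * (A' n a0 b * y n)] (mod int p ^ n)" if "b \<in> J" for n b
      proof -
        have "[int p ^ e * A' n a0 b * 1 = int p ^ e * A' n a0 b * (A' n a0 b0 * y n)] (mod int p ^ n)"
          by (intro cong_mult cong_refl cong_sym[OF y(2)])
        then show ?thesis using A[OF a0 that, of n] unfolding ppow_def
          by (simp add: mult_ac) (metis cong_trans)
      qed
      show "[A n a b0 = A' n a b0 * ppow p (Some e) * (A' n a0 b0 * y n)] (mod int p ^ n)" if "a \<in> I" for n a
      proof -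
        have "[int p ^ e * A' n a b0 * 1 = int p ^ e * A' n a b0 * (A' n a0 b0 * y n)] (mod int p ^ n)"
          by (intro cong_mult cong_refl cong_sym[OF y(2)])
        then show ?thesis using A[OF that b0, of n] unfolding ppow_def
          by (simp add: mult_ac) (metis cong_trans)
      qed
      show "has_snf p (I - {a0}) (J - {b0}) (\<lambda>n a b. A n a b - A' n a b0 * ppow p (Some e) * (A' n a0 b * y n))"
        using coh coh' a0 b0 y by (intro IH a0 b0 coh_diff coh_mult coh_const) auto
    qed (use y in \<open>auto simp: coh_const\<close>)
  qed
qed

section \<open>Singular numbers\<close>

definition zdig :: "nat \<Rightarrow> (nat \<Rightarrow> int) \<Rightarrow> nat \<Rightarrow> nat" where
  "zdig p x i = nat ((x (Suc i) mod int p ^ Suc i) div int p ^ i)"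

lemma trunc_0 [simp]: "trunc p 0 d = 0"
  and trunc_Suc: "trunc p (Suc n) d = trunc p n d + int (d n) * int p ^ n"
  by (simp_all add: trunc_def)

lemma zdig_less:
  assumes "p > 0"
  shows "zdig p x i < p"
proof -
  define z where "z = x (Suc i) mod int p ^ Suc i"
  have zl: "z < int p * int p ^ i" using assms by (simp add: z_def)
  have "z div int p ^ i < int p"
  proof (rule ccontr)
    assume "\<not> z div int p ^ i < int p"
    then have "int p * int p ^ i \<le> z div int p ^ i * int p ^ i" by (intro mult_right_mono) auto
    also have "\<dots> \<le> z" using div_mult_mod_eq[of z "int p ^ i"] assms by (simp add: minus_mod_eq_div_mult[symmetric])
    finally show False using zl by simp
  qed
  then show ?thesis unfolding zdig_def z_def[symmetric] using assms by (simp add: nat_less_iff)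
qed

lemma trunc_zdig:
  assumes "p > 0" and x: "coh p x"
  shows "trunc p n (zdig p x) = x n mod int p ^ n"
proof (induction n)
  case (Suc n)
  define z where "z = x (Suc n) mod int p ^ Suc n"
  have "int p ^ n dvd int p ^ Suc n" by simp
  then have "z mod int p ^ n = x (Suc n) mod int p ^ n" unfolding z_def by (rule mod_mod_cancel)
  also have "\<dots> = x n mod int p ^ n" using x unfolding coh_def cong_def by blast
  finally have 1: "x n mod int p ^ n = z mod int p ^ n" ..
  have "z div int p ^ n \<ge> 0" using assms(1) by (simp add: z_def pos_imp_zdiv_nonneg_iff)
  then have "int (zdig p x n) = z div int p ^ n" unfolding zdig_def z_def[symmetric] by simp
  then have "trunc p (Suc n) (zdig p x) = z mod int p ^ n + (z div int p ^ n) * int p ^ n"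
    by (simp add: trunc_Suc Suc.IH 1)
  then show ?case by (simp only: mod_div_mult_eq z_def)
qed simp

lemma coh_trunc: "coh p (\<lambda>n. trunc p n d)"
  by (simp add: coh_def trunc_Suc cong_iff_dvd_diff)

lemma inv_pair_transpose:
  assumes "inv_pair p I T B B'"
  shows "inv_pair p T I (\<lambda>n c a. B n a c) (\<lambda>n a c. B' n c a)"
  unfolding inv_pair_def
proof (intro conjI ballI allI)
  fix n
  show "[(\<Sum>c\<in>I. B n c a * B' n d c) = (if a = d then 1 else 0)] (mod int p ^ n)" if "a \<in> T" "d \<in> T" for a d
    using assms that unfolding inv_pair_def by (subst mult.commute, subst eq_commute[of a d]) blast
  show "[(\<Sum>c\<in>T. B' n c a * B n d c) = (if a = d then 1 else 0)] (mod int p ^ n)" if "a \<in> I" "d \<in> I" for a d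
    using assms that unfolding inv_pair_def by (subst mult.commute, subst eq_commute[of a d]) blast
qed (use assms in \<open>auto simp: inv_pair_def\<close>)

lemma inv_pair_reindex:
  assumes "inv_pair p I T B B'" and \<pi>: "bij_betw \<pi> T' T"
  shows "inv_pair p I T' (\<lambda>n a c. B n a (\<pi> c)) (\<lambda>n c a. B' n (\<pi> c) a)"
proof -
  have mem: "\<pi> c \<in> T" if "c \<in> T'" for c using \<pi> that by (rule bij_betw_apply)
  have inj: "\<pi> c = \<pi> d \<longleftrightarrow> c = d" if "c \<in> T'" "d \<in> T'" for c d
    using \<pi> that by (auto simp: bij_betw_def inj_on_def)
  have "(\<Sum>c\<in>T'. B n a (\<pi> c) * B' n (\<pi> c) d) = (\<Sum>c\<in>T. B n a c * B' n c d)" for n a d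
    using \<pi> by (rule sum.reindex_bij_betw)
  moreover have "[(\<Sum>a\<in>I. B' n (\<pi> c) a * B n a (\<pi> d)) = (if c = d then 1 else 0)] (mod int p ^ n)"
    if "c \<in> T'" "d \<in> T'" for n c d
    using assms(1) mem that unfolding inv_pair_def inj[OF that, symmetric] by blast
  ultimately show ?thesis using assms(1) mem unfolding inv_pair_def by auto
qed

text \<open>Replacing each coherent entry by its digit expansion keeps all residues, and the inverse
  relations in \<open>GLZp\<close> are congruences.\<close>

lemma GLZp_of_inv_pair:
  assumes "p > 0" and inv: "inv_pair p {..<N} {..<N} B B'"
  obtains B0 where "B0 \<in> GLZp p N" "\<And>n a c. a < N \<Longrightarrow> c < N \<Longrightarrow> [trunc p n (B0 a c) = B n a c] (mod int p ^ n)"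
proof -
  define dig where "dig B a c = (if a < N \<and> c < N then zdig p (\<lambda>n. B n a c) else (\<lambda>_. 0))" for B a c
  have dig: "dig B \<in> zmat_space p N" for B
    using assms(1) zdig_less by (auto simp: zmat_space_def dig_def)
  have coh: "coh p (\<lambda>n. B n a c)" "coh p (\<lambda>n. B' n a c)" if "a < N" "c < N" for a c
    using inv that unfolding inv_pair_def by auto
  have tr: "[trunc p n (dig B a c) = B n a c] (mod int p ^ n)" "[trunc p n (dig B' a c) = B' n a c] (mod int p ^ n)"
    if "a < N" "c < N" for n a c
    using trunc_zdig[OF assms(1) coh(1)] trunc_zdig[OF assms(1) coh(2)] that by (simp_all add: dig_def)
  have "[(\<Sum>c<N. trunc p n (dig B a c) * trunc p n (dig B' c b)) = (if a = b then 1 else 0)] (mod int p ^ n)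
    \<and> [(\<Sum>c<N. trunc p n (dig B' a c) * trunc p n (dig B c b)) = (if a = b then 1 else 0)] (mod int p ^ n)"
    if ab: "a < N" "b < N" for n a b
  proof
    have "[(\<Sum>c<N. trunc p n (dig B a c) * trunc p n (dig B' c b)) = (\<Sum>c<N. B n a c * B' n c b)] (mod int p ^ n)"
      by (intro cong_sum cong_mult tr) (use ab in auto)
    also have "[(\<Sum>c<N. B n a c * B' n c b) = (if a = b then 1 else 0)] (mod int p ^ n)" using inv ab unfolding inv_pair_def by blast
    finally show "[(\<Sum>c<N. trunc p n (dig B a c) * trunc p n (dig B' c b)) = (if a = b then 1 else 0)] (mod int p ^ n)" .
    have "[(\<Sum>c<N. trunc p n (dig B' a c) * trunc p n (dig B c b)) = (\<Sum>c<N. B' n a c * B n c b)] (mod int p ^ n)"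
      by (intro cong_sum cong_mult tr) (use ab in auto)
    also have "[(\<Sum>c<N. B' n a c * B n c b) = (if a = b then 1 else 0)] (mod int p ^ n)" using inv ab unfolding inv_pair_def by blast
    finally show "[(\<Sum>c<N. trunc p n (dig B' a c) * trunc p n (dig B c b)) = (if a = b then 1 else 0)] (mod int p ^ n)" .
  qed
  then have "dig B \<in> GLZp p N" unfolding GLZp_def using dig by blast
  then show ?thesis using tr(1) that by blast
qed

text \<open>An entry of \<open>p ^ m * Z\<close> modulo \<open>p ^ n\<close>, provided that
  \<open>Z\<close> has no digits below index \<open>- m\<close>.\<close>

definition qtrunc :: "nat \<Rightarrow> nat \<Rightarrow> nat \<Rightarrow> qmat \<Rightarrow> nat \<Rightarrow> nat \<Rightarrow> int" where
  "qtrunc p m n Z a b = trunc p n (\<lambda>i. Z a b (int i - int m))"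

definition ediv :: "nat \<Rightarrow> nat \<Rightarrow> ereal \<Rightarrow> int" where
  "ediv p m v = (if v = -\<infinity> then 0 else int p ^ nat (int m - \<lfloor>real_of_ereal v\<rfloor>))"

text \<open>\<open>sing_rel\<close> with the scale \<open>m\<close> exposed, so that two
  decompositions of one matrix can be compared at a common scale.\<close>

definition sing_at :: "nat \<Rightarrow> nat \<Rightarrow> nat \<Rightarrow> qmat \<Rightarrow> ereal list \<Rightarrow> bool" where
  "sing_at p N m Z k \<longleftrightarrow> k \<in> Delta N \<and> (\<forall>a b j. j < - int m \<longrightarrow> Z a b j = 0) \<and> (\<forall>v\<in>set k. v \<le> ereal (real m)) \<and>
     (\<exists>B\<in>GLZp p N. \<exists>C\<in>GLZp p N. \<forall>n a b. a < N \<longrightarrow> b < N \<longrightarrow>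
        [qtrunc p m n Z a b = (\<Sum>c<N. trunc p n (B a c) * ediv p m (k ! c) * trunc p n (C c b))] (mod int p ^ n))"

lemma sing_rel_iff: "sing_rel p N Z k \<longleftrightarrow> (\<exists>m. sing_at p N m Z k)"
  unfolding sing_rel_def sing_at_def qtrunc_def ediv_def by blast

text \<open>The normal form is sorted afterwards: one permutation acts on the diagonal, on the
  columns of the left factor and on the rows of the right one.\<close>

lemma sing_at_exists:
  assumes p: "prime p" and Z: "\<And>a b j. j < - int m \<Longrightarrow> Z a b j = 0"
  obtains k where "sing_at p N m Z k"
proof -
  have p0: "p > 0" using p by (rule prime_gt_0_nat)
  have "has_snf p {..<N} {..<N} (\<lambda>n. qtrunc p m n Z)"
    by (rule has_snf) (use p coh_trunc in \<open>auto simp: qtrunc_def\<close>)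
  then obtain B B' W W' \<delta> where B: "inv_pair p {..<N} {..<N} B B'" and W: "inv_pair p {..<N} {..<N} W W'"
    and A: "\<forall>n. \<forall>a\<in>{..<N}. \<forall>b\<in>{..<N}.
      [qtrunc p m n Z a b = (\<Sum>c<N. B n a c * ppow p (\<delta> c) * W n b c)] (mod int p ^ n)"
    unfolding has_snf_def by blast
  \<comment> \<open>An elementary divisor \<open>p ^ e\<close> of \<open>p ^ m * Z\<close>
    corresponds to the singular number \<open>m - e\<close>, and the divisor zero to
    \<open>-\<infinity>\<close>.\<close>
  define val where "val d = (case d of None \<Rightarrow> -\<infinity> | Some e \<Rightarrow> ereal (of_int (int m - int e)))" for d
  have ediv_val: "ediv p m (val d) = ppow p d" for d
    proof (cases d)
    case (Some e)
    have "\<lfloor>real_of_ereal (val d)\<rfloor> = int m - int e"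
      unfolding Some val_def option.case real_of_ereal.simps by (rule floor_of_int)
    then show ?thesis using Some by (simp add: ediv_def val_def ppow_def)
  qed (simp add: ediv_def val_def ppow_def)
  have val_le: "val d \<le> ereal (real m)" for d by (auto simp: val_def split: option.splits)
  have val_Z: "val d = -\<infinity> \<or> (\<exists>i::int. val d = ereal (of_int i))" for d
  proof (cases d)
    case (Some e)
    then have "val d = ereal (of_int (int m - int e))" unfolding val_def by (simp only: option.case)
    then show ?thesis by blast
  qed (simp add: val_def)
  define xs where "xs = map (\<lambda>c. val (\<delta> c)) [0..<N]"
  define k where "k = rev (sort xs)"
  have "mset k = mset xs" by (simp add: k_def)
  then obtain \<pi> where \<pi>: "\<pi> permutes {..<length xs}" "permute_list \<pi> xs = k" by (rule mset_eq_permutation)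
  have \<pi>N: "\<pi> permutes {..<N}" using \<pi>(1) by (simp add: xs_def)
  then have bij: "bij_betw \<pi> {..<N} {..<N}" by (rule permutes_imp_bij)
  have k_nth: "k ! c = val (\<delta> (\<pi> c))" if "c < N" for c
  proof -
    have "\<pi> c < N" using permutes_in_image[OF \<pi>N, of c] that by simp
    then show ?thesis unfolding \<pi>(2)[symmetric] using that \<pi>(1) by (subst permute_list_nth) (auto simp: xs_def)
  qed
  have setk: "set k \<subseteq> range val" by (auto simp: k_def xs_def)
  have "sorted_wrt (\<ge>) k" by (simp add: k_def sorted_wrt_rev)
  then have D: "k \<in> Delta N" using setk val_Z by (auto simp: Delta_def k_def xs_def)
  obtain B0 where B0: "B0 \<in> GLZp p N" "\<And>n a c. a < N \<Longrightarrow> c < N \<Longrightarrow> [trunc p n (B0 a c) = B n a (\<pi> c)] (mod int p ^ n)"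
    using GLZp_of_inv_pair[OF p0 inv_pair_reindex[OF B bij]] by blast
  obtain C0 where C0: "C0 \<in> GLZp p N" "\<And>n c b. c < N \<Longrightarrow> b < N \<Longrightarrow> [trunc p n (C0 c b) = W n b (\<pi> c)] (mod int p ^ n)"
    using GLZp_of_inv_pair[OF p0 inv_pair_transpose[OF inv_pair_reindex[OF W bij]]] by blast
  have "[qtrunc p m n Z a b = (\<Sum>c<N. trunc p n (B0 a c) * ediv p m (k ! c) * trunc p n (C0 c b))] (mod int p ^ n)"
    if ab: "a < N" "b < N" for n a b
  proof -
    have 1: "(\<Sum>c<N. B n a c * ppow p (\<delta> c) * W n b c) = (\<Sum>c<N. B n a (\<pi> c) * ppow p (\<delta> (\<pi> c)) * W n b (\<pi> c))"
      by (rule sum.reindex_bij_betw[OF bij, where g = "\<lambda>c. B n a c * ppow p (\<delta> c) * W n b c", symmetric])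
    have 2: "[(\<Sum>c<N. B n a (\<pi> c) * ppow p (\<delta> (\<pi> c)) * W n b (\<pi> c))
        = (\<Sum>c<N. trunc p n (B0 a c) * ediv p m (k ! c) * trunc p n (C0 c b))] (mod int p ^ n)"
      by (intro cong_sum cong_mult cong_sym[OF B0(2)] cong_sym[OF C0(2)]) (use ab in \<open>auto simp: k_nth ediv_val\<close>)
    have "[qtrunc p m n Z a b = (\<Sum>c<N. B n a c * ppow p (\<delta> c) * W n b c)] (mod int p ^ n)" using A ab by simp
    then show ?thesis unfolding 1 using 2 by (rule cong_trans)
  qed
  moreover have "\<forall>v\<in>set k. v \<le> ereal (real m)" using setk val_le by auto
  ultimately have "sing_at p N m Z k" unfolding sing_at_def using D Z B0(1) C0(1) by blast
  then show ?thesis by (rule that)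
qed

lemma DeltaE:
  assumes "k \<in> Delta N" "v \<in> set k"
  obtains "v = -\<infinity>" | i :: int where "v = ereal (of_int i)"
  using assms unfolding Delta_def by blast

text \<open>Multiplication by \<open>p ^ d\<close> keeps \<open>B\<close> and \<open>C\<close> and
  multiplies the diagonal; on the left side it moves the digit string up by \<open>d\<close>
  places.\<close>

lemma sing_at_add:
  assumes "sing_at p N m Z k"
  shows "sing_at p N (m + d) Z k"
proof -
  obtain B C where k: "k \<in> Delta N" and Z: "\<And>a b j. j < - int m \<Longrightarrow> Z a b j = 0"
    and le: "\<And>v. v \<in> set k \<Longrightarrow> v \<le> ereal (real m)" and BC: "B \<in> GLZp p N" "C \<in> GLZp p N"
    and A: "\<And>n a b. a < N \<Longrightarrow> b < N \<Longrightarrow>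
      [qtrunc p m n Z a b = (\<Sum>c<N. trunc p n (B a c) * ediv p m (k ! c) * trunc p n (C c b))] (mod int p ^ n)"
    using assms unfolding sing_at_def by blast
  have e: "ediv p (m + d) (k ! c) = int p ^ d * ediv p m (k ! c)" if "c < N" for c
  proof -
    have mem: "k ! c \<in> set k" using that k by (auto simp: Delta_def)
    show ?thesis
    proof (cases rule: DeltaE[OF k mem])
      case (2 i)
      then have "i \<le> int m" using le[OF mem] by simp
      then have "nat (int (m + d) - i) = d + nat (int m - i)" by simp
      then show ?thesis using 2 by (simp add: ediv_def power_add)
    qed (simp add: ediv_def)
  qed
  have q: "[qtrunc p (m + d) n Z a b = int p ^ d * qtrunc p m n Z a b] (mod int p ^ n)" for n a b
  proof -
    have split: "(\<Sum>i<d + n. f i) = (\<Sum>i<d. f i) + (\<Sum>i<n. f (d + i))" for f :: "nat \<Rightarrow> int"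
      by (induction n) (auto simp: add.assoc)
    have "qtrunc p (m + d) (d + n) Z a b = (\<Sum>i<d. int (Z a b (int i - int (m + d))) * int p ^ i)
       + (\<Sum>i<n. int (Z a b (int (d + i) - int (m + d))) * int p ^ (d + i))"
      unfolding qtrunc_def trunc_def by (rule split)
    also have "(\<Sum>i<d. int (Z a b (int i - int (m + d))) * int p ^ i) = 0"
      by (intro sum.neutral) (auto simp: Z)
    also have "0 + (\<Sum>i<n. int (Z a b (int (d + i) - int (m + d))) * int p ^ (d + i)) = int p ^ d * qtrunc p m n Z a b"
      unfolding qtrunc_def trunc_def sum_distrib_left add_0 by (intro sum.cong) (auto simp: power_add)
    finally have "qtrunc p (m + d) (d + n) Z a b = int p ^ d * qtrunc p m n Z a b" .
    moreover have "[qtrunc p (m + d) (d + n) Z a b = qtrunc p (m + d) n Z a b] (mod int p ^ n)"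
      unfolding qtrunc_def by (rule coh_mono[OF coh_trunc]) simp
    ultimately show ?thesis by (simp add: cong_sym)
  qed
  have "[qtrunc p (m + d) n Z a b = (\<Sum>c<N. trunc p n (B a c) * ediv p (m + d) (k ! c) * trunc p n (C c b))] (mod int p ^ n)"
    if ab: "a < N" "b < N" for n a b
  proof -
    have "[int p ^ d * qtrunc p m n Z a b = int p ^ d * (\<Sum>c<N. trunc p n (B a c) * ediv p m (k ! c) * trunc p n (C c b))] (mod int p ^ n)"
      by (intro cong_mult cong_refl A ab)
    also have "int p ^ d * (\<Sum>c<N. trunc p n (B a c) * ediv p m (k ! c) * trunc p n (C c b))
       = (\<Sum>c<N. trunc p n (B a c) * ediv p (m + d) (k ! c) * trunc p n (C c b))"
      unfolding sum_distrib_left by (intro sum.cong) (auto simp: e)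
    finally show ?thesis using q cong_trans by blast
  qed
  moreover have "v \<le> ereal (real (m + d))" if "v \<in> set k" for v
    using le[OF that] by (rule order_trans) simp
  moreover have "Z a b j = 0" if "j < - int (m + d)" for a b j using Z that by simp
  ultimately show ?thesis unfolding sing_at_def using k BC by blast
qed

text \<open>At \<open>z = m - l\<close> this counts the elementary divisors of
  \<open>p ^ m * Z\<close> divisible by \<open>p ^ l\<close>, because \<open>p ^ (m - v)\<close> is
  among them exactly for \<open>v \<le> m - l\<close>. Entries \<open>-\<infinity>\<close>, which
  give the divisor zero, are always included.\<close>

definition kcount :: "ereal list \<Rightarrow> int \<Rightarrow> nat" where
  "kcount k z = length (filter (\<lambda>v. v \<le> ereal (of_int z)) k)"

lemma kcount_eq_card: "kcount k z = card {c. c < length k \<and> k ! c \<le> ereal (of_int z)}"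
  by (simp add: kcount_def length_filter_conv_card)

lemma card_dvd_mult:
  fixes P Q :: int
  assumes "Q > 0" "P > 0"
  shows "card {x \<in> {0..<Q * P}. Q * P dvd Q * x} = nat Q"
proof -
  have "bij_betw (\<lambda>x. P * x) {0..<Q} {x \<in> {0..<Q * P}. Q * P dvd Q * x}"
    by (rule bij_betw_byWitness[where f' = "\<lambda>x. x div P"])
       (use assms in \<open>auto simp: zero_le_mult_iff pos_imp_zdiv_nonneg_iff mult.commute[of _ P] elim!: dvdE\<close>)
  from bij_betw_same_card[OF this] show ?thesis by simp
qed

text \<open>Multiplication by \<open>p ^ e\<close> has a kernel of size \<open>p ^ min e n\<close>
  modulo \<open>p ^ n\<close>. The exponent is written as a number of thresholds \<open>l\<close>,
  ready for exchanging the sums over entries and thresholds.\<close>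

lemma card_ediv:
  assumes "p > 0" "v = -\<infinity> \<or> (\<exists>i::int. v = ereal (of_int i))" "v \<le> ereal (real m)"
  shows "card {x \<in> {0..<int p ^ n}. int p ^ n dvd ediv p m v * x}
    = p ^ card {l \<in> {1..n}. v \<le> ereal (of_int (int m - int l))}"
  using assms(2)
proof
  assume v: "v = -\<infinity>"
  have "{x \<in> {0..<int p ^ n}. int p ^ n dvd ediv p m v * x} = {0..<int p ^ n}" by (auto simp: v ediv_def)
  moreover have "{l \<in> {1..n}. v \<le> ereal (of_int (int m - int l))} = {1..n}" by (auto simp: v)
  ultimately show ?thesis by (simp add: nat_power_eq)
next
  assume "\<exists>i::int. v = ereal (of_int i)"
  then obtain i :: int where v: "v = ereal (of_int i)" by blast
  define e where "e = nat (int m - i)"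
  have i: "i = int m - int e" using assms(3) v by (simp add: e_def)
  have "\<lfloor>real_of_ereal v\<rfloor> = i" unfolding v by simp
  then have E: "ediv p m v = int p ^ e" by (simp add: ediv_def v e_def)
  have "{l \<in> {1..n}. v \<le> ereal (of_int (int m - int l))} = {1..min e n}" by (auto simp: v i)
  then have R: "card {l \<in> {1..n}. v \<le> ereal (of_int (int m - int l))} = min e n" by simp
  show ?thesis
  proof (cases "n \<le> e")
    case True
    then have "{x \<in> {0..<int p ^ n}. int p ^ n dvd ediv p m v * x} = {0..<int p ^ n}"
      unfolding E by (auto intro!: dvd_mult2 le_imp_power_dvd)
    then show ?thesis unfolding R using True by (simp add: nat_power_eq min_def)
  next
    case False
    define f where "f = n - e"
    have n: "n = e + f" using False by (simp add: f_def)
    show ?thesis unfolding R E using card_dvd_mult[of "int p ^ e" "int p ^ f"] False assms(1)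
      by (simp add: n power_add min_def nat_power_eq)
  qed
qed

text \<open>Diagonalising turns the kernel size into a product over the entries of \<open>k\<close>;
  exchanging the two sums in the exponent, as for conjugate partitions, groups it by
  thresholds.\<close>

lemma profile_sing_at:
  assumes p: "p > 0" and "sing_at p N m Z k"
  shows "profile p n {..<N} {..<N} (qtrunc p m n Z) (\<lambda>l. kcount k (int m - int l))"
  unfolding profile_def
proof (intro allI impI)
  fix i assume "i \<le> n"
  obtain B C where k: "k \<in> Delta N"
    and le: "\<And>v. v \<in> set k \<Longrightarrow> v \<le> ereal (real m)" and BC: "B \<in> GLZp p N" "C \<in> GLZp p N"
    and A: "\<And>n a b. a < N \<Longrightarrow> b < N \<Longrightarrow>
      [qtrunc p m n Z a b = (\<Sum>c<N. trunc p n (B a c) * ediv p m (k ! c) * trunc p n (C c b))] (mod int p ^ n)"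
    using assms(2) unfolding sing_at_def by blast
  have len: "length k = N" using k by (simp add: Delta_def)
  obtain B' where B': "\<And>n a b. a < N \<Longrightarrow> b < N \<Longrightarrow>
     [(\<Sum>c<N. trunc p n (B' a c) * trunc p n (B c b)) = (if a = b then 1 else 0)] (mod int p ^ n)"
    using BC(1) unfolding GLZp_def by blast
  obtain C' where C': "\<And>n a b. a < N \<Longrightarrow> b < N \<Longrightarrow>
     [(\<Sum>c<N. trunc p n (C a c) * trunc p n (C' c b)) = (if a = b then 1 else 0)] (mod int p ^ n)"
     "\<And>n a b. a < N \<Longrightarrow> b < N \<Longrightarrow>
     [(\<Sum>c<N. trunc p n (C' a c) * trunc p n (C c b)) = (if a = b then 1 else 0)] (mod int p ^ n)"
    using BC(2) unfolding GLZp_def by blast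
  have "ker_card (int p ^ i) {..<N} {..<N} (qtrunc p m n Z) = ker_card (int p ^ i) {..<N} {..<N} (qtrunc p m i Z)"
    by (rule ker_card_cong) (unfold qtrunc_def, rule coh_mono[OF coh_trunc \<open>i \<le> n\<close>])
  also have "\<dots> = (\<Prod>c<N. card {x \<in> {0..<int p ^ i}. int p ^ i dvd ediv p m (k ! c) * x})"
    by (rule ker_card_BDC[where B = "\<lambda>a c. trunc p i (B a c)" and C = "\<lambda>a c. trunc p i (C a c)"
          and B' = "\<lambda>a c. trunc p i (B' a c)" and C' = "\<lambda>a c. trunc p i (C' a c)"])
       (use A B' C' p in auto)
  also have "\<dots> = (\<Prod>c<N. p ^ card {l \<in> {1..i}. k ! c \<le> ereal (of_int (int m - int l))})"
  proof (intro prod.cong refl card_ediv p)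
    fix c assume "c \<in> {..<N}"
    then have "k ! c \<in> set k" using len by simp
    then show "k ! c \<le> ereal (real m)" "k ! c = -\<infinity> \<or> (\<exists>i::int. k ! c = ereal (of_int i))"
      using le k unfolding Delta_def by auto
  qed
  also have "\<dots> = p ^ (\<Sum>c<N. card {l \<in> {1..i}. k ! c \<le> ereal (of_int (int m - int l))})"
    by (rule power_sum[symmetric])
  also have "(\<Sum>c<N. card {l \<in> {1..i}. k ! c \<le> ereal (of_int (int m - int l))})
     = (\<Sum>c<N. \<Sum>l\<in>{1..i}. if k ! c \<le> ereal (of_int (int m - int l)) then 1 else 0)"
    by (intro sum.cong refl) (simp add: sum.If_cases Int_def)
  also have "\<dots> = (\<Sum>l\<in>{1..i}. \<Sum>c<N. if k ! c \<le> ereal (of_int (int m - int l)) then 1 else 0)" by (rule sum.swap)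
  also have "\<dots> = (\<Sum>l\<in>{1..i}. kcount k (int m - int l))"
    by (intro sum.cong refl) (simp add: sum.If_cases kcount_eq_card len Int_def)
  finally show "ker_card (int p ^ i) {..<N} {..<N} (qtrunc p m n Z) = p ^ (\<Sum>l\<in>{1..i}. kcount k (int m - int l))" .
qed

section \<open>Recovering \<open>k\<close> from its threshold counts\<close>

lemma nth_le_iff_kcount:
  assumes k: "k \<in> Delta N" and c: "c < N"
  shows "k ! c \<le> ereal (of_int z) \<longleftrightarrow> N - c \<le> kcount k z"
proof -
  have len: "length k = N" and srt: "\<And>i j. i < j \<Longrightarrow> j < N \<Longrightarrow> k ! j \<le> k ! i"
    using k by (auto simp: Delta_def sorted_wrt_iff_nth_less)
  have srt': "k ! j \<le> k ! i" if "i \<le> j" "j < N" for i j using srt[of i j] that by (cases "i = j") auto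
  let ?S = "{j. j < N \<and> k ! j \<le> ereal (of_int z)}"
  show ?thesis
  proof
    assume "k ! c \<le> ereal (of_int z)"
    then have "k ! j \<le> ereal (of_int z)" if "c \<le> j" "j < N" for j
      by (rule order_trans[OF srt'[OF that]])
    then have "{c..<N} \<subseteq> ?S" by auto
    moreover have "finite ?S" by simp
    ultimately have "card {c..<N} \<le> card ?S" by (intro card_mono)
    then show "N - c \<le> kcount k z" unfolding kcount_eq_card len card_atLeastLessThan .
  next
    assume h: "N - c \<le> kcount k z"
    show "k ! c \<le> ereal (of_int z)"
    proof (rule ccontr)
      assume "\<not> k ! c \<le> ereal (of_int z)"
      then have "\<not> j \<le> c" if "j \<in> ?S" for j
        using that srt'[of j c] c order_trans[of "k ! c" "k ! j" "ereal (of_int z)"] by blast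
      then have "?S \<subseteq> {Suc c..<N}" by (auto simp: Suc_le_eq not_le)
      then have "card ?S \<le> card {Suc c..<N}" by (intro card_mono) simp_all
      then have "kcount k z \<le> N - Suc c" unfolding kcount_eq_card len card_atLeastLessThan .
      then show False using h c by linarith
    qed
  qed
qed

text \<open>In a decreasing list the counts decide every comparison of an entry with an integer
  \<open>z\<close>. An integer entry is the least such upper bound, and \<open>-\<infinity>\<close>
  is the only value below all integers.\<close>

lemma Delta_eqI:
  assumes k: "k \<in> Delta N" "k' \<in> Delta N" and eq: "\<And>z. kcount k z = kcount k' z"
  shows "k = k'"
proof (rule nth_equalityI)
  show "length k = length k'" using k by (simp add: Delta_def)
  fix c assume "c < length k"
  then have c: "c < N" using k by (simp add: Delta_def)
  have le: "k ! c \<le> ereal (of_int z) \<longleftrightarrow> k' ! c \<le> ereal (of_int z)" for z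
    using nth_le_iff_kcount[OF k(1) c] nth_le_iff_kcount[OF k(2) c] eq by simp
  have mem: "k ! c \<in> set k" "k' ! c \<in> set k'" using c k by (auto simp: Delta_def)
  show "k ! c = k' ! c"
  proof (cases rule: DeltaE[OF k(1) mem(1)])
    case 1
    then have all: "k' ! c \<le> ereal (of_int z)" for z using le by simp
    show ?thesis
    proof (cases rule: DeltaE[OF k(2) mem(2)])
      case (2 i)
      then show ?thesis using all[of "i - 1"] by simp
    qed (use 1 in simp)
  next
    case (2 i)
    show ?thesis
    proof (cases rule: DeltaE[OF k(2) mem(2)])
      case 1
      then show ?thesis using le[of "i - 1"] 2 by simp
    next
      case (2 j)
      then show ?thesis using le[of i] le[of j] \<open>k ! c = ereal (of_int i)\<close> by simp
    qed
  qed
qed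

text \<open>Consecutive partial sums in the exponents differ by a single count, which gives
  \<open>kcount\<close> below \<open>m\<close>; from \<open>m\<close> on both counts equal
  \<open>N\<close>.\<close>

lemma Delta_eq_of_profile:
  assumes p: "prime p" and k: "k \<in> Delta N" "k' \<in> Delta N"
    and le: "\<And>v. v \<in> set k \<Longrightarrow> v \<le> ereal (real m)" "\<And>v. v \<in> set k' \<Longrightarrow> v \<le> ereal (real m)"
    and pr: "\<And>n. profile p n I J (A n) (\<lambda>l. kcount k (int m - int l))"
            "\<And>n. profile p n I J (A n) (\<lambda>l. kcount k' (int m - int l))"
  shows "k = k'"
proof (rule Delta_eqI[OF k])
  have p1: "p > 1" using p by (rule prime_gt_1_nat)
  have S: "(\<Sum>l\<in>{1..n}. kcount k (int m - int l)) = (\<Sum>l\<in>{1..n}. kcount k' (int m - int l))" for n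
  proof -
    have "p ^ (\<Sum>l\<in>{1..n}. kcount k (int m - int l)) = p ^ (\<Sum>l\<in>{1..n}. kcount k' (int m - int l))"
      using pr(1)[of n, unfolded profile_def, rule_format, OF order_refl]
        pr(2)[of n, unfolded profile_def, rule_format, OF order_refl] by simp
    then show ?thesis using p1 by (simp only: power_inject_exp)
  qed
  fix z
  show "kcount k z = kcount k' z"
  proof (cases "z < int m")
    case True
    define l where "l = nat (int m - z - 1)"
    have l: "z = int m - int (Suc l)" using True by (simp add: l_def)
    show ?thesis using S[of "Suc l"] S[of l] unfolding l by simp
  next
    case False
    have "v \<le> ereal (of_int z)" if "v \<in> set k \<union> set k'" for v
    proof -
      have "v \<le> ereal (real m)" using le that by blast
      also have "\<dots> \<le> ereal (of_int z)" using False by simp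
      finally show ?thesis .
    qed
    then have "filter (\<lambda>v. v \<le> ereal (of_int z)) k = k" "filter (\<lambda>v. v \<le> ereal (of_int z)) k' = k'"
      by (auto simp: filter_id_conv)
    then show ?thesis using k by (simp add: kcount_def Delta_def)
  qed
qed

lemma sing_rel_unique:
  assumes p: "prime p" and "sing_rel p N Z k" "sing_rel p N Z k'"
  shows "k = k'"
proof -
  obtain m m' where "sing_at p N m Z k" "sing_at p N m' Z k'" using assms by (auto simp: sing_rel_iff)
  then have s: "sing_at p N (m + m') Z k" "sing_at p N (m + m') Z k'"
    using sing_at_add[of p N m Z k m'] sing_at_add[of p N m' Z k' m] by (simp_all add: add.commute)
  note pr = profile_sing_at[OF prime_gt_0_nat[OF p] s(1)] profile_sing_at[OF prime_gt_0_nat[OF p] s(2)]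
  show ?thesis
    by (rule Delta_eq_of_profile[OF p _ _ _ _ pr]) (use s in \<open>auto simp: sing_at_def\<close>)
qed

section \<open>\<open>Sing\<close> as a function on matrices\<close>

lemma Sing_eqI: "prime p \<Longrightarrow> sing_rel p N Z k \<Longrightarrow> Sing p N Z = k"
  unfolding Sing_def using sing_rel_unique by blast

lemma Sing_in_Delta:
  assumes "prime p" "Z \<in> qmat_space p N"
  shows "Sing p N Z \<in> Delta N"
proof -
  obtain m where "\<And>a b j. j < - int m \<Longrightarrow> Z a b j = 0" using assms(2) by (auto simp: qmat_space_def)
  then obtain k where "sing_at p N m Z k" using sing_at_exists[OF assms(1), of m Z N] by blast
  moreover from this have "Sing p N Z = k" by (intro Sing_eqI assms) (auto simp: sing_rel_iff)
  ultimately show ?thesis by (simp add: sing_at_def)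
qed

text \<open>A normal form exists at scale \<open>m\<close>, and its profile determines
  \<open>k\<close>. This trades the description operator for countably many conditions on finitely
  many digits each, the starting point for measurability and for the limit in
  \<open>n\<close>.\<close>

lemma Sing_eq_iff:
  assumes p: "prime p" and Z: "\<And>a b j. j < - int m \<Longrightarrow> Z a b j = 0"
    and k: "k \<in> Delta N" "\<And>v. v \<in> set k \<Longrightarrow> v \<le> ereal (real m)"
  shows "Sing p N Z = k \<longleftrightarrow>
    (\<forall>n. profile p n {..<N} {..<N} (qtrunc p m n Z) (\<lambda>l. kcount k (int m - int l)))"
proof -
  obtain k0 where k0: "sing_at p N m Z k0" using sing_at_exists[OF p, of m Z N] Z by blast
  then have S: "Sing p N Z = k0" by (intro Sing_eqI p) (auto simp: sing_rel_iff)
  note pr = profile_sing_at[OF prime_gt_0_nat[OF p] k0]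
  show ?thesis
  proof
    assume "\<forall>n. profile p n {..<N} {..<N} (qtrunc p m n Z) (\<lambda>l. kcount k (int m - int l))"
    then have "k0 = k"
      by (intro Delta_eq_of_profile[OF p _ k(1) _ k(2) pr]) (use k0 in \<open>auto simp: sing_at_def\<close>)
    then show "Sing p N Z = k" using S by simp
  qed (use S pr in auto)
qed

section \<open>The Haar measure\<close>

abbreviation digit_meas :: "nat \<Rightarrow> nat \<Rightarrow> nat \<Rightarrow> (nat \<times> nat \<times> int \<Rightarrow> nat) measure" where
  "digit_meas p N m \<equiv> PiM (digit_idx N m) (\<lambda>_. measure_pmf (pmf_of_set {0..<p}))"

abbreviation qmat_sets :: "nat \<Rightarrow> nat \<Rightarrow> qmat set set" where
  "qmat_sets p N \<equiv> sigma_sets (qmat_space p N) (qmat_gen p N)"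

lemma qmat_gen_subset: "qmat_gen p N \<subseteq> Pow (qmat_space p N)"
  by (auto simp: qmat_gen_def)

interpretation digit_prod: product_prob_space "\<lambda>_. measure_pmf (pmf_of_set {0..<p})" "digit_idx N m" for p N m
  by unfold_locales

lemma measurable_digit_Collect:
  assumes "i \<in> digit_idx N m"
  shows "{f \<in> space (digit_meas p N m). P (f i)} \<in> sets (digit_meas p N m)"
  using assms by (intro sets_Collect_single') auto

lemma digit_emb_in_qmat_space_iff:
  assumes "p > 0"
  shows "digit_emb N m f \<in> qmat_space p N \<longleftrightarrow> (\<forall>i\<in>digit_idx N m. f i < p)"
proof
  assume "digit_emb N m f \<in> qmat_space p N"
  then have "digit_emb N m f a b j < p" for a b j by (auto simp: qmat_space_def)
  moreover have "digit_emb N m f a b j = f (a, b, j)" if "(a, b, j) \<in> digit_idx N m" for a b j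
    using that by (simp add: digit_emb_def)
  ultimately show "\<forall>i\<in>digit_idx N m. f i < p" by (metis prod_cases3)
next
  assume "\<forall>i\<in>digit_idx N m. f i < p"
  then show "digit_emb N m f \<in> qmat_space p N"
    using assms by (auto simp: qmat_space_def digit_emb_def digit_idx_def intro!: exI[of _ m])
qed

lemma sets_digit_emb_vimage:
  assumes "p > 0" "A \<in> qmat_sets p N"
  shows "digit_emb N m -` A \<inter> space (digit_meas p N m) \<in> sets (digit_meas p N m)"
  using assms(2)
proof induction
  let ?P = "digit_meas p N m"
  \<comment> \<open>The coordinates of the product space range over all natural numbers, so the
    preimage of \<open>qmat_space\<close> is itself an event, namely that all digits are below
    \<open>p\<close>. Complements are formed inside it.\<close>
  have top: "{f \<in> space ?P. \<forall>i\<in>digit_idx N m. f i < p} \<in> sets ?P"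
    by (intro sets.sets_Collect_countable_All' measurable_digit_Collect) auto
  then have M: "digit_emb N m -` qmat_space p N \<inter> space ?P \<in> sets ?P"
    by (rule back_subst[of "\<lambda>X. X \<in> sets ?P"]) (auto simp: digit_emb_in_qmat_space_iff[OF assms(1)])
  {
    case (Basic A)
    then obtain a b j d where A: "A = {Z \<in> qmat_space p N. Z a b j = d}" by (auto simp: qmat_gen_def)
    have "{f \<in> space ?P. digit_emb N m f a b j = d} \<in> sets ?P"
      by (cases "(a, b, j) \<in> digit_idx N m") (auto simp: digit_emb_def intro: measurable_digit_Collect)
    with M have "(digit_emb N m -` qmat_space p N \<inter> space ?P) \<inter> {f \<in> space ?P. digit_emb N m f a b j = d} \<in> sets ?P"
      by (rule sets.Int)
    also have "(digit_emb N m -` qmat_space p N \<inter> space ?P) \<inter> {f \<in> space ?P. digit_emb N m f a b j = d}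
       = digit_emb N m -` A \<inter> space ?P" by (auto simp: A)
    finally show ?case .
  next
    case Empty
    show ?case by simp
  next
    case (Compl A)
    have "digit_emb N m -` (qmat_space p N - A) \<inter> space ?P
      = (digit_emb N m -` qmat_space p N \<inter> space ?P) - (digit_emb N m -` A \<inter> space ?P)" by auto
    then show ?case using M Compl.IH by auto
  next
    case (Union A)
    have e: "digit_emb N m -` (\<Union>i. A i) \<inter> space ?P = (\<Union>i. digit_emb N m -` A i \<inter> space ?P)" by auto
    show ?case unfolding e using Union.IH by (intro sets.countable_nat_UN) auto
  }
qed

definition level_vol :: "nat \<Rightarrow> nat \<Rightarrow> nat \<Rightarrow> qmat set \<Rightarrow> ennreal" where
  "level_vol p N m A = emeasure (digit_meas p N m) (digit_emb N m -` A \<inter> space (digit_meas p N m))"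

lemma level_vol_countably_additive:
  assumes "p > 0"
  shows "countably_additive (qmat_sets p N) (level_vol p N m)"
proof (rule countably_additiveI)
  fix A :: "nat \<Rightarrow> qmat set"
  assume A: "range A \<subseteq> qmat_sets p N" "disjoint_family A"
  let ?P = "digit_meas p N m"
  have "(\<Sum>i. emeasure ?P (digit_emb N m -` A i \<inter> space ?P)) = emeasure ?P (\<Union>i. digit_emb N m -` A i \<inter> space ?P)"
  proof (rule suminf_emeasure)
    show "range (\<lambda>i. digit_emb N m -` A i \<inter> space ?P) \<subseteq> sets ?P"
      using A sets_digit_emb_vimage[OF assms] by auto
    show "disjoint_family (\<lambda>i. digit_emb N m -` A i \<inter> space ?P)"
      using A(2) unfolding disjoint_family_on_def by blast
  qed
  also have "(\<Union>i. digit_emb N m -` A i \<inter> space ?P) = digit_emb N m -` (\<Union>i. A i) \<inter> space ?P" by auto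
  finally show "(\<Sum>i. level_vol p N m (A i)) = level_vol p N m (\<Union>i. A i)" by (simp add: level_vol_def)
qed

text \<open>\<open>digit_emb\<close> does not map the whole product space into \<open>qmat_space\<close>, so it is not measurable
  in the sense of the library and \<open>emeasure_distr\<close> does not apply.\<close>
lemma emeasure_vol_m:
  assumes "p > 0" "A \<in> qmat_sets p N"
  shows "emeasure (vol_m p N m) A = level_vol p N m A"
proof -
  have v: "vol_m p N m = measure_of (qmat_space p N) (qmat_sets p N) (level_vol p N m)"
    unfolding vol_m_def distr_def level_vol_def
    using qmat_gen_subset by (simp add: space_measure_of_conv sets_measure_of)
  show ?thesis
  proof (rule emeasure_measure_of[OF v])
    show "qmat_sets p N \<subseteq> Pow (qmat_space p N)" using sigma_sets_into_sp[OF qmat_gen_subset] by blast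
    have sets: "sets (vol_m p N m) = qmat_sets p N"
      unfolding vol_m_def using qmat_gen_subset by (simp add: sets_measure_of)
    then show "A \<in> sets (vol_m p N m)" using assms(2) by simp
    show "positive (sets (vol_m p N m)) (level_vol p N m)" by (simp add: positive_def level_vol_def)
    show "countably_additive (sets (vol_m p N m)) (level_vol p N m)"
      unfolding sets by (rule level_vol_countably_additive[OF assms(1)])
  qed
qed

section \<open>Comparison of consecutive levels\<close>

lemma digit_idx_Suc: "digit_idx N (Suc m) = digit_idx N m \<union> {..<N} \<times> {..<N} \<times> {- int (Suc m)}"
  by (auto simp: digit_idx_def)

lemma emeasure_digit:
  assumes "d < p"
  shows "emeasure (measure_pmf (pmf_of_set {0..<p})) {d} = ennreal (1 / real p)"
  using assms by (simp add: emeasure_pmf_single pmf_of_set)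

text \<open>Given that the \<open>N * N\<close> digits of index \<open>- Suc m\<close> vanish, which
  has probability \<open>1 / p ^ (N * N)\<close>, the other digits follow the law of level
  \<open>m\<close>. The factor undoes the conditioning.\<close>

lemma digit_meas_Suc:
  assumes p: "p > 0" and X: "X \<in> sets (digit_meas p N m)"
  defines "F \<equiv> {..<N} \<times> {..<N} \<times> {- int (Suc m)}"
  shows "emeasure (digit_meas p N m) X = ennreal (real p ^ (N * N)) *
    emeasure (digit_meas p N (Suc m))
      {f \<in> space (digit_meas p N (Suc m)). (\<forall>i\<in>F. f i = 0) \<and> restrict f (digit_idx N m) \<in> X}"
proof -
  let ?P = "digit_meas p N m" and ?Q = "digit_meas p N (Suc m)"
  let ?M = "\<lambda>_ :: nat \<times> nat \<times> int. measure_pmf (pmf_of_set {0..<p})"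
  have F: "finite F" "F \<subseteq> digit_idx N (Suc m)" "F \<inter> digit_idx N m = {}" "card F = N * N"
    by (auto simp: F_def digit_idx_Suc card_cartesian_product) (auto simp: digit_idx_def)
  have sub: "digit_idx N m \<subseteq> digit_idx N (Suc m)" by (auto simp: digit_idx_Suc)
  define S where "S = {f \<in> space ?Q. \<forall>i\<in>F. f i = 0}"
  have S: "S \<in> sets ?Q"
    unfolding S_def using F by (intro sets.sets_Collect_countable_All' measurable_digit_Collect countable_finite) auto
  \<comment> \<open>The conditional law given \<open>S\<close>. Its image under restriction is
    recognised as the product measure by its values on finite cylinders.\<close>
  define D where "D = density ?Q (\<lambda>f. ennreal (real p ^ (N * N)) * indicator S f)"
  define r where "r f = restrict f (digit_idx N m)" for f :: "nat \<times> nat \<times> int \<Rightarrow> nat"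
  have r: "r \<in> measurable ?Q ?P" unfolding r_def by (rule measurable_restrict_subset[OF sub])
  then have rD: "r \<in> measurable D ?P" by (simp add: D_def)
  have spD: "space D = space ?Q" by (simp add: D_def)
  have em: "emeasure (distr D ?P r) X = ennreal (real p ^ (N * N)) * emeasure ?Q (S \<inter> (r -` X \<inter> space ?Q))"
    if "X \<in> sets ?P" for X
  proof -
    have rX: "r -` X \<inter> space ?Q \<in> sets ?Q" using r that by (rule measurable_sets)
    have "emeasure (distr D ?P r) X = emeasure D (r -` X \<inter> space ?Q)"
      using that rD by (simp add: emeasure_distr spD)
    also have "\<dots> = (\<integral>\<^sup>+ f. ennreal (real p ^ (N * N)) * indicator S f * indicator (r -` X \<inter> space ?Q) f \<partial>?Q)"
      unfolding D_def using S rX by (intro emeasure_density) auto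
    also have "\<dots> = (\<integral>\<^sup>+ f. ennreal (real p ^ (N * N)) * indicator (S \<inter> (r -` X \<inter> space ?Q)) f \<partial>?Q)"
      by (intro nn_integral_cong) (simp add: indicator_inter_arith mult.assoc)
    also have "\<dots> = ennreal (real p ^ (N * N)) * emeasure ?Q (S \<inter> (r -` X \<inter> space ?Q))"
      using S rX by (intro nn_integral_cmult_indicator) auto
    finally show ?thesis .
  qed
  have "distr D ?P r = ?P"
  proof (rule digit_prod.PiM_eq)
    fix J :: "(nat \<times> nat \<times> int) set" and G :: "nat \<times> nat \<times> int \<Rightarrow> nat set"
    assume J: "finite J" "J \<subseteq> digit_idx N m"
    have G: "prod_emb (digit_idx N m) ?M J (Pi\<^sub>E J G) \<in> sets ?P" using J by (intro sets_PiM_I) auto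
    define H where "H i = (if i \<in> F then {0} else G i)" for i
    have HJ: "H i = G i" if "i \<in> J" for i using that F J by (auto simp: H_def)
    have HF: "H i = {0}" if "i \<in> F" for i using that by (simp add: H_def)
    have rf: "r f \<in> prod_emb (digit_idx N m) ?M J (Pi\<^sub>E J G) \<longleftrightarrow> (\<forall>i\<in>J. f i \<in> G i)" for f
      unfolding prod_emb_def using J by (simp add: r_def Int_absorb1 Pi_iff)
    have "S \<inter> (r -` prod_emb (digit_idx N m) ?M J (Pi\<^sub>E J G) \<inter> space ?Q)
        = {f \<in> space ?Q. \<forall>i\<in>J \<union> F. f i \<in> H i}"
      unfolding S_def using rf by (auto simp: ball_Un HJ HF)
    then have "emeasure (distr D ?P r) (prod_emb (digit_idx N m) ?M J (Pi\<^sub>E J G))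
       = ennreal (real p ^ (N * N)) * emeasure ?Q {f \<in> space ?Q. \<forall>i\<in>J \<union> F. f i \<in> H i}"
      using em[OF G] by simp
    also have "emeasure ?Q {f \<in> space ?Q. \<forall>i\<in>J \<union> F. f i \<in> H i} = (\<Prod>i\<in>J \<union> F. emeasure (?M i) (H i))"
      using F J sub by (intro digit_prod.emeasure_PiM_Collect) auto
    also have "\<dots> = (\<Prod>i\<in>J. emeasure (?M i) (H i)) * (\<Prod>i\<in>F. emeasure (?M i) (H i))"
      using F J by (intro prod.union_disjoint) auto
    also have "(\<Prod>i\<in>J. emeasure (?M i) (H i)) = (\<Prod>i\<in>J. emeasure (?M i) (G i))"
      using F J by (intro prod.cong) (auto simp: H_def)
    also have "(\<Prod>i\<in>F. emeasure (?M i) (H i)) = (\<Prod>i\<in>F. ennreal (1 / real p))"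
      using p by (intro prod.cong) (auto simp: H_def emeasure_digit)
    also have "\<dots> = ennreal ((1 / real p) ^ (N * N))" by (simp add: F(4) ennreal_power)
    also have "ennreal (real p ^ (N * N)) * ((\<Prod>i\<in>J. emeasure (?M i) (G i)) * ennreal ((1 / real p) ^ (N * N)))
       = (ennreal (real p ^ (N * N)) * ennreal ((1 / real p) ^ (N * N))) * (\<Prod>i\<in>J. emeasure (?M i) (G i))"
      by (simp only: mult_ac)
    also have "ennreal (real p ^ (N * N)) * ennreal ((1 / real p) ^ (N * N)) = 1"
      using p by (simp add: ennreal_mult[symmetric] power_mult_distrib[symmetric])
    finally show "emeasure (distr D ?P r) (prod_emb (digit_idx N m) ?M J (Pi\<^sub>E J G)) = (\<Prod>i\<in>J. emeasure (?M i) (G i))"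
      by simp
  qed simp
  then have "emeasure ?P X = emeasure (distr D ?P r) X" by simp
  also have "\<dots> = ennreal (real p ^ (N * N)) * emeasure ?Q (S \<inter> (r -` X \<inter> space ?Q))" by (rule em[OF X])
  also have "S \<inter> (r -` X \<inter> space ?Q) = {f \<in> space ?Q. (\<forall>i\<in>F. f i = 0) \<and> restrict f (digit_idx N m) \<in> X}"
    by (auto simp: S_def r_def)
  finally show ?thesis .
qed

text \<open>Matrices with digits from \<open>- m\<close> on also have digits from
  \<open>- Suc m\<close> on, and the scaling makes the two levels agree on the smaller set.\<close>

lemma scaled_level_vol_mono:
  assumes p: "p > 0" and A: "A \<in> qmat_sets p N"
  shows "incseq (\<lambda>m. ennreal (real p ^ (m * N * N)) * level_vol p N m A)"
proof (rule incseq_SucI)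
  fix m
  let ?P = "digit_meas p N m" and ?Q = "digit_meas p N (Suc m)"
  let ?F = "{..<N} \<times> {..<N} \<times> {- int (Suc m)}"
  let ?X = "digit_emb N m -` A \<inter> space ?P"
  have "level_vol p N m A = ennreal (real p ^ (N * N)) *
      emeasure ?Q {f \<in> space ?Q. (\<forall>i\<in>?F. f i = 0) \<and> restrict f (digit_idx N m) \<in> ?X}"
    unfolding level_vol_def by (rule digit_meas_Suc[OF p sets_digit_emb_vimage[OF p A]])
  also have "\<dots> \<le> ennreal (real p ^ (N * N)) * level_vol p N (Suc m) A"
    unfolding level_vol_def
  proof (intro mult_left_mono emeasure_mono sets_digit_emb_vimage[OF p A] subsetI)
    fix f assume f: "f \<in> {f \<in> space ?Q. (\<forall>i\<in>?F. f i = 0) \<and> restrict f (digit_idx N m) \<in> ?X}"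
    have "digit_emb N (Suc m) f = digit_emb N m (restrict f (digit_idx N m))"
    proof (intro ext)
      fix a b j
      show "digit_emb N (Suc m) f a b j = digit_emb N m (restrict f (digit_idx N m)) a b j"
        using f by (auto simp: digit_emb_def digit_idx_Suc)
    qed
    then show "f \<in> digit_emb N (Suc m) -` A \<inter> space ?Q" using f by auto
  qed simp
  finally have "ennreal (real p ^ (m * N * N)) * level_vol p N m A
     \<le> ennreal (real p ^ (m * N * N)) * (ennreal (real p ^ (N * N)) * level_vol p N (Suc m) A)"
    by (rule mult_left_mono) simp
  also have "\<dots> = ennreal (real p ^ (Suc m * N * N)) * level_vol p N (Suc m) A"
  proof -
    have "real p ^ (Suc m * N * N) = real p ^ (m * N * N) * real p ^ (N * N)"
      by (simp only: power_add[symmetric]) (simp add: algebra_simps)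
    then show ?thesis by (simp only: ennreal_mult zero_le_power of_nat_0_le_iff mult.assoc)
  qed
  finally show "ennreal (real p ^ (m * N * N)) * level_vol p N m A
     \<le> ennreal (real p ^ (Suc m * N * N)) * level_vol p N (Suc m) A" .
qed

section \<open>The measure \<open>vol\<close>\<close>

lemma space_vol [simp]: "space (vol p N) = qmat_space p N"
  unfolding vol_def using qmat_gen_subset by (simp add: space_measure_of)

lemma sets_vol [simp]: "sets (vol p N) = qmat_sets p N"
  unfolding vol_def using qmat_gen_subset by (simp add: sets_measure_of)

text \<open>\<open>measure_of\<close> takes the prescribed values only once the supremum is known to
  be countably additive; it is, because an increasing supremum commutes with an infinite
  sum.\<close>

lemma emeasure_vol:
  assumes p: "p > 0" and A: "A \<in> qmat_sets p N"
  shows "emeasure (vol p N) A = (SUP m. ennreal (real p ^ (m * N * N)) * level_vol p N m A)"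
proof -
  let ?\<mu> = "\<lambda>A. SUP m. ennreal (real p ^ (m * N * N)) * emeasure (vol_m p N m) A"
  have \<mu>: "?\<mu> A = (SUP m. ennreal (real p ^ (m * N * N)) * level_vol p N m A)" if "A \<in> qmat_sets p N" for A
    using that by (simp add: emeasure_vol_m[OF p])
  have "emeasure (vol p N) A = ?\<mu> A"
  proof (rule emeasure_measure_of[OF vol_def qmat_gen_subset])
    show "positive (sets (vol p N)) ?\<mu>" by (simp add: positive_def)
    show "countably_additive (sets (vol p N)) ?\<mu>"
    proof (rule countably_additiveI)
      fix A :: "nat \<Rightarrow> qmat set"
      assume A: "range A \<subseteq> sets (vol p N)" "disjoint_family A" "(\<Union>i. A i) \<in> sets (vol p N)"
      then have Ai: "A i \<in> qmat_sets p N" for i by auto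
      have "(\<Sum>i. ?\<mu> (A i)) = (\<Sum>i. SUP m. ennreal (real p ^ (m * N * N)) * level_vol p N m (A i))"
        by (simp add: \<mu>[OF Ai])
      also have "\<dots> = (SUP m. \<Sum>i. ennreal (real p ^ (m * N * N)) * level_vol p N m (A i))"
        by (rule ennreal_suminf_SUP_eq) (rule scaled_level_vol_mono[OF p Ai])
      also have "\<dots> = (SUP m. ennreal (real p ^ (m * N * N)) * level_vol p N m (\<Union>i. A i))"
        using level_vol_countably_additive[OF p] A unfolding countably_additive_def
        by (simp add: ennreal_suminf_cmult)
      also have "\<dots> = ?\<mu> (\<Union>i. A i)" using A(3) by (simp add: \<mu>)
      finally show "(\<Sum>i. ?\<mu> (A i)) = ?\<mu> (\<Union>i. A i)" .
    qed
  qed (use A in simp)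
  then show ?thesis using \<mu>[OF A] by simp
qed

section \<open>Reversing the chain of coranks\<close>

lemma Pker_pos:
  assumes "p > 1" "s > -1" "y \<le> x"
  shows "Pker p s x y > 0"
proof -
  have "real p powr (-1-s) < 1" using assms by (simp add: powr_less_one)
  then have "qpoch (real p powr (-1-s)) (1/p) n > 0" "qpoch (1/p) (1/p) n > 0" for n
    using assms by (auto intro!: qpoch_pos)
  then show ?thesis using assms by (simp add: Pker_def)
qed

text \<open>The balancing factor of the time reversal:
  \<open>pitilde p N s x * corank_bal p N s x\<close> depends on \<open>x\<close> only through
  \<open>p\<close> to the power \<open>- (N - x)^2\<close>.\<close>

definition corank_bal :: "nat \<Rightarrow> nat \<Rightarrow> real \<Rightarrow> nat \<Rightarrow> real" where
  "corank_bal p N s x = qpoch (1/p) (1/p) (N - x) ^ 2 * qpoch (1/p) (1/p) x * qpoch (real p powr (-1-s)) (1/p) x"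

lemma corank_bal_pos:
  assumes "p > 1" "s > -1"
  shows "corank_bal p N s x > 0"
proof -
  have "real p powr (-1-s) < 1" using assms by (simp add: powr_less_one)
  then have "qpoch (real p powr (-1-s)) (1/p) n > 0" "qpoch (1/p) (1/p) n > 0" for n
    using assms by (auto intro!: qpoch_pos)
  then show ?thesis unfolding corank_bal_def by (intro mult_pos_pos zero_less_power)
qed

text \<open>Reversing the time direction turns the complementary chain \<open>N - x\<close> with kernel \<open>Pker p 0\<close>
  into the chain \<open>x\<close> with kernel \<open>Pker p s\<close>.\<close>
lemma Pker_reverse:
  assumes p: "p > 1" "s > -1" and xy: "y \<le> x" "x \<le> N"
  shows "Pker p 0 (N - y) (N - x) * corank_bal p N s x =
    Pker p s x y * real p powr (- real ((N - x)^2) + real (y^2) + s * real y) * corank_bal p N s y"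
proof -
  have "real p powr (-1-s) < 1" using p by (simp add: powr_less_one)
  then have R: "qpoch (real p powr (-1-s)) (1/p) n \<noteq> 0" for n
    using p qpoch_pos[of "real p powr (-1-s)" "1/p" n] by simp
  have Q: "qpoch (1/p) (1/p) n \<noteq> 0" for n
    using p qpoch_pos[of "1/p" "1/p" n] by simp
  have m1: "real p powr - 1 = 1 / real p" using p by (simp add: powr_minus_divide)
  have d: "N - y - (N - x) = x - y" using xy by simp
  have E: "real p powr (- real (y^2) - s * real y) * real p powr (- real ((N - x)^2) + real (y^2) + s * real y)
     = real p powr (- real ((N - x)^2))"
    by (simp flip: powr_add)
  define A where "A = real p powr (- real (y^2) - s * real y)"
  define B where "B = real p powr (- real ((N - x)^2) + real (y^2) + s * real y)"
  have P0: "Pker p 0 (N - y) (N - x) = A * B * qpoch (1/p) (1/p) (N - y) ^ 2 / (qpoch (1/p) (1/p) (N - x) ^ 2 * qpoch (1/p) (1/p) (x - y))"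
    using xy E unfolding Pker_def d A_def B_def by (simp add: m1 power2_eq_square mult_ac)
  have Ps: "Pker p s x y = A * qpoch (1/p) (1/p) x * qpoch (real p powr (-1-s)) (1/p) x
      / (qpoch (1/p) (1/p) y * qpoch (1/p) (1/p) (x - y) * qpoch (real p powr (-1-s)) (1/p) y)"
    using xy unfolding Pker_def A_def by simp
  show ?thesis unfolding P0 Ps B_def[symmetric] corank_bal_def
    using Q[of "N - x"] Q[of "x - y"] Q[of y] R[of y] by (simp add: divide_simps)
qed

text \<open>The reversal relations telescope in \<open>corank_bal\<close> and leave its two end
  values. Each further index brings a factor \<open>p ^ (N * N)\<close> from the scaling and the
  share of \<open>x i\<close> in the density.\<close>

lemma prod_Pker_reverse:
  assumes p: "p > 1" "s > -1" and x: "\<And>i. x (Suc i) \<le> x i" "x 0 \<le> N"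
  shows "real p ^ (m * N * N) * real p powr ((- s - 2 * real N) * (\<Sum>i=1..m. real (x i)))
       * (\<Prod>i<Suc m. Pker p 0 (N - x (Suc i)) (N - x i)) * corank_bal p N s (x 0)
     = real p powr (- real ((N - x 0)^2)) * real p powr (real (x (Suc m)^2) + s * real (x (Suc m)))
       * corank_bal p N s (x (Suc m)) * (\<Prod>i<Suc m. Pker p s (x i) (x (Suc i)))"
proof (induction m)
  case 0
  have "real p powr (- real ((N - x 0)^2) + real (x 1 ^2) + s * real (x 1))
     = real p powr (- real ((N - x 0)^2)) * real p powr (real (x 1 ^2) + s * real (x 1))"
    unfolding add.assoc by (rule powr_add)
  then show ?case
    using Pker_reverse[OF p x(1)[of 0] x(2)] p by (simp add: mult_ac)
next
  case (Suc m)
  have xN: "x i \<le> N" for i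
    by (induction i) (use x in \<open>auto intro: order_trans\<close>)
  define y where "y = x (Suc m)"
  define z where "z = x (Suc (Suc m))"
  define S where "S = (\<Sum>i=1..m. real (x i))"
  define X where "X = (\<Prod>i<Suc m. Pker p 0 (N - x (Suc i)) (N - x i))"
  define Y where "Y = (\<Prod>i<Suc m. Pker p s (x i) (x (Suc i)))"
  define C where "C = corank_bal p N s"
  have yN: "y \<le> N" by (simp add: y_def xN)
  have step: "Pker p 0 (N - z) (N - y) * C y = Pker p s y z * real p powr (- real ((N - y)^2) + real (z^2) + s * real z) * C z"
    unfolding C_def by (rule Pker_reverse[OF p]) (use x xN in \<open>auto simp: y_def z_def\<close>)
  have IH: "real p ^ (m * N * N) * real p powr ((- s - 2 * real N) * S) * X * C (x 0)
     = real p powr (- real ((N - x 0)^2)) * real p powr (real (y^2) + s * real y) * C y * Y"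
    using Suc.IH unfolding S_def X_def Y_def C_def y_def .
  have pw: "real p ^ (Suc m * N * N) * real p powr ((- s - 2 * real N) * (S + real y))
     = (real p ^ (m * N * N) * real p powr ((- s - 2 * real N) * S)) * (real p powr (real (N * N) + (- s - 2 * real N) * real y))"
  proof -
    have "real p ^ (N * N) = real p powr real (N * N)" using powr_realpow[of "real p" "N * N"] p by simp
    then have e: "real p ^ (Suc m * N * N) = real p ^ (m * N * N) * real p powr real (N * N)"
      by (simp add: power_add algebra_simps)
    show ?thesis unfolding e distrib_left powr_add by (simp only: mult_ac)
  qed
  have sq: "real ((N - y)^2) = real N ^ 2 - 2 * real N * real y + real y ^ 2"
    using yN by (simp add: of_nat_diff power2_diff)
  \<comment> \<open>Completing the square: \<open>y^2 + s * y + N * N - (s + 2 * N) * y\<close>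
    equals \<open>(N - y)^2\<close> and cancels the exponent left by the next reversal.\<close>
  have ex: "real p powr (real (y^2) + s * real y) * real p powr (real (N * N) + (- s - 2 * real N) * real y)
      * real p powr (- real ((N - y)^2) + real (z^2) + s * real z) = real p powr (real (z^2) + s * real z)"
    unfolding powr_add[symmetric] sq by (rule arg_cong[where f = "(powr) (real p)"]) (simp add: power2_eq_square algebra_simps)
  have "real p ^ (Suc m * N * N) * real p powr ((- s - 2 * real N) * (S + real y))
       * (X * Pker p 0 (N - z) (N - y)) * C (x 0)
     = (real p ^ (m * N * N) * real p powr ((- s - 2 * real N) * S) * X * C (x 0))
       * (real p powr (real (N * N) + (- s - 2 * real N) * real y) * Pker p 0 (N - z) (N - y))"
    unfolding pw by (simp only: mult_ac)
  also have "\<dots> = real p powr (- real ((N - x 0)^2)) * Y * (real p powr (real (y^2) + s * real y) *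
      real p powr (real (N * N) + (- s - 2 * real N) * real y) * (Pker p 0 (N - z) (N - y) * C y))"
    unfolding IH by (simp only: mult_ac)
  also have "\<dots> = real p powr (- real ((N - x 0)^2)) * Y * ((real p powr (real (y^2) + s * real y) *
      real p powr (real (N * N) + (- s - 2 * real N) * real y) * real p powr (- real ((N - y)^2) + real (z^2) + s * real z))
       * (Pker p s y z * C z))"
    unfolding step by (simp only: mult_ac)
  also have "\<dots> = real p powr (- real ((N - x 0)^2)) * real p powr (real (z^2) + s * real z) * C z * (Y * Pker p s y z)"
    unfolding ex by (simp only: mult_ac)
  finally show ?case
    unfolding prod.lessThan_Suc[of _ "Suc m"] X_def[symmetric] Y_def[symmetric] y_def[symmetric] z_def[symmetric] C_def[symmetric]
    by (simp add: S_def y_def)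
qed

section \<open>Tail counts and the density in terms of \<open>k\<close>\<close>

lemma length_filter_mem_eq_sum:
  assumes "finite S"
  shows "length (filter (\<lambda>v. v \<in> S) k) = (\<Sum>v\<in>S. lcount k v)"
proof (induction k)
  case (Cons a k)
  have "(\<Sum>v\<in>S. lcount (a # k) v) = (\<Sum>v\<in>S. (if a = v then 1 else 0) + lcount k v)"
    by (intro sum.cong) (auto simp: lcount_def)
  also have "\<dots> = (if a \<in> S then 1 else 0) + (\<Sum>v\<in>S. lcount k v)"
    using assms by (simp add: sum.distrib sum.delta)
  finally show ?case using Cons by simp
qed (simp add: lcount_def)

text \<open>An entry that is not an integer at least \<open>i\<close> is either an integer at most
  \<open>i - 1\<close> or \<open>-\<infinity>\<close>; this is where the threshold moves by
  one.\<close>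

lemma ltail_add_kcount:
  assumes k: "k \<in> Delta N"
  shows "ltail k i + kcount k (i - 1) = N"
proof -
  define J where "J = {j::int. i \<le> j \<and> ereal (of_int j) \<in> set k}"
  define S where "S = (\<lambda>j::int. ereal (of_int j)) ` J"
  have inj: "inj_on (\<lambda>j::int. ereal (of_int j)) J" by (auto simp: inj_on_def)
  have "S \<subseteq> set k" by (auto simp: S_def J_def)
  then have fin: "finite S" by (rule finite_subset) simp
  have "ltail k i = (\<Sum>v\<in>S. lcount k v)"
    unfolding ltail_def J_def[symmetric] S_def using inj by (simp add: sum.reindex)
  also have "\<dots> = length (filter (\<lambda>v. v \<in> S) k)" by (rule length_filter_mem_eq_sum[OF fin, symmetric])
  finally have 1: "ltail k i = length (filter (\<lambda>v. v \<in> S) k)" .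
  have "v \<notin> S \<longleftrightarrow> v \<le> ereal (of_int (i - 1))" if v: "v \<in> set k" for v
  proof (cases rule: DeltaE[OF k v])
    case 1
    then show ?thesis by (auto simp: S_def)
  next
    case (2 j)
    then have "v \<in> S \<longleftrightarrow> i \<le> j" using v by (auto simp: S_def J_def)
    moreover have "v \<le> ereal (of_int (i - 1)) \<longleftrightarrow> j \<le> i - 1" unfolding 2 by (simp only: ereal_less_eq of_int_le_iff)
    ultimately show ?thesis by auto
  qed
  then have "kcount k (i - 1) = length (filter (\<lambda>v. v \<notin> S) k)"
    unfolding kcount_def by (intro arg_cong[where f = length] filter_cong) auto
  then show ?thesis unfolding 1 using sum_length_filter_compl[of "\<lambda>v. v \<in> S" k] k by (simp add: Delta_def)
qed

lemma kcount_mono: "z \<le> z' \<Longrightarrow> kcount k z \<le> kcount k z'"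
  unfolding kcount_eq_card by (intro card_mono) (auto intro: order_trans)

definition kgamma :: "nat \<Rightarrow> nat \<Rightarrow> ereal list \<Rightarrow> real" where
  "kgamma p N k = (\<Prod>q\<in>{q. q < N \<and> k ! q > 0}. real p powr real_of_ereal (k ! q))"

text \<open>A positive entry \<open>j \<le> m\<close> is the number of \<open>i\<close> in
  \<open>{1..m}\<close> with \<open>i \<le> j\<close>; summing by thresholds instead of entries
  gives the tail counts.\<close>

lemma kgamma_eq:
  assumes p: "p > 1" and k: "k \<in> Delta N" "\<And>v. v \<in> set k \<Longrightarrow> v \<le> ereal (real m)"
  shows "kgamma p N k = real p powr (\<Sum>i=1..m. real (ltail k (int i)))"
proof -
  have len: "length k = N" using k by (simp add: Delta_def)
  have lt: "ltail k (int i) = card {q. q < N \<and> k ! q > ereal (of_int (int i - 1))}" for i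
  proof -
    have c: "card {q. q < N \<and> \<not> P q} + card {q. q < N \<and> P q} = N" for P
    proof -
      have "card ({q. q < N \<and> \<not> P q} \<union> {q. q < N \<and> P q}) = card {q. q < N \<and> \<not> P q} + card {q. q < N \<and> P q}"
        by (rule card_Un_disjoint) auto
      moreover have "{q. q < N \<and> \<not> P q} \<union> {q. q < N \<and> P q} = {..<N}" by auto
      ultimately show ?thesis by simp
    qed
    show ?thesis
      using ltail_add_kcount[OF k(1), of "int i"] c[of "\<lambda>q. k ! q \<le> ereal (of_int (int i - 1))"]
      unfolding kcount_eq_card len not_le by linarith
  qed
  have "(\<Sum>i=1..m. real (ltail k (int i))) = (\<Sum>i=1..m. \<Sum>q<N. if k ! q > ereal (of_int (int i - 1)) then 1 else 0)"
    unfolding lt by (intro sum.cong refl) (simp add: sum.If_cases Int_def)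
  also have "\<dots> = (\<Sum>q<N. \<Sum>i=1..m. if k ! q > ereal (of_int (int i - 1)) then 1 else 0)" by (rule sum.swap)
  also have "\<dots> = (\<Sum>q<N. if k ! q > 0 then real_of_ereal (k ! q) else 0)"
  proof (rule sum.cong[OF refl])
    fix q assume "q \<in> {..<N}"
    then have mem: "k ! q \<in> set k" using len by simp
    show "(\<Sum>i=1..m. if k ! q > ereal (of_int (int i - 1)) then 1 else 0) = (if k ! q > 0 then real_of_ereal (k ! q) else 0)"
    proof (cases rule: DeltaE[OF k(1) mem])
      case 1
      then show ?thesis by simp
    next
      case (2 j)
      have jm: "j \<le> int m" using k(2)[OF mem] 2 by simp
      have iff: "k ! q > ereal (of_int (int i - 1)) \<longleftrightarrow> i \<le> nat j" if "i \<in> {1..m}" for i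
      proof -
        have "k ! q > ereal (of_int (int i - 1)) \<longleftrightarrow> int i - 1 < j" unfolding 2 by (simp only: ereal_less of_int_less_iff less_ereal.simps)
        then show ?thesis using that by auto
      qed
      have "(\<Sum>i=1..m. if k ! q > ereal (of_int (int i - 1)) then 1 else (0::real)) = (\<Sum>i=1..m. if i \<le> nat j then 1 else 0)"
        by (intro sum.cong refl) (simp only: iff)
      also have "\<dots> = real (card {i \<in> {1..m}. i \<le> nat j})" by (simp add: sum.If_cases Int_def)
      also have "{i \<in> {1..m}. i \<le> nat j} = {1..nat j}" using jm by auto
      finally show ?thesis using 2 by auto
    qed
  qed
  also have "\<dots> = (\<Sum>q\<in>{q. q < N \<and> k ! q > 0}. real_of_ereal (k ! q))"
    by (subst sum.inter_filter[symmetric]) auto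
  finally show ?thesis unfolding kgamma_def using p by (simp add: powr_sum)
qed

text \<open>The chain \<open>c\<close> starts at \<open>N\<close> and up to index
  \<open>Suc m\<close> runs through the values \<open>N - x i\<close> backwards, ending in
  \<open>N - x 0\<close>; from there on it is the chain \<open>y\<close>. The initial part is
  reversed, the rest is kept.\<close>

lemma level_identity:
  assumes p: "p > 1" "s > -1" and k: "k \<in> Delta N" "\<And>v. v \<in> set k \<Longrightarrow> v \<le> ereal (real m)"
    and L: "(\<lambda>n. \<Prod>i<n. Pker p 0 (kcount k (int m - int i)) (kcount k (int m - int (Suc i)))) \<longlonglongrightarrow> L"
  defines "x \<equiv> \<lambda>i::nat. ltail k (int i)" and "y \<equiv> \<lambda>i::nat. N - ltail k (- int i)"
  shows "Mconst p N s * kgamma p N k powr (- s - 2 * real N) * (real p ^ (m * N * N) * L)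
    = pitilde p N s (x 0) * lim (\<lambda>n. \<Prod>i<n. Pker p s (x i) (x (Suc i))) * lim (\<lambda>n. \<Prod>i<n. Pker p 0 (y i) (y (Suc i)))"
proof -
  define c where "c i = kcount k (int m - int i)" for i
  have xk: "x i + kcount k (int i - 1) = N" for i unfolding x_def by (rule ltail_add_kcount[OF k(1)])
  have xN: "x i \<le> N" for i using xk[of i] by simp
  have x_dec: "x (Suc i) \<le> x i" for i
    using xk[of i] xk[of "Suc i"] kcount_mono[of "int i - 1" "int (Suc i) - 1" k] by simp
  \<comment> \<open>The shift is \<open>Suc m\<close>, not \<open>m\<close>, because the complement
    of the entries at least \<open>- i\<close> is counted at the threshold
    \<open>- i - 1\<close>.\<close>
  have yk: "y i = c (Suc m + i)" for i
  proof -
    have e: "int m - int (Suc m + i) = - int i - 1" by simp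
    show ?thesis unfolding y_def c_def e using ltail_add_kcount[OF k(1), of "- int i"] by linarith
  qed
  have cx: "c i = N - x (Suc m - i)" if "i \<le> Suc m" for i
    using xk[of "Suc m - i"] that unfolding c_def by (simp add: of_nat_diff algebra_simps)
  have "filter (\<lambda>v. v \<le> ereal (of_int (int m))) k = k" using k(2) by (auto simp: filter_id_conv)
  then have "kcount k (int m) = N" using k(1) by (simp add: kcount_def Delta_def)
  then have x0: "x (Suc m) = 0" using xk[of "Suc m"] by simp
  have x0': "x i = 0" if "i \<ge> Suc m" for i
    using that
  proof (induction i rule: dec_induct)
    case (step n)
    then show ?case using x_dec[of n] by simp
  qed (rule x0)
  \<comment> \<open>No entry exceeds \<open>m\<close>, so \<open>x\<close> has reached
    \<open>0\<close> at index \<open>Suc m\<close> and all later factors of its product equal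
    one.\<close>
  have P00: "Pker p s 0 0 = 1" using p by (simp add: Pker_def)
  define X where "X = (\<Prod>i<Suc m. Pker p s (x i) (x (Suc i)))"
  have "(\<Prod>i<Suc m + n. Pker p s (x i) (x (Suc i))) = X" for n
    by (induction n) (auto simp: X_def x0' P00)
  then have "eventually (\<lambda>n. (\<Prod>i<n. Pker p s (x i) (x (Suc i))) = X) sequentially"
    unfolding eventually_sequentially by (metis le_Suc_ex)
  then have limx: "lim (\<lambda>n. \<Prod>i<n. Pker p s (x i) (x (Suc i))) = X"
    by (intro limI tendsto_eventually)
  define Pre where "Pre = (\<Prod>i<Suc m. Pker p 0 (c i) (c (Suc i)))"
  have Pre_eq: "Pre = (\<Prod>i<Suc m. Pker p 0 (N - x (Suc i)) (N - x i))"
    unfolding Pre_def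
    by (subst prod.nat_diff_reindex[symmetric]) (intro prod.cong refl, simp add: cx Suc_diff_le)
  \<comment> \<open>Positivity allows division by the finite initial part, which carries the
    convergence over to the product along \<open>y\<close>.\<close>
  have Pre_pos: "Pre > 0"
    unfolding Pre_eq using p x_dec by (intro prod_pos Pker_pos ballI) (auto intro: diff_le_mono2)
  have split: "(\<Prod>i<Suc m + n. Pker p 0 (c i) (c (Suc i))) = Pre * (\<Prod>i<n. Pker p 0 (y i) (y (Suc i)))" for n
    by (induction n) (simp_all add: Pre_def yk mult.assoc)
  have "(\<lambda>n. \<Prod>i<n + Suc m. Pker p 0 (c i) (c (Suc i))) \<longlonglongrightarrow> L"
    using L unfolding c_def[symmetric] by (rule LIMSEQ_ignore_initial_segment)
  then have "(\<lambda>n. Pre * (\<Prod>i<n. Pker p 0 (y i) (y (Suc i)))) \<longlonglongrightarrow> L"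
    unfolding split[symmetric] by (simp only: add.commute)
  then have "(\<lambda>n. (1 / Pre) * (Pre * (\<Prod>i<n. Pker p 0 (y i) (y (Suc i))))) \<longlonglongrightarrow> (1 / Pre) * L"
    by (rule tendsto_mult_left)
  then have "(\<lambda>n. \<Prod>i<n. Pker p 0 (y i) (y (Suc i))) \<longlonglongrightarrow> L / Pre"
    using Pre_pos by simp
  then have limy: "lim (\<lambda>n. \<Prod>i<n. Pker p 0 (y i) (y (Suc i))) = L / Pre" by (rule limI)
  \<comment> \<open>Since \<open>x (Suc m) = 0\<close>, the balancing factor at the far end is
    \<open>qpoch (1/p) (1/p) N ^ 2\<close>; this is the origin of that factor in
    \<open>pitilde\<close>.\<close>
  have "real p ^ (m * N * N) * real p powr ((- s - 2 * real N) * (\<Sum>i=1..m. real (x i))) * Pre * corank_bal p N s (x 0)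
     = real p powr (- real ((N - x 0)^2)) * qpoch (1/p) (1/p) N ^ 2 * X"
    using prod_Pker_reverse[OF p, of x N m, OF x_dec xN] p unfolding Pre_eq X_def x0
    by (simp add: corank_bal_def)
  moreover have "kgamma p N k powr (- s - 2 * real N) = real p powr ((- s - 2 * real N) * (\<Sum>i=1..m. real (x i)))"
    using kgamma_eq[OF p(1) k(1), of m] k(2) unfolding x_def by (simp add: powr_powr mult.commute)
  ultimately have E: "kgamma p N k powr (- s - 2 * real N) * real p ^ (m * N * N) * Pre * corank_bal p N s (x 0)
     = real p powr (- real ((N - x 0)^2)) * qpoch (1/p) (1/p) N ^ 2 * X"
    by (simp add: mult_ac)
  have C: "corank_bal p N s (x 0) \<noteq> 0" using corank_bal_pos[OF p, of N "x 0"] by simp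
  have pit: "pitilde p N s (x 0) * corank_bal p N s (x 0) = Mconst p N s * (real p powr (- real ((N - x 0)^2)) * qpoch (1/p) (1/p) N ^ 2)"
    using C unfolding pitilde_def Mconst_def corank_bal_def
    by (simp add: divide_simps mult_ac)
  have "Mconst p N s * kgamma p N k powr (- s - 2 * real N) * (real p ^ (m * N * N) * L) * corank_bal p N s (x 0)
     = Mconst p N s * (kgamma p N k powr (- s - 2 * real N) * real p ^ (m * N * N) * Pre * corank_bal p N s (x 0)) * (L / Pre)"
    using Pre_pos by simp
  also have "\<dots> = (Mconst p N s * (real p powr (- real ((N - x 0)^2)) * qpoch (1/p) (1/p) N ^ 2)) * X * (L / Pre)"
    unfolding E by (simp only: mult_ac)
  also have "\<dots> = pitilde p N s (x 0) * X * (L / Pre) * corank_bal p N s (x 0)"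
    unfolding pit[symmetric] by (simp only: mult_ac)
  finally show ?thesis unfolding limx limy by (rule mult_right_cancel[OF C, THEN iffD1])
qed

section \<open>The law of the singular numbers\<close>

lemma trunc_cong: "(\<And>i. i < n \<Longrightarrow> d i = d' i) \<Longrightarrow> trunc p n d = trunc p n d'"
  unfolding trunc_def by (intro sum.cong) auto

lemma trunc_digits:
  assumes "p > 0"
  shows "trunc p n (\<lambda>i. nat (x div int p ^ i mod int p)) = x mod int p ^ n"
proof (induction n)
  case (Suc n)
  have "x mod (int p ^ n * int p) = int p ^ n * (x div int p ^ n mod int p) + x mod int p ^ n"
    using assms by (intro zmod_zmult2_eq) simp
  then show ?case using assms Suc by (simp add: trunc_Suc mult.commute)
qed simp

lemma trunc_bounds:
  assumes "\<And>i. i < n \<Longrightarrow> d i < p"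
  shows "0 \<le> trunc p n d \<and> trunc p n d < int p ^ n"
  using assms
proof (induction n)
  case (Suc n)
  then have IH: "0 \<le> trunc p n d" "trunc p n d < int p ^ n" and d: "int (d n) \<le> int p - 1"
    using Suc.prems[of n] by (simp_all add: less_Suc_eq)
  have "int (d n) * int p ^ n \<le> (int p - 1) * int p ^ n" using d by (intro mult_right_mono) auto
  then show ?case using IH by (simp add: trunc_Suc left_diff_distrib)
qed simp

lemma trunc_inj:
  assumes "\<And>i. i < n \<Longrightarrow> d i < p" "\<And>i. i < n \<Longrightarrow> d' i < p" "trunc p n d = trunc p n d'" "i < n"
  shows "d i = d' i"
  using assms
proof (induction n)
  case (Suc n)
  have b: "0 \<le> trunc p n d \<and> trunc p n d < int p ^ n" "0 \<le> trunc p n d' \<and> trunc p n d' < int p ^ n"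
    using Suc.prems(1,2) by (auto intro!: trunc_bounds)
  have e: "trunc p n d + int (d n) * int p ^ n = trunc p n d' + int (d' n) * int p ^ n"
    using Suc.prems(3) by (simp add: trunc_Suc)
  then have "(trunc p n d + int (d n) * int p ^ n) mod int p ^ n = (trunc p n d' + int (d' n) * int p ^ n) mod int p ^ n"
    by simp
  then have t: "trunc p n d = trunc p n d'" using b by (simp add: mod_pos_pos_trivial)
  have "p > 0" using Suc.prems(1)[of n] by simp
  then have "d n = d' n" using e t by simp
  then show ?case using Suc.IH Suc.prems t by (cases "i = n") auto
qed simp

lemma trunc_eq_iff:
  assumes "p > 0" "\<And>i. i < n \<Longrightarrow> d i < p" "0 \<le> x" "x < int p ^ n"
  shows "trunc p n d = x \<longleftrightarrow> (\<forall>i<n. d i = nat (x div int p ^ i mod int p))"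
proof -
  have x: "trunc p n (\<lambda>i. nat (x div int p ^ i mod int p)) = x"
    using assms by (simp add: trunc_digits)
  have lt: "nat (x div int p ^ i mod int p) < p" for i
    using assms(1) by (simp add: nat_less_iff)
  show ?thesis
  proof
    assume "trunc p n d = x"
    with x show "\<forall>i<n. d i = nat (x div int p ^ i mod int p)"
      using trunc_inj[of n d p "\<lambda>i. nat (x div int p ^ i mod int p)"] assms(2) lt by auto
  next
    assume "\<forall>i<n. d i = nat (x div int p ^ i mod int p)"
    then have "trunc p n d = trunc p n (\<lambda>i. nat (x div int p ^ i mod int p))" by (intro trunc_cong) auto
    then show "trunc p n d = x" using x by simp
  qed
qed

section \<open>Digit cylinders of matrices with a given profile\<close>

definition profile_mats :: "nat \<Rightarrow> nat \<Rightarrow> nat \<Rightarrow> (nat \<Rightarrow> nat) \<Rightarrow> (nat \<times> nat \<Rightarrow> int) set" where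
  "profile_mats p N n c = {A \<in> {..<N} \<times> {..<N} \<rightarrow>\<^sub>E {0..<int p ^ n}. profile p n {..<N} {..<N} (curry A) c}"

definition profile_set :: "nat \<Rightarrow> nat \<Rightarrow> nat \<Rightarrow> nat \<Rightarrow> (nat \<Rightarrow> nat) \<Rightarrow> qmat set" where
  "profile_set p N m n c = {Z \<in> qmat_space p N. profile p n {..<N} {..<N} (qtrunc p m n Z) c}"

definition has_digits :: "nat \<Rightarrow> nat \<Rightarrow> nat \<Rightarrow> nat \<Rightarrow> (nat \<times> nat \<Rightarrow> int) \<Rightarrow> qmat \<Rightarrow> bool" where
  "has_digits p N m n A Z \<longleftrightarrow>
     (\<forall>a\<in>{..<N}. \<forall>b\<in>{..<N}. \<forall>i\<in>{..<n}. Z a b (int i - int m) = nat (A (a, b) div int p ^ i mod int p))"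

lemma finite_profile_mats: "finite (profile_mats p N n c)"
  unfolding profile_mats_def
  by (rule finite_subset[OF Collect_restrict]) (auto intro!: finite_PiE)

text \<open>A profile depends only on the residue matrix modulo \<open>p ^ n\<close>, and each
  residue matrix is one pattern of finitely many digits. The event is therefore a finite union of
  cylinders.\<close>

lemma profile_qtrunc_iff:
  assumes p: "p > 0" and Z: "Z \<in> qmat_space p N"
  shows "profile p n {..<N} {..<N} (qtrunc p m n Z) c \<longleftrightarrow> (\<exists>A\<in>profile_mats p N n c. has_digits p N m n A Z)"
proof -
  have Zp: "Z a b j < p" for a b j using Z by (simp add: qmat_space_def)
  have dig: "has_digits p N m n A Z \<longleftrightarrow> (\<forall>a\<in>{..<N}. \<forall>b\<in>{..<N}. qtrunc p m n Z a b = A (a, b))"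
    if A: "A \<in> {..<N} \<times> {..<N} \<rightarrow>\<^sub>E {0..<int p ^ n}" for A
    unfolding has_digits_def
  proof (intro ball_cong refl)
    fix a b assume "a \<in> {..<N}" "b \<in> {..<N}"
    then have "A (a, b) \<in> {0..<int p ^ n}" using A by blast
    then show "(\<forall>i\<in>{..<n}. Z a b (int i - int m) = nat (A (a, b) div int p ^ i mod int p))
       \<longleftrightarrow> qtrunc p m n Z a b = A (a, b)"
      unfolding qtrunc_def using trunc_eq_iff[of p n "\<lambda>i. Z a b (int i - int m)" "A (a, b)"] p Zp by auto
  qed
  show ?thesis
  proof
    assume pr: "profile p n {..<N} {..<N} (qtrunc p m n Z) c"
    define A where "A = (\<lambda>(a, b)\<in>{..<N} \<times> {..<N}. qtrunc p m n Z a b)"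
    have A: "A \<in> {..<N} \<times> {..<N} \<rightarrow>\<^sub>E {0..<int p ^ n}"
      using trunc_bounds[of n _ p] Zp by (auto simp: A_def qtrunc_def)
    moreover have "profile p n {..<N} {..<N} (curry A) c \<longleftrightarrow> profile p n {..<N} {..<N} (qtrunc p m n Z) c"
      by (rule profile_cong) (simp add: A_def)
    moreover have "has_digits p N m n A Z" unfolding dig[OF A] by (simp add: A_def)
    ultimately show "\<exists>A\<in>profile_mats p N n c. has_digits p N m n A Z"
      using pr unfolding profile_mats_def by blast
  next
    assume "\<exists>A\<in>profile_mats p N n c. has_digits p N m n A Z"
    then obtain A where A: "A \<in> {..<N} \<times> {..<N} \<rightarrow>\<^sub>E {0..<int p ^ n}" "profile p n {..<N} {..<N} (curry A) c"
      "has_digits p N m n A Z" unfolding profile_mats_def by blast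
    have "profile p n {..<N} {..<N} (curry A) c \<longleftrightarrow> profile p n {..<N} {..<N} (qtrunc p m n Z) c"
      by (rule profile_cong) (use A(3) dig[OF A(1)] in simp)
    then show "profile p n {..<N} {..<N} (qtrunc p m n Z) c" using A(2) by simp
  qed
qed

interpretation qmat_sigma: sigma_algebra "qmat_space p N" "qmat_sets p N" for p N
  by (rule sigma_algebra_sigma_sets[OF qmat_gen_subset])

lemma digit_set_in_qmat_sets: "{Z \<in> qmat_space p N. Z a b j = d} \<in> qmat_sets p N"
  by (rule sigma_sets.Basic) (auto simp: qmat_gen_def)

lemma profile_set_in_qmat_sets:
  assumes p: "p > 0"
  shows "profile_set p N m n c \<in> qmat_sets p N"
proof -
  have "profile_set p N m n c = {Z \<in> qmat_space p N. \<exists>A\<in>profile_mats p N n c. has_digits p N m n A Z}"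
    unfolding profile_set_def using profile_qtrunc_iff[OF p] by blast
  also have "\<dots> \<in> qmat_sets p N"
    unfolding has_digits_def
    by (intro qmat_sigma.sets_Collect_countable_Ex' qmat_sigma.sets_Collect_countable_All'
        digit_set_in_qmat_sets countable_finite finite_profile_mats) auto
  finally show ?thesis .
qed

lemma emeasure_has_digits:
  assumes p: "p > 0"
  shows "{f \<in> space (digit_meas p N m). has_digits p N m n A (digit_emb N m f)} \<in> sets (digit_meas p N m)"
    and "emeasure (digit_meas p N m) {f \<in> space (digit_meas p N m). has_digits p N m n A (digit_emb N m f)}
       = ennreal (1 / real p ^ (n * N * N))"
proof -
  let ?P = "digit_meas p N m"
  let ?g = "\<lambda>(a :: nat, b :: nat, i :: nat). (a, b, int i - int m)"
  define J where "J = ?g ` ({..<N} \<times> {..<N} \<times> {..<n})"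
  define X where "X z = (case z of (a, b, j) \<Rightarrow> {nat (A (a, b) div int p ^ nat (j + int m) mod int p)})"
    for z :: "nat \<times> nat \<times> int"
  have inj: "inj_on ?g ({..<N} \<times> {..<N} \<times> {..<n})" by (auto simp: inj_on_def)
  have J: "J \<subseteq> digit_idx N m" "finite J" by (auto simp: J_def digit_idx_def)
  have cJ: "card J = n * N * N"
    unfolding J_def by (subst card_image[OF inj]) (simp add: card_cartesian_product)
  have eq: "{f \<in> space ?P. has_digits p N m n A (digit_emb N m f)} = {f \<in> space ?P. \<forall>z\<in>J. f z \<in> X z}"
    by (auto simp: has_digits_def J_def X_def digit_emb_def digit_idx_def)
  show "{f \<in> space ?P. has_digits p N m n A (digit_emb N m f)} \<in> sets ?P"
    unfolding eq using J by (intro sets.sets_Collect_countable_All' measurable_digit_Collect countable_finite) auto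
  have "emeasure ?P {f \<in> space ?P. \<forall>z\<in>J. f z \<in> X z} = (\<Prod>z\<in>J. emeasure (measure_pmf (pmf_of_set {0..<p})) (X z))"
    by (rule digit_prod.emeasure_PiM_Collect[OF J]) auto
  also have "\<dots> = (\<Prod>z\<in>J. ennreal (1 / real p))"
    using p by (intro prod.cong refl) (auto simp: X_def nat_less_iff intro!: emeasure_digit)
  also have "\<dots> = ennreal (1 / real p ^ (n * N * N))"
    by (simp add: cJ ennreal_power power_one_over)
  finally show "emeasure ?P {f \<in> space ?P. has_digits p N m n A (digit_emb N m f)} = ennreal (1 / real p ^ (n * N * N))"
    unfolding eq .
qed

lemma AE_digit_emb:
  assumes p: "p > 0"
  shows "AE f in digit_meas p N m. digit_emb N m f \<in> qmat_space p N"
proof -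
  have "AE f in digit_meas p N m. \<forall>i\<in>digit_idx N m. f i < p"
  proof (subst AE_ball_countable)
    show "\<forall>i\<in>digit_idx N m. AE f in digit_meas p N m. f i < p"
    proof
      fix i assume i: "i \<in> digit_idx N m"
      have "AE d in measure_pmf (pmf_of_set {0..<p}). d < p"
        using p by (auto simp: AE_measure_pmf_iff)
      then show "AE f in digit_meas p N m. f i < p" by (rule digit_prod.AE_component[OF i])
    qed
  qed simp
  then show ?thesis by (simp add: digit_emb_in_qmat_space_iff[OF p])
qed

text \<open>Cylinders of distinct residue matrices are disjoint and have probability
  \<open>1 / p ^ (n * N * N)\<close> each, which cancels the power of \<open>p\<close> in
  \<open>card_mats_profile\<close>.\<close>

lemma level_vol_profile_set:
  assumes p: "prime p" and c: "c 0 = N"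
  shows "level_vol p N m (profile_set p N m n c) = ennreal (\<Prod>i<n. Pker p 0 (c i) (c (Suc i)))"
proof -
  have p0: "p > 0" using p by (rule prime_gt_0_nat)
  let ?P = "digit_meas p N m"
  let ?V = "profile_mats p N n c"
  define Cyl where "Cyl A = {f \<in> space ?P. has_digits p N m n A (digit_emb N m f)}" for A
  note Cyl = emeasure_has_digits[OF p0, of N m n, folded Cyl_def]
  have disj: "disjoint_family_on Cyl ?V"
    unfolding disjoint_family_on_def
  proof (intro ballI impI)
    fix A A' assume A: "A \<in> ?V" "A' \<in> ?V" "A \<noteq> A'"
    show "Cyl A \<inter> Cyl A' = {}"
    proof (rule ccontr)
      assume "Cyl A \<inter> Cyl A' \<noteq> {}"
      then obtain f where f: "has_digits p N m n A (digit_emb N m f)" "has_digits p N m n A' (digit_emb N m f)"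
        by (auto simp: Cyl_def)
      have P: "A \<in> {..<N} \<times> {..<N} \<rightarrow>\<^sub>E {0..<int p ^ n}" "A' \<in> {..<N} \<times> {..<N} \<rightarrow>\<^sub>E {0..<int p ^ n}"
        using A unfolding profile_mats_def by blast+
      have "A z = A' z" if z: "z \<in> {..<N} \<times> {..<N}" for z
      proof -
        obtain a b where ab: "z = (a, b)" "a \<in> {..<N}" "b \<in> {..<N}" using z by auto
        have "nat (A z div int p ^ i mod int p) = nat (A' z div int p ^ i mod int p)" if i: "i < n" for i
        proof -
          have "i \<in> {..<n}" using i by simp
          then have "digit_emb N m f a b (int i - int m) = nat (A (a, b) div int p ^ i mod int p)"
            "digit_emb N m f a b (int i - int m) = nat (A' (a, b) div int p ^ i mod int p)"
            using f ab(2,3) unfolding has_digits_def by blast+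
          then show ?thesis unfolding ab(1) by simp
        qed
        then have "trunc p n (\<lambda>i. nat (A z div int p ^ i mod int p)) = trunc p n (\<lambda>i. nat (A' z div int p ^ i mod int p))"
          by (rule trunc_cong)
        then have "A z mod int p ^ n = A' z mod int p ^ n" unfolding trunc_digits[OF p0] .
        moreover have "A z \<in> {0..<int p ^ n}" "A' z \<in> {0..<int p ^ n}"
          using PiE_mem[OF P(1) z] PiE_mem[OF P(2) z] .
        ultimately show ?thesis by simp
      qed
      then have "A = A'" by (rule PiE_ext[OF P])
      then show False using A by simp
    qed
  qed
  have "level_vol p N m (profile_set p N m n c) = emeasure ?P (\<Union>A\<in>?V. Cyl A)"
    unfolding level_vol_def
  proof (rule emeasure_eq_AE)
    \<comment> \<open>The two sets can differ only where some digit is at least \<open>p\<close>,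
      which is a null event.\<close>
    show "AE f in ?P. f \<in> digit_emb N m -` profile_set p N m n c \<inter> space ?P \<longleftrightarrow> f \<in> (\<Union>A\<in>?V. Cyl A)"
      using AE_digit_emb[OF p0]
    proof eventually_elim
      case (elim f)
      show ?case using profile_qtrunc_iff[OF p0 elim, of n m c] elim by (auto simp: profile_set_def Cyl_def)
    qed
    show "digit_emb N m -` profile_set p N m n c \<inter> space ?P \<in> sets ?P"
      by (rule sets_digit_emb_vimage[OF p0 profile_set_in_qmat_sets[OF p0]])
    show "(\<Union>A\<in>?V. Cyl A) \<in> sets ?P" using Cyl(1) finite_profile_mats by (intro sets.finite_UN) auto
  qed
  also have "\<dots> = (\<Sum>A\<in>?V. emeasure ?P (Cyl A))"
    using Cyl(1) disj finite_profile_mats by (intro sum_emeasure[symmetric]) auto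
  also have "\<dots> = ennreal (real (card ?V) * (1 / real p ^ (n * N * N)))"
    by (simp add: Cyl(2) ennreal_mult[symmetric] ennreal_of_nat_eq_real_of_nat)
  also have "real (card ?V) = real p ^ (n * N * N) * (\<Prod>i<n. Pker p 0 (c i) (c (Suc i)))"
    using card_mats_profile[OF p, of "{..<N}" "{..<N}" c n] c unfolding profile_mats_def by simp
  finally show ?thesis using p0 by simp
qed

text \<open>The profile events decrease in \<open>n\<close> to the event for \<open>Sing\<close>.
  Continuity from above gives its probability and, at the same time, the existence of the limit
  \<open>L\<close>.\<close>

lemma level_vol_Sing:
  assumes p: "prime p" and k: "k \<in> Delta N" "\<And>v. v \<in> set k \<Longrightarrow> v \<le> ereal (real m)"
    and meas: "{Z \<in> qmat_space p N. Sing p N Z = k} \<in> qmat_sets p N"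
  obtains L where "(\<lambda>n. \<Prod>i<n. Pker p 0 (kcount k (int m - int i)) (kcount k (int m - int (Suc i)))) \<longlonglongrightarrow> L"
    "0 \<le> L" "level_vol p N m {Z \<in> qmat_space p N. Sing p N Z = k} = ennreal L"
proof -
  have p0: "p > 0" and p1: "p > 1" using prime_gt_0_nat[OF p] prime_gt_1_nat[OF p] by auto
  let ?P = "digit_meas p N m"
  define c where "c i = kcount k (int m - int i)" for i
  have "filter (\<lambda>v. v \<le> ereal (of_int (int m))) k = k" using k(2) by (auto simp: filter_id_conv)
  then have c0: "c 0 = N" using k(1) by (simp add: c_def kcount_def Delta_def)
  define E where "E n = digit_emb N m -` profile_set p N m n c \<inter> space ?P" for n
  have E: "E n \<in> sets ?P" for n
    unfolding E_def by (rule sets_digit_emb_vimage[OF p0 profile_set_in_qmat_sets[OF p0]])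
  have em: "emeasure ?P (E n) = ennreal (\<Prod>i<n. Pker p 0 (c i) (c (Suc i)))" for n
    using level_vol_profile_set[OF p, of c N m n, OF c0] unfolding level_vol_def E_def .
  have dec: "profile p n {..<N} {..<N} (qtrunc p m n Z) c"
    if "profile p (Suc n) {..<N} {..<N} (qtrunc p m (Suc n) Z) c" for n Z
  proof -
    have "profile p n {..<N} {..<N} (qtrunc p m (Suc n) Z) c" using that by (auto simp: profile_def)
    moreover have "profile p n {..<N} {..<N} (qtrunc p m n Z) c \<longleftrightarrow> profile p n {..<N} {..<N} (qtrunc p m (Suc n) Z) c"
      by (rule profile_cong) (simp add: qtrunc_def trunc_Suc cong_iff_dvd_diff)
    ultimately show ?thesis by simp
  qed
  have "decseq E" by (rule decseq_SucI) (auto simp: E_def profile_set_def dest: dec)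
  then have lim: "(\<lambda>n. emeasure ?P (E n)) \<longlonglongrightarrow> emeasure ?P (\<Inter>n. E n)"
    using E em by (intro Lim_emeasure_decseq) auto
  have S: "digit_emb N m -` {Z \<in> qmat_space p N. Sing p N Z = k} \<inter> space ?P = (\<Inter>n. E n)"
  proof -
    have "Sing p N (digit_emb N m f) = k \<longleftrightarrow>
       (\<forall>n. profile p n {..<N} {..<N} (qtrunc p m n (digit_emb N m f)) c)" for f
      unfolding c_def by (rule Sing_eq_iff[OF p _ k]) (simp add: digit_emb_def digit_idx_def)
    then show ?thesis by (auto simp: E_def profile_set_def)
  qed
  define L where "L = measure ?P (\<Inter>n. E n)"
  have L: "emeasure ?P (\<Inter>n. E n) = ennreal L" "0 \<le> L"
    by (simp_all add: L_def digit_prod.emeasure_eq_measure)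
  have "Pker p 0 x y \<ge> 0" for x y
    using Pker_pos[OF p1, of 0 y x] by (cases "y \<le> x") (auto simp: Pker_def)
  then have nonneg: "(\<Prod>i<n. Pker p 0 (c i) (c (Suc i))) \<ge> 0" for n by (intro prod_nonneg) auto
  have "(\<lambda>n. \<Prod>i<n. Pker p 0 (c i) (c (Suc i))) \<longlonglongrightarrow> L"
    using lim L(2) nonneg unfolding em L(1) by (simp add: tendsto_ennreal_iff)
  then show ?thesis using that[of L] L S unfolding c_def level_vol_def by simp
qed

section \<open>Measurability of the singular numbers\<close>

lemma Delta_bounded:
  assumes "k \<in> Delta N"
  obtains m where "\<And>v. v \<in> set k \<Longrightarrow> v \<le> ereal (real m)"
proof -
  have "\<exists>m. v \<le> ereal (real m)" if "v \<in> set k" for v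
  proof (cases rule: DeltaE[OF assms that])
    case (2 i)
    then show ?thesis by (intro exI[of _ "nat i"]) simp
  qed simp
  then obtain g where g: "\<And>v. v \<in> set k \<Longrightarrow> v \<le> ereal (real (g v))" by metis
  have "v \<le> ereal (real (Max (insert 0 (g ` set k))))" if "v \<in> set k" for v
  proof -
    have "g v \<le> Max (insert 0 (g ` set k))" using that by (intro Max_ge) auto
    then have "ereal (real (g v)) \<le> ereal (real (Max (insert 0 (g ` set k))))" by simp
    with g[OF that] show ?thesis by (rule order_trans)
  qed
  then show ?thesis by (rule that)
qed

text \<open>On matrices with digits from \<open>- m\<close> on, \<open>Sing_eq_iff\<close> expresses
  the event by countably many digit conditions, provided that \<open>m\<close> bounds
  \<open>k\<close>. Every matrix is covered by some such \<open>m\<close>.\<close>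

lemma Sing_set_in_qmat_sets:
  assumes p: "prime p" and k: "k \<in> Delta N"
  shows "{Z \<in> qmat_space p N. Sing p N Z = k} \<in> qmat_sets p N"
proof -
  have p0: "p > 0" using p by (rule prime_gt_0_nat)
  obtain m0 where m0: "\<And>v. v \<in> set k \<Longrightarrow> v \<le> ereal (real m0)" using Delta_bounded[OF k] by blast
  define c where "c m i = kcount k (int m - int i)" for m i
  define S where "S m = {Z \<in> qmat_space p N. \<forall>a. \<forall>b. \<forall>j\<in>{..<- int m}. Z a b j = 0} \<inter> (\<Inter>n. profile_set p N m n (c m))" for m
  have iff: "Sing p N Z = k \<longleftrightarrow> (\<forall>n. profile p n {..<N} {..<N} (qtrunc p m n Z) (c m))"
    if "m \<ge> m0" "\<And>a b j. j < - int m \<Longrightarrow> Z a b j = 0" for m Z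
    unfolding c_def
  proof (rule Sing_eq_iff[OF p that(2) k])
    fix v assume "v \<in> set k"
    then have "v \<le> ereal (real m0)" by (rule m0)
    also have "\<dots> \<le> ereal (real m)" using that(1) by simp
    finally show "v \<le> ereal (real m)" .
  qed
  have "{Z \<in> qmat_space p N. Sing p N Z = k} = (\<Union>m\<in>{m0..}. S m)"
  proof (intro equalityI subsetI)
    fix Z assume Z: "Z \<in> {Z \<in> qmat_space p N. Sing p N Z = k}"
    then obtain m1 :: nat where m1: "\<forall>a b j. j < - int m1 \<longrightarrow> Z a b j = 0" by (auto simp: qmat_space_def)
    define m where "m = max m0 m1"
    have m: "m \<ge> m0" "\<And>a b j. j < - int m \<Longrightarrow> Z a b j = 0" using m1 by (auto simp: m_def)
    then have "Z \<in> S m" using Z iff[OF m] by (auto simp: S_def profile_set_def)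
    then show "Z \<in> (\<Union>m\<in>{m0..}. S m)" using m(1) by auto
  next
    fix Z assume "Z \<in> (\<Union>m\<in>{m0..}. S m)"
    then obtain m where m: "m \<ge> m0" "Z \<in> S m" by auto
    then have "Sing p N Z = k" by (intro iff[OF m(1), THEN iffD2]) (auto simp: S_def profile_set_def)
    then show "Z \<in> {Z \<in> qmat_space p N. Sing p N Z = k}" using m(2) by (auto simp: S_def)
  qed
  also have "\<dots> \<in> qmat_sets p N"
  proof -
    have "S m \<in> qmat_sets p N" for m
    proof -
      have "{Z \<in> qmat_space p N. \<forall>a. \<forall>b. \<forall>j\<in>{..<- int m}. Z a b j = 0} \<in> qmat_sets p N"
        by (rule qmat_sigma.sets_Collect_countable_All, rule qmat_sigma.sets_Collect_countable_All,
            rule qmat_sigma.sets_Collect_countable_All', rule digit_set_in_qmat_sets, rule countableI_type)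
      moreover have "(\<Inter>n. profile_set p N m n (c m)) \<in> qmat_sets p N"
        using profile_set_in_qmat_sets[OF p0] by (intro qmat_sigma.countable_INT image_subsetI) auto
      ultimately show ?thesis unfolding S_def by (rule qmat_sigma.Int)
    qed
    then show ?thesis by (intro qmat_sigma.countable_UN image_subsetI)
  qed
  finally show ?thesis .
qed

lemma countable_Delta: "countable (Delta N)"
proof -
  have "Delta N \<subseteq> lists (insert (-\<infinity>) (range (\<lambda>i::int. ereal (of_int i))))"
    by (auto simp: Delta_def lists_eq_set)
  then show ?thesis by (rule countable_subset) (intro countable_lists countable_insert countable_image, simp)
qed

text \<open>The density depends on \<open>Z\<close> through \<open>Sing\<close> alone, so this makes
  it measurable; as \<open>Delta N\<close> is countable, it suffices to treat the fibres.\<close>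

lemma measurable_Sing:
  assumes "prime p"
  shows "Sing p N \<in> measurable (vol p N) (count_space (Delta N))"
proof (subst measurable_count_space_eq_countable[OF countable_Delta], intro conjI ballI)
  show "Sing p N \<in> space (vol p N) \<rightarrow> Delta N" using Sing_in_Delta[OF assms] by simp
  fix k assume "k \<in> Delta N"
  then have "{Z \<in> qmat_space p N. Sing p N Z = k} \<in> qmat_sets p N" by (rule Sing_set_in_qmat_sets[OF assms])
  also have "{Z \<in> qmat_space p N. Sing p N Z = k} = Sing p N -` {k} \<inter> space (vol p N)" by auto
  finally show "Sing p N -` {k} \<inter> space (vol p N) \<in> sets (vol p N)" by simp
qed

lemma Mconst_pos:
  assumes "p > 1" "s > -1"
  shows "Mconst p N s > 0"
proof -
  have "real p powr (-1-s) < 1" using assms by (simp add: powr_less_one)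
  then have "qpoch (real p powr (-1-s)) (1/p) n > 0" for n using assms by (intro qpoch_pos) auto
  then show ?thesis unfolding Mconst_def by (intro divide_pos_pos zero_less_power)
qed

text \<open>The density is constant on each fibre of \<open>Sing\<close>, so the mass of
  \<open>k\<close> is that constant times a volume.\<close>

lemma mmeas_eq:
  assumes p: "prime p" and s: "s > -1" and k: "k \<in> Delta N"
  shows "mmeas p N s k = ennreal (Mconst p N s * kgamma p N k powr (- s - 2 * real N))
     * emeasure (vol p N) {Z \<in> qmat_space p N. Sing p N Z = k}"
proof -
  let ?S = "{Z \<in> qmat_space p N. Sing p N Z = k}"
  define h where "h k = ennreal (Mconst p N s * kgamma p N k powr (- s - 2 * real N))" for k
  have g: "ennreal (Mconst p N s * gammaZ p N Z powr (- s - 2 * real N)) = h (Sing p N Z)" for Z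
    by (simp add: h_def gammaZ_def kgamma_def Let_def)
  have S: "?S \<in> sets (vol p N)" using Sing_set_in_qmat_sets[OF p k] by simp
  have "mmeas p N s k = emeasure (density (vol p N) (\<lambda>Z. h (Sing p N Z))) ?S"
    unfolding mmeas_def Mmeas_def g by (intro arg_cong2[where f = emeasure] refl) auto
  also have "\<dots> = (\<integral>\<^sup>+ Z. h (Sing p N Z) * indicator ?S Z \<partial>vol p N)"
    using S by (intro emeasure_density measurable_compose[OF measurable_Sing[OF p]]) simp_all
  also have "\<dots> = (\<integral>\<^sup>+ Z. h k * indicator ?S Z \<partial>vol p N)"
    by (intro nn_integral_cong) (auto simp: indicator_def)
  also have "\<dots> = h k * emeasure (vol p N) ?S" using S by (rule nn_integral_cmult_indicator)
  finally show ?thesis unfolding h_def .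
qed

theorem theorem3p4:
  fixes p N :: nat and s :: real
  assumes "prime p" and "s > -1"
  shows "((\<forall>x\<le>N. pitilde p N s x \<ge> 0) \<and> (\<Sum>x\<le>N. pitilde p N s x) = 1) \<and>
         (\<forall>k\<in>Delta N.
           (let x = (\<lambda>i::nat. ltail k (int i));
                y = (\<lambda>i::nat. N - ltail k (- int i))
            in mmeas p N s k =
                 ennreal (pitilde p N s (x 0)
                   * lim (\<lambda>n. \<Prod>i<n. Pker p s (x i) (x (Suc i)))
                   * lim (\<lambda>n. \<Prod>i<n. Pker p 0 (y i) (y (Suc i))))))"
proof (intro conjI ballI)
  show "\<forall>x\<le>N. pitilde p N s x \<ge> 0" using pitilde_nonneg[OF assms] by blast
  show "(\<Sum>x\<le>N. pitilde p N s x) = 1" by (rule sum_pitilde[OF assms])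
  fix k assume k: "k \<in> Delta N"
  have p0: "p > 0" and p1: "p > 1" using prime_gt_0_nat[OF assms(1)] prime_gt_1_nat[OF assms(1)] by auto
  define rhs where "rhs = pitilde p N s (ltail k (int 0))
      * lim (\<lambda>n. \<Prod>i<n. Pker p s (ltail k (int i)) (ltail k (int (Suc i))))
      * lim (\<lambda>n. \<Prod>i<n. Pker p 0 (N - ltail k (- int i)) (N - ltail k (- int (Suc i))))"
  let ?S = "{Z \<in> qmat_space p N. Sing p N Z = k}"
  have S: "?S \<in> qmat_sets p N" by (rule Sing_set_in_qmat_sets[OF assms(1) k])
  obtain m0 where m0: "\<And>v. v \<in> set k \<Longrightarrow> v \<le> ereal (real m0)" using Delta_bounded[OF k] by blast
  define G where "G = Mconst p N s * kgamma p N k powr (- s - 2 * real N)"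
  have "kgamma p N k > 0" unfolding kgamma_def using p0 by (intro prod_pos) auto
  then have G: "G > 0" unfolding G_def using Mconst_pos[OF p1 assms(2)] by simp
  \<comment> \<open>The right side is free of \<open>m\<close>: once \<open>m\<close> bounds the
    entries of \<open>k\<close>, the scaled level volumes are constant, and their increasing
    supremum is this constant.\<close>
  have lev: "ennreal (real p ^ (m * N * N)) * level_vol p N m ?S = ennreal (rhs / G)" if "m \<ge> m0" for m
  proof -
    have mk: "v \<le> ereal (real m)" if "v \<in> set k" for v
    proof -
      have "v \<le> ereal (real m0)" using that by (rule m0)
      also have "\<dots> \<le> ereal (real m)" using \<open>m \<ge> m0\<close> by simp
      finally show ?thesis .
    qed
    obtain L where L: "(\<lambda>n. \<Prod>i<n. Pker p 0 (kcount k (int m - int i)) (kcount k (int m - int (Suc i)))) \<longlonglongrightarrow> L"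
      "0 \<le> L" "level_vol p N m ?S = ennreal L"
      using level_vol_Sing[OF assms(1) k mk S] by blast
    have "G * (real p ^ (m * N * N) * L) = rhs"
      unfolding G_def rhs_def by (rule level_identity[OF p1 assms(2) k mk L(1)])
    then have "rhs / G = real p ^ (m * N * N) * L" using G by (simp add: field_simps)
    then show ?thesis using L by (simp add: ennreal_mult)
  qed
  have "(\<lambda>m. ennreal (real p ^ (m * N * N)) * level_vol p N m ?S) \<longlonglongrightarrow> ennreal (rhs / G)"
    by (intro tendsto_eventually eventually_sequentiallyI[of m0] lev)
  moreover have "(\<lambda>m. ennreal (real p ^ (m * N * N)) * level_vol p N m ?S) \<longlonglongrightarrow> emeasure (vol p N) ?S"
    unfolding emeasure_vol[OF p0 S] by (rule LIMSEQ_SUP[OF scaled_level_vol_mono[OF p0 S]])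
  ultimately have "emeasure (vol p N) ?S = ennreal (rhs / G)" using LIMSEQ_unique by blast
  then have "mmeas p N s k = ennreal G * ennreal (rhs / G)"
    using mmeas_eq[OF assms k] by (simp add: G_def)
  also have "\<dots> = ennreal rhs" using G by (simp add: ennreal_mult''[symmetric] ennreal_mult'[symmetric])
  finally show "let x = (\<lambda>i::nat. ltail k (int i));
                y = (\<lambda>i::nat. N - ltail k (- int i))
            in mmeas p N s k =
                 ennreal (pitilde p N s (x 0)
                   * lim (\<lambda>n. \<Prod>i<n. Pker p s (x i) (x (Suc i)))
                   * lim (\<lambda>n. \<Prod>i<n. Pker p 0 (y i) (y (Suc i))))"
    unfolding Let_def rhs_def .
qed

end
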